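(* Let $\Omega\subset\mathbb{R}^N$ be a bounded domain with $C^{1,1}$ boundary, let $1<q\le p<\infty$ and $0<s_2\le s_1<1$. Let $g\in C(\mathbb{R})\cap BV_{\mathrm{loc}}(\mathbb{R})$ and let $u\in W^{s_1,p}_0(\Omega)\cap C(\overline\Omega)$ be such that $$(-\Delta)^{s_1}_pu+(-\Delta)^{s_2}_qu+g(u)\ge g(0)\quad\text{weakly in }\Omega.$$ Assume further that $u\not\equiv0$ and $u\ge0$ in $\Omega$. Then there exists $c_1>0$ such that $u\ge c_1\,\mathrm{dist}(\cdot,\partial\Omega)^{s_1}$ in $\Omega$.
   Context: Notation: $[t]^{m}:=|t|^{m-1}t$ for $m>0$, $t\in\mathbb{R}$ (with $[0]^m=0$). For $E\subset\mathbb{R}^N$, $1\le m<\infty$, $s\in(0,1)$, $W^{s,m}(E)=\{u\in L^m(E): [u]_{W^{s,m}(E)}<\infty\}$ with $[u]_{W^{s,m}(E)}=\big(\int_E\int_E\frac{|u(x)-u(y)|^m}{|x-y|^{N+sm}}dxdy\big)^{1/m}$. $W^{s,m}_0(\Omega)=\{u\in W^{s,m}(\mathbb{R}^N):u=0\text{ in }\mathbb{R}^N\setminus\Omega\}$. Set $\mathcal{W}(E)=W^{s_1,p}(E)\cap W^{s_2,q}(E)$; $u\in\mathcal{W}_{\mathrm{loc}}(\Omega)$ means $u\in\mathcal{W}(E)$ for all $E\Subset\Omega$. When $s_2<s_1$ and $q\le p$, $W^{s_1,p}_0(\Omega)$ embeds continuously in $W^{s_2,q}_0(\Omega)$. $BV_{\mathrm{loc}}(\mathbb{R})$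 is the space of functions of locally bounded variation on $\mathbb{R}$. The fractional operator is $(-\Delta)^s_m u(x)=2\lim_{\varepsilon\to0}\int_{\mathbb{R}^N\setminus B_\varepsilon(x)}\frac{|u(x)-u(y)|^{m-2}(u(x)-u(y))}{|x-y|^{N+ms}}dy$, understood weakly: for $(\ell,s)\in\{(p,s_1),(q,s_2)\}$ let $$A_\ell(u,\phi)=\int_{\mathbb{R}^N\times\mathbb{R}^N}\frac{[u(x)-u(y)]^{\ell-1}(\phi(x)-\phi(y))}{|x-y|^{N+\ell s}}dxdy.$$ The inequality "weakly in $\Omega$" means that ($u$ belonging to $\mathcal{W}_{\mathrm{loc}}(\Omega)$) $A_p(u,\phi)+A_q(u,\phi)+\int_\Omega g(u)\phi\,dx\ge\int_\Omega g(0)\phi\,dx$ for every nonnegative $\phi\in\mathcal{W}(\Omega)$ with compact support contained in $\Omega$ (extended by $0$ outside $\Omega$). *)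

theory Defs
  imports "HOL-Analysis.Analysis"
begin

definition signed_pow :: "real \<Rightarrow> real \<Rightarrow> real" where
  "signed_pow t m = \<bar>t\<bar> powr (m - 1) * t"

definition L_space :: "'a::euclidean_space set \<Rightarrow> real \<Rightarrow> ('a \<Rightarrow> real) set" where
  "L_space E m = {u. u \<in> borel_measurable (lebesgue_on E) \<and>
                     integrable (lebesgue_on E) (\<lambda>x. \<bar>u x\<bar> powr m)}"

text \<open>The \<open>m\<close>-th power of the Gagliardo seminorm of \<open>W\<^sup>s\<^sup>,\<^sup>m(E)\<close>, where \<open>N = DIM('a)\<close>.
  The integrand is \<open>0\<close> on the (null) diagonal, since \<open>0 / 0 = 0\<close>.\<close>

definition gagliardo_energy :: "'a::euclidean_space set \<Rightarrow> real \<Rightarrow> real \<Rightarrow> ('a \<Rightarrow> real) \<Rightarrow> ennreal" where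
  "gagliardo_energy E s m u =
     (\<integral>\<^sup>+ x. (\<integral>\<^sup>+ y. ennreal (\<bar>u x - u y\<bar> powr m / norm (x - y) powr (real DIM('a) + s * m))
        \<partial>lebesgue_on E) \<partial>lebesgue_on E)"

definition frac_Sobolev :: "'a::euclidean_space set \<Rightarrow> real \<Rightarrow> real \<Rightarrow> ('a \<Rightarrow> real) set" where
  "frac_Sobolev E s m = {u \<in> L_space E m. gagliardo_energy E s m u < \<infinity>}"

text \<open>Elements of Sobolev spaces are classes modulo null sets, so the exterior condition is
  required almost everywhere only. In particular it says nothing about the values on
  \<open>frontier \<Omega>\<close> when that set is null.\<close>

definition frac_Sobolev_0 :: "'a::euclidean_space set \<Rightarrow> real \<Rightarrow> real \<Rightarrow> ('a \<Rightarrow> real) set" where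
  "frac_Sobolev_0 \<Omega> s m = {u \<in> frac_Sobolev UNIV s m. AE x in lebesgue. x \<notin> \<Omega> \<longrightarrow> u x = 0}"

definition W_space ::
  "real \<Rightarrow> real \<Rightarrow> real \<Rightarrow> real \<Rightarrow> 'a::euclidean_space set \<Rightarrow> ('a \<Rightarrow> real) set" where
  "W_space s1 p s2 q E = frac_Sobolev E s1 p \<inter> frac_Sobolev E s2 q"

definition W_loc ::
  "real \<Rightarrow> real \<Rightarrow> real \<Rightarrow> real \<Rightarrow> 'a::euclidean_space set \<Rightarrow> ('a \<Rightarrow> real) set" where
  "W_loc s1 p s2 q \<Omega> =
     {u. \<forall>E \<in> sets lebesgue. compact (closure E) \<and> closure E \<subseteq> \<Omega> \<longrightarrow> u \<in> W_space s1 p s2 q E}"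

definition frac_form :: "real \<Rightarrow> real \<Rightarrow> ('a::euclidean_space \<Rightarrow> real) \<Rightarrow> ('a \<Rightarrow> real) \<Rightarrow> real" where
  "frac_form s l u \<phi> =
     (LINT z | (lebesgue \<Otimes>\<^sub>M lebesgue).
        signed_pow (u (fst z) - u (snd z)) (l - 1) * (\<phi> (fst z) - \<phi> (snd z))
          / norm (fst z - snd z) powr (real DIM('a) + l * s))"

text \<open>Test functions are given on the whole space, being zero off a compact subset of \<open>\<Omega>\<close>;
  this is the extension by zero.\<close>

definition test_functions ::
  "real \<Rightarrow> real \<Rightarrow> real \<Rightarrow> real \<Rightarrow> 'a::euclidean_space set \<Rightarrow> ('a \<Rightarrow> real) set" where
  "test_functions s1 p s2 q \<Omega> =
     {\<phi> \<in> W_space s1 p s2 q \<Omega>. (\<forall>x. 0 \<le> \<phi> x) \<and>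
        compact (closure {x. \<phi> x \<noteq> 0}) \<and> closure {x. \<phi> x \<noteq> 0} \<subseteq> \<Omega>}"

text \<open>The inequality \<open>(-\<Delta>)\<^sub>p\<^sup>s\<^sup>1 u + (-\<Delta>)\<^sub>q\<^sup>s\<^sup>2 u + g(u) \<ge> g(0)\<close>, weakly in \<open>\<Omega>\<close>. For bounded \<open>\<Omega>\<close>,
  continuous \<open>g\<close> and \<open>u \<in> W\<^sup>s\<^sup>1\<^sup>,\<^sup>p\<^sub>0(\<Omega>) \<inter> C(closure \<Omega>) \<inter> W\<^sub>l\<^sub>o\<^sub>c(\<Omega>)\<close> all four integrals converge
  absolutely, so the default value of the Bochner integral plays no role.\<close>

definition weak_supersolution ::
  "real \<Rightarrow> real \<Rightarrow> real \<Rightarrow> real \<Rightarrow> (real \<Rightarrow> real) \<Rightarrow> 'a::euclidean_space set \<Rightarrow> ('a \<Rightarrow> real) \<Rightarrow> bool" where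
  "weak_supersolution s1 p s2 q g \<Omega> u \<longleftrightarrow>
     u \<in> W_loc s1 p s2 q \<Omega> \<and>
     (\<forall>\<phi> \<in> test_functions s1 p s2 q \<Omega>.
        frac_form s1 p u \<phi> + frac_form s2 q u \<phi> + (LINT x:\<Omega>|lebesgue. g (u x) * \<phi> x)
          \<ge> (LINT x:\<Omega>|lebesgue. g 0 * \<phi> x))"

definition BV_loc :: "(real \<Rightarrow> real) set" where
  "BV_loc = {g. \<forall>a b. \<exists>M. \<forall>(n::nat) (t::nat \<Rightarrow> real).
     (\<forall>i<n. t i \<le> t (Suc i)) \<and> (\<forall>i\<le>n. t i \<in> {a..b}) \<longrightarrow>
       (\<Sum>i<n. \<bar>g (t (Suc i)) - g (t i)\<bar>) \<le> M}"

definition C11_function :: "('a::euclidean_space \<Rightarrow> real) \<Rightarrow> bool" where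
  "C11_function \<gamma> \<longleftrightarrow>
     (\<exists>(\<gamma>' :: 'a \<Rightarrow> 'a \<Rightarrow>\<^sub>L real) L.
        (\<forall>x. (\<gamma> has_derivative blinfun_apply (\<gamma>' x)) (at x)) \<and> L-lipschitz_on UNIV \<gamma>')"

text \<open>Near each boundary point, \<open>\<Omega>\<close> is the set above a \<open>C\<^sup>1\<^sup>,\<^sup>1\<close> graph in some orthonormal frame.
  The unit vector \<open>e\<close> is the vertical axis, and \<open>y - (y \<bullet> e) *\<^sub>R e\<close> is the projection of \<open>y\<close> to the
  horizontal hyperplane; only the values of \<open>\<gamma>\<close> on that hyperplane matter, and every \<open>C\<^sup>1\<^sup>,\<^sup>1\<close>
  function there extends to the whole space (constantly in direction \<open>e\<close>).\<close>

definition C11_boundary :: "'a::euclidean_space set \<Rightarrow> bool" where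
  "C11_boundary \<Omega> \<longleftrightarrow>
     (\<forall>x0 \<in> frontier \<Omega>. \<exists>r>0. \<exists>e \<gamma>. norm e = 1 \<and> C11_function \<gamma> \<and>
        (\<forall>y \<in> ball x0 r. y \<in> \<Omega> \<longleftrightarrow> \<gamma> (y - (y \<bullet> e) *\<^sub>R e) < y \<bullet> e))"

end

theory Submission
  imports Defs
begin

text \<open>Let a ball of radius \<open>r\<close> and centre \<open>z\<close> lie in \<open>\<Omega>\<close>, and let \<open>u \<ge> 2 \<eta>\<close> on the concentric ball of
radius \<open>r / 2\<close>. The barrier is \<open>W x = c * (r\<^sup>2 - |x - z|\<^sup>2)\<^sub>+ powr s1\<close> with a small \<open>c\<close>, and the test
function is \<open>\<phi> = (W - u)\<^sub>+\<close>, which lives in the annulus between the two balls. Since \<open>\<phi>\<close> is a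
nondecreasing function of \<open>W - u\<close>, each pair of points contributes at most as much to the form of \<open>u\<close>
against \<open>\<phi>\<close> as to the form of \<open>W\<close> against \<open>\<phi>\<close>. Pairs that join the support of \<open>\<phi>\<close> to the inner ball
do better: \<open>u\<close> rises there by at least \<open>\<eta>\<close> while \<open>W\<close> varies by a multiple of \<open>c\<close>, so the \<open>p\<close>-form of
\<open>u\<close> falls below that of \<open>W\<close> by \<open>\<kappa> * \<integral>\<phi>\<close>, where \<open>\<kappa> > 0\<close> does not depend on \<open>c\<close>. The forms of \<open>W\<close> are at
most \<open>C * c powr (p - 1) * \<integral>\<phi>\<close> and \<open>C * c powr (q - 1) * \<integral>\<phi>\<close>, and \<open>g(u) - g(0)\<close> is small where \<open>\<phi> > 0\<close>,
because \<open>0 \<le> u < W\<close> there. For small \<open>c\<close> the supersolution inequality therefore forces \<open>\<integral>\<phi> = 0\<close>, that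
is \<open>u \<ge> W\<close>, with a constant \<open>c\<close> independent of \<open>z\<close> (\<open>interior_ball_lower_bound\<close>).

The bound on the forms of \<open>W\<close> is an upper bound for the two operators on the barrier
(\<open>ball_profile_operator_bound\<close>). Along a line, \<open>r\<^sup>2 - |x|\<^sup>2\<close> is a quadratic polynomial, so after an affine
change of variable the barrier is \<open>((1 + t) (1 - \<epsilon> t))\<^sub>+ powr \<beta>\<close> with \<open>\<beta> = s1\<close>. For \<open>\<epsilon> = 0\<close> this is the
half-line function \<open>(1 + t)\<^sub>+ powr \<beta>\<close>: pairing \<open>1 + t\<close> with \<open>1 / (1 + t)\<close> shows that the operator of order
\<open>s\<close> vanishes on it for \<open>\<beta> = s\<close> and is nonpositive for \<open>\<beta> \<ge> s\<close>, which covers both \<open>s1\<close> and \<open>s2\<close>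
(\<open>has_integral_half_line_harmonic\<close>). For \<open>\<epsilon> > 0\<close> the inversion is replaced by the Moebius involution of
the chord, and the error is of the exact order in \<open>\<epsilon>\<close> that the rescaling of the chord can absorb
(\<open>chord_pair_integral\<close>, \<open>chord_bound\<close>). Chords through \<open>x\<close> that are nearly orthogonal to \<open>x\<close> cost a
factor \<open>|x \<bullet> \<omega>| powr - (2 - m)\<close> when the exponent \<open>m\<close> is below \<open>2\<close>; as \<open>m > 1\<close>, this is integrable over
directions.

The lower bound on balls yields \<open>u > 0\<close> in \<open>\<Omega>\<close>: otherwise a ball centred at a point of positivity
reaches a zero of \<open>u\<close> (\<open>strong_minimum_principle\<close>). Finally a point at height \<open>t\<close> above the boundary graph
lies in a ball of fixed radius that touches the graph at the foot of the vertical through the point, and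
there \<open>r\<^sup>2 - |x - z|\<^sup>2\<close> is bounded below by a multiple of \<open>t\<close>, hence of the distance to the boundary
(\<open>hopf_near_boundary_point\<close>). Compactness of the closure of \<open>\<Omega>\<close> makes the constant uniform.\<close>

section \<open>Increments of signed powers\<close>

lemma signed_pow_nonneg: "0 \<le> t \<Longrightarrow> signed_pow t m = t powr m"
  using powr_mult_base[of t "m - 1"] by (cases "t = 0") (auto simp: signed_pow_def mult.commute)

lemma signed_pow_minus: "signed_pow (- t) m = - signed_pow t m"
  by (simp add: signed_pow_def)

lemma signed_pow_nonpos: "t \<le> 0 \<Longrightarrow> signed_pow t m = - ((- t) powr m)"
  using signed_pow_minus[of "- t" m] signed_pow_nonneg[of "- t" m] by simp

lemma abs_signed_pow: "\<bar>signed_pow t m\<bar> = \<bar>t\<bar> powr m"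
  by (cases "0 \<le> t") (auto simp: signed_pow_nonneg signed_pow_nonpos)

lemma signed_pow_mono:
  assumes "0 < m" "x \<le> y"
  shows "signed_pow x m \<le> signed_pow y m"
proof -
  consider "0 \<le> x" | "y \<le> 0" | "x < 0" "0 < y" by linarith
  then show ?thesis
  proof cases
    case 1
    then show ?thesis using assms by (simp add: signed_pow_nonneg powr_mono2)
  next
    case 2
    then show ?thesis using assms by (simp add: signed_pow_nonpos powr_mono2)
  next
    case 3
    then have "signed_pow x m \<le> 0" "0 \<le> signed_pow y m"
      by (simp_all add: signed_pow_nonpos signed_pow_nonneg)
    then show ?thesis by linarith
  qed
qed

lemma signed_pow_mult: "0 \<le> c \<Longrightarrow> signed_pow (c * t) m = c powr m * signed_pow t m"
  using powr_mult_base[of c "m - 1"] by (simp add: signed_pow_def abs_mult powr_mult mult_ac)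

lemma continuous_on_signed_pow:
  assumes "0 < m"
  shows "continuous_on UNIV (\<lambda>t. signed_pow t m)"
proof -
  have "signed_pow t m = max 0 t powr m - max 0 (- t) powr m" for t
    using assms by (cases "0 \<le> t") (auto simp: signed_pow_nonneg signed_pow_nonpos max_def)
  moreover have "continuous_on UNIV (\<lambda>t::real. max 0 t powr m - max 0 (- t) powr m)"
    using assms by (intro continuous_intros continuous_on_powr') auto
  ultimately show ?thesis by simp
qed

lemma signed_pow_borel_measurable [measurable]:
  assumes "f \<in> borel_measurable M"
  shows "(\<lambda>x. signed_pow (f x) m) \<in> borel_measurable M"
  using assms unfolding signed_pow_def by measurable

text \<open>The increment is measured at \<open>y\<close> alone, wherever \<open>x\<close> lies. To the right of a positive \<open>y\<close> this is
concavity; for \<open>y < x \<le> 0\<close> it follows from \<open>|x| powr n \<ge> |x| * |y| powr (n - 1)\<close>. The factor \<open>2\<close> pays for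
increments that cross \<open>0\<close>.\<close>

lemma signed_pow_increment_sublinear:
  assumes n: "0 < n" "n \<le> 1" and y: "y \<noteq> 0" "y \<le> x"
  shows "signed_pow x n - signed_pow y n \<le> 2 * \<bar>y\<bar> powr (n - 1) * (x - y)"
proof -
  have split: "t powr n = t * t powr (n - 1)" if "0 < t" for t :: real
    using powr_mult_base[of t "n - 1"] that by simp
  have anti: "b powr (n - 1) \<le> a powr (n - 1)" if "0 < a" "a \<le> b" for a b :: real
    using that n by (intro powr_mono2') auto
  have nn: "0 \<le> \<bar>y\<bar> powr (n - 1) * (x - y)" using y by simp
  consider "0 < y" | "y < 0" "x < 0" | "y < 0" "0 \<le> x" using y by linarith
  then have "signed_pow x n - signed_pow y n \<le> \<bar>y\<bar> powr (n - 1) * (x - y) + \<bar>y\<bar> powr (n - 1) * (x - y)"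
  proof cases
    case 1
    then have "x powr n \<le> x * y powr (n - 1)"
      using y anti[of y x] split[of x] by (simp add: mult_left_mono)
    then have "x powr n - y powr n \<le> y powr (n - 1) * (x - y)"
      using split[of y] 1 by (simp add: algebra_simps)
    moreover have "signed_pow x n = x powr n" "signed_pow y n = y powr n" "\<bar>y\<bar> = y"
      using 1 y by (simp_all add: signed_pow_nonneg)
    ultimately have "signed_pow x n - signed_pow y n \<le> \<bar>y\<bar> powr (n - 1) * (x - y)" by simp
    then show ?thesis using nn by linarith
  next
    case 2
    have "(- x) * (- y) powr (n - 1) \<le> (- x) powr n"
      using split[of "- x"] anti[of "- x" "- y"] 2 y by (simp add: mult_left_mono_neg)
    then have "(- y) powr n - (- x) powr n \<le> (- y) powr (n - 1) * (x - y)"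
      using split[of "- y"] 2 by (simp add: algebra_simps)
    moreover have "signed_pow x n = - ((- x) powr n)" "signed_pow y n = - ((- y) powr n)" "\<bar>y\<bar> = - y"
      using 2 by (simp_all add: signed_pow_nonpos)
    ultimately have "signed_pow x n - signed_pow y n \<le> \<bar>y\<bar> powr (n - 1) * (x - y)" by simp
    then show ?thesis using nn by linarith
  next
    case 3
    have "x powr n \<le> (- y) powr (n - 1) * x + (- y) powr n"
    proof (cases "x \<le> - y")
      case True
      then have "x powr n \<le> (- y) powr n" using 3 n by (intro powr_mono2) auto
      moreover have "0 \<le> (- y) powr (n - 1) * x" using 3 by simp
      ultimately show ?thesis by linarith
    next
      case False
      then have "x powr n \<le> x * (- y) powr (n - 1)"
        using 3 anti[of "- y" x] split[of x] by (simp add: mult_left_mono)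
      then show ?thesis using powr_ge_zero[of "- y" n] unfolding mult.commute[of x] by linarith
    qed
    moreover have "(- y) powr n = (- y) powr (n - 1) * (- y)" using split[of "- y"] 3 by simp
    moreover have "0 \<le> (- y) powr (n - 1) * x" using 3 by simp
    moreover have "(- y) powr (n - 1) * (x - y) = (- y) powr (n - 1) * x + (- y) powr (n - 1) * (- y)"
      by (simp add: algebra_simps)
    moreover have "signed_pow x n - signed_pow y n = x powr n + (- y) powr n"
      using 3 by (simp add: signed_pow_nonpos signed_pow_nonneg)
    moreover have "\<bar>y\<bar> = - y" using 3 by simp
    ultimately show ?thesis by (simp only:)
  qed
  then show ?thesis by linarith
qed

text \<open>Bernoulli's inequality for real exponents below \<open>1\<close>; the next lemma derives from it the case of
exponents above \<open>1\<close>.\<close>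

lemma powr_le_affine:
  fixes z \<beta> :: real
  assumes "0 \<le> z" "0 < \<beta>" "\<beta> \<le> 1"
  shows "z powr \<beta> \<le> 1 + \<beta> * (z - 1)"
  using Youngs_inequality_0[of \<beta> "1 - \<beta>" z 1] assms by (cases "z = 0") (auto simp: algebra_simps)

lemma affine_le_powr:
  fixes z n :: real
  assumes "0 \<le> z" "1 \<le> n"
  shows "1 + n * (z - 1) \<le> z powr n"
proof (cases "1 + n * (z - 1) \<le> 0")
  case True
  then show ?thesis using powr_ge_zero[of z n] by linarith
next
  case False
  define y where "y = 1 + n * (z - 1)"
  have "y powr (1 / n) \<le> 1 + 1 / n * (y - 1)"
    using False assms unfolding y_def by (intro powr_le_affine) auto
  also have "\<dots> = z" using assms unfolding y_def by (simp add: field_simps)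
  finally have "(y powr (1 / n)) powr n \<le> z powr n" using assms by (intro powr_mono2) auto
  then show ?thesis using assms False by (simp add: powr_powr y_def)
qed

lemma powr_increment_le:
  fixes a b n :: real
  assumes "0 \<le> a" "a \<le> b" "1 \<le> n"
  shows "b powr n - a powr n \<le> n * b powr (n - 1) * (b - a)"
proof (cases "b = 0")
  case False
  then have b: "0 < b" using assms by simp
  have "b powr n * (1 + n * (a / b - 1)) \<le> b powr n * (a / b) powr n"
    using assms b by (intro mult_left_mono affine_le_powr) auto
  also have "\<dots> = a powr n" using b assms by (simp flip: powr_mult)
  finally have "b powr n * (1 + n * (a / b - 1)) \<le> a powr n" .
  moreover have "b powr n * (1 + n * (a / b - 1)) = b powr (n - 1) * (b * (1 + n * (a / b - 1)))"
    using powr_mult_base[of b "n - 1"] b by (simp add: mult_ac)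
  moreover have "b * (1 + n * (a / b - 1)) = b - n * (b - a)" using b by (simp add: field_simps)
  moreover have "b powr (n - 1) * (b - n * (b - a)) = b powr n - n * b powr (n - 1) * (b - a)"
    using powr_mult_base[of b "n - 1"] b by (simp add: algebra_simps)
  ultimately show ?thesis by simp
qed (use assms in auto)

lemma powr_decrement_le:
  fixes X Z \<beta> :: real
  assumes "0 \<le> X" "X \<le> Z" "0 < Z" "0 < \<beta>" "\<beta> \<le> 1"
  shows "Z powr \<beta> - X powr \<beta> \<le> (Z - X) * Z powr (\<beta> - 1)"
proof -
  have "X / Z \<le> (X / Z) powr \<beta>"
    using powr_mono'[of \<beta> 1 "X / Z"] assms by auto
  then have "Z powr \<beta> * (X / Z) \<le> Z powr \<beta> * (X / Z) powr \<beta>" by (intro mult_left_mono) auto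
  also have "\<dots> = X powr \<beta>" using assms by (simp flip: powr_mult)
  finally have "Z powr \<beta> * (X / Z) \<le> X powr \<beta>" .
  moreover have "Z powr \<beta> = Z * Z powr (\<beta> - 1)" using powr_mult_base[of Z "\<beta> - 1"] assms by simp
  moreover have "Z * Z powr (\<beta> - 1) * (X / Z) = X * Z powr (\<beta> - 1)" using assms by simp
  ultimately show ?thesis by (simp add: left_diff_distrib)
qed

lemma signed_pow_increment_superlinear:
  assumes n: "1 \<le> n" and t: "\<bar>x\<bar> \<le> t" "\<bar>y\<bar> \<le> t" "y \<le> x"
  shows "signed_pow x n - signed_pow y n \<le> n * t powr (n - 1) * (x - y)"
proof -
  have pos: "b powr n - a powr n \<le> n * t powr (n - 1) * (b - a)" if ab: "0 \<le> a" "a \<le> b" "b \<le> t" for a b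
  proof -
    have "b powr n - a powr n \<le> n * b powr (n - 1) * (b - a)" using ab n by (intro powr_increment_le)
    also have "\<dots> \<le> n * t powr (n - 1) * (b - a)"
      using ab n by (intro mult_right_mono mult_left_mono powr_mono2) auto
    finally show ?thesis .
  qed
  consider "0 \<le> y" | "x \<le> 0" | "y < 0" "0 < x" by linarith
  then show ?thesis
  proof cases
    case 1
    then show ?thesis using pos[of y x] t by (simp add: signed_pow_nonneg)
  next
    case 2
    then show ?thesis using pos[of "- x" "- y"] t by (simp add: signed_pow_nonpos)
  next
    case 3
    then show ?thesis using pos[of 0 x] pos[of 0 "- y"] t n
      by (simp add: signed_pow_nonpos signed_pow_nonneg algebra_simps)
  qed
qed

text \<open>A common form of the two estimates. For \<open>n < 1\<close> the derivative blows up at \<open>0\<close>, and the lower bound on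
\<open>|y|\<close> costs the power of \<open>c\<close>. On a chord of the ball, \<open>c\<close> will measure how far the chord is from being
bisected by the point at which the operator is evaluated.\<close>

lemma signed_pow_increment:
  assumes n: "0 < n" and c: "0 < c" "c \<le> 1" and \<kappa>: "0 < \<kappa>" and t: "0 < t"
    and y: "\<kappa> * c * t \<le> \<bar>y\<bar>" "\<bar>y\<bar> \<le> t" "\<bar>x\<bar> \<le> t" "y \<le> x"
  shows "signed_pow x n - signed_pow y n \<le>
    max n (2 * \<kappa> powr (n - 1)) * c powr (- max 0 (1 - n)) * t powr (n - 1) * (x - y)"
proof (cases "1 \<le> n")
  case True
  have "signed_pow x n - signed_pow y n \<le> n * t powr (n - 1) * (x - y)"
    using y True by (intro signed_pow_increment_superlinear) auto
  also have "\<dots> \<le> max n (2 * \<kappa> powr (n - 1)) * t powr (n - 1) * (x - y)"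
    using y by (intro mult_right_mono) auto
  finally show ?thesis using True c by simp
next
  case False
  have pos: "0 < \<kappa> * c * t" using \<kappa> c t by simp
  have "signed_pow x n - signed_pow y n \<le> 2 * \<bar>y\<bar> powr (n - 1) * (x - y)"
    using n False y pos by (intro signed_pow_increment_sublinear) auto
  also have "\<dots> \<le> 2 * (\<kappa> * c * t) powr (n - 1) * (x - y)"
    using y False pos by (intro mult_right_mono mult_left_mono powr_mono2') auto
  also have "\<dots> = (2 * \<kappa> powr (n - 1)) * c powr (- max 0 (1 - n)) * t powr (n - 1) * (x - y)"
    using \<kappa> c t False by (simp add: powr_mult)
  also have "\<dots> \<le> max n (2 * \<kappa> powr (n - 1)) * c powr (- max 0 (1 - n)) * t powr (n - 1) * (x - y)"
    using y by (intro mult_right_mono) auto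
  finally show ?thesis .
qed

section \<open>The operator on a normalised chord\<close>

text \<open>The chord is normalised so that the profile is \<open>(1 + t) (1 - \<epsilon> t)\<close>, equal to \<open>1\<close> at \<open>t = 0\<close>. The involution
\<open>t \<mapsto> - t / (1 + c t)\<close> exchanges the two ends \<open>- 1\<close> and \<open>1 / \<epsilon>\<close> and sends \<open>- \<theta>\<close> to \<open>\<theta> / Z\<close>. The profile
is \<open>X\<close> at \<open>- \<theta>\<close> and \<open>X / Z\<^sup>2\<close> at \<open>\<theta> / Z\<close>. If \<open>X\<close> were equal to \<open>Z\<close>, the second value would be the
reciprocal of the first, as on the half-line. In fact \<open>Z - X = \<epsilon> \<theta>\<^sup>2\<close>, so the powers differ by at most
\<open>\<epsilon> \<theta>\<^sup>2 Z powr (\<beta> - 1)\<close>, and the increment estimate converts this into the error terms below. The weight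
\<open>Z powr (s (n + 1) - 1)\<close> is what the kernel and the Jacobian produce at \<open>\<theta> / Z\<close>.\<close>

lemma involution_pair_bound:
  fixes \<beta> s n \<epsilon> \<theta> :: real
  defines "c \<equiv> 1 - \<epsilon>"
  defines "Z \<equiv> 1 - c * \<theta>" and "X \<equiv> (1 - \<theta>) * (1 + \<epsilon> * \<theta>)"
  defines "K \<equiv> max n (2 * \<beta> powr (n - 1))"
  assumes s: "0 < s" "s \<le> \<beta>" "\<beta> < 1" and n: "0 < n" and \<epsilon>: "0 < \<epsilon>" "\<epsilon> < 1" and \<theta>: "0 < \<theta>" "\<theta> \<le> 1"
  shows "signed_pow (1 - X powr \<beta>) n \<le> (1 - Z powr \<beta>) powr n
           + K * c powr (- max 0 (1 - n)) * \<epsilon> * \<theta> powr (n + 1) * Z powr (- (2 - s + (\<beta> - s) * n))" (is ?A)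
    and "- (signed_pow (X powr \<beta> * Z powr (- 2 * \<beta>) - 1) n * Z powr (s * (n + 1) - 1)) \<le>
           - ((1 - Z powr \<beta>) powr n * Z powr (s * (n + 1) - 1 - \<beta> * n))
           + K * c powr (- max 0 (1 - n)) * \<epsilon> * \<theta> powr (n + 1) * Z powr (- (2 - s + (\<beta> - s) * n))" (is ?B)
proof -
  have c: "0 < c" "c < 1" using \<epsilon> by (auto simp: c_def)
  have "c * \<theta> \<le> c" "0 < c * \<theta>" using c \<theta> mult_left_le[of \<theta> c] by simp_all
  then have Z: "0 < Z" "Z < 1" "\<epsilon> \<le> Z" using c unfolding Z_def by (simp_all add: c_def)
  have ZX: "Z - X = \<epsilon> * \<theta>\<^sup>2" by (simp add: Z_def X_def c_def power2_eq_square algebra_simps)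
  have X: "0 \<le> X" "1 - \<theta> \<le> X" "X \<le> Z"
  proof -
    show "0 \<le> X" using \<theta> \<epsilon> by (auto simp: X_def)
    show "1 - \<theta> \<le> X" using \<theta> \<epsilon> mult_left_mono[of 1 "1 + \<epsilon> * \<theta>" "1 - \<theta>"] by (auto simp: X_def)
    show "X \<le> Z" using ZX \<epsilon> zero_le_power2[of \<theta>] by (smt (verit) mult_nonneg_nonneg)
  qed
  have K: "0 < K" using n by (auto simp: K_def)
  define D where "D = Z powr \<beta> - X powr \<beta>"
  have D0: "0 \<le> D" using X s by (auto simp: D_def intro!: powr_mono2)
  have D: "D \<le> \<epsilon> * \<theta>\<^sup>2 * Z powr (\<beta> - 1)"
    using powr_decrement_le[of X Z \<beta>] X Z s ZX by (auto simp: D_def)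
  have Zb: "\<beta> * c * \<theta> \<le> 1 - Z powr \<beta>" using powr_le_affine[of Z \<beta>] Z s by (simp add: Z_def algebra_simps)
  have Xb: "1 - X powr \<beta> \<le> \<theta>" "X powr \<beta> \<le> 1"
  proof -
    have "X \<le> 1" using X Z by simp
    then show "X powr \<beta> \<le> 1" using X s powr_mono2[of \<beta> X 1] by simp
    have "X \<le> X powr \<beta>" using powr_mono'[of \<beta> 1 X] \<open>X \<le> 1\<close> X s by auto
    then show "1 - X powr \<beta> \<le> \<theta>" using X by linarith
  qed
  have t2: "\<theta> powr (n - 1) * \<theta>\<^sup>2 = \<theta> powr (n + 1)"
    using \<theta> powr_add[of \<theta> "n - 1" 2] by (simp add: add.commute)
  have Zle: "1 - Z powr \<beta> \<le> \<theta>" using Xb D0 by (simp add: D_def)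
  have Zpos: "0 \<le> 1 - Z powr \<beta>" using Zb s c \<theta> by (smt (verit) mult_nonneg_nonneg)
  let ?m = "c powr (- max 0 (1 - n))"
  have "signed_pow (1 - X powr \<beta>) n - signed_pow (1 - Z powr \<beta>) n \<le> K * ?m * \<theta> powr (n - 1) * ((1 - X powr \<beta>) - (1 - Z powr \<beta>))"
    unfolding K_def using n c s \<theta> Zb Zle Xb D0 Zpos
    by (intro signed_pow_increment) (auto simp: D_def)
  also have "\<dots> \<le> K * ?m * \<theta> powr (n - 1) * (\<epsilon> * \<theta>\<^sup>2 * Z powr (\<beta> - 1))"
    using D K by (intro mult_left_mono) (auto simp: D_def)
  also have "\<dots> \<le> K * ?m * \<theta> powr (n - 1) * (\<epsilon> * \<theta>\<^sup>2 * Z powr (- (2 - s + (\<beta> - s) * n)))"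
  proof -
    have "- (2 - s + (\<beta> - s) * n) \<le> \<beta> - 1" using s n by (smt (verit) mult_nonneg_nonneg)
    then have "Z powr (\<beta> - 1) \<le> Z powr (- (2 - s + (\<beta> - s) * n))" using Z by (intro powr_mono') auto
    then show ?thesis using K \<epsilon> by (intro mult_left_mono) auto
  qed
  also have "\<dots> = K * ?m * \<epsilon> * (\<theta> powr (n - 1) * \<theta>\<^sup>2) * Z powr (- (2 - s + (\<beta> - s) * n))"
    by (simp add: mult_ac)
  finally show ?A using Zpos unfolding t2 by (simp add: signed_pow_nonneg algebra_simps)

  define y where "y = - (Z powr (- \<beta>) - 1)"
  define x where "x = 1 - X powr \<beta> * Z powr (- 2 * \<beta>)"
  have zz: "Z powr (- \<beta>) * Z powr \<beta> = 1" "Z powr (- \<beta>) * Z powr (- \<beta>) = Z powr (- 2 * \<beta>)"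
    using Z by (auto simp flip: powr_add)
  have zz2: "Z powr \<beta> * Z powr (- 2 * \<beta>) = Z powr (- \<beta>)" using Z by (auto simp flip: powr_add)
  have Zge1: "1 \<le> Z powr (- \<beta>)" using Z s powr_mono2'[of "- \<beta>" Z 1] by simp
  have yabs: "\<bar>y\<bar> = Z powr (- \<beta>) * (1 - Z powr \<beta>)" using Zge1 zz by (simp add: y_def right_diff_distrib)
  have xy: "x - y = D * Z powr (- 2 * \<beta>)" using zz2 by (simp add: x_def y_def D_def left_diff_distrib)
  define t where "t = Z powr (- \<beta>) * \<theta>"
  have x1: "- x \<le> t"
  proof -
    have "- x \<le> - y" using xy D0 by (smt (verit) mult_nonneg_nonneg powr_ge_zero)
    also have "- y \<le> t" using yabs Zle mult_left_mono[OF Zle, of "Z powr - \<beta>"] Zge1 by (simp add: t_def y_def)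
    finally show ?thesis .
  qed
  have x2: "x \<le> t"
  proof -
    have "1 \<le> Z powr (- 2 * \<beta>)" using Zge1 zz mult_mono[OF Zge1 Zge1] by simp
    then have "x \<le> 1 - X powr \<beta>" using mult_left_mono[of 1 "Z powr (- 2 * \<beta>)" "X powr \<beta>"] by (simp add: x_def)
    also have "\<dots> \<le> \<theta>" using Xb by simp
    also have "\<dots> \<le> t" using mult_right_mono[OF Zge1, of \<theta>] \<theta> by (simp add: t_def)
    finally show ?thesis .
  qed
  have "signed_pow x n - signed_pow y n \<le> K * ?m * t powr (n - 1) * (x - y)"
    unfolding K_def
  proof (rule signed_pow_increment)
    show "\<beta> * c * t \<le> \<bar>y\<bar>" using mult_left_mono[OF Zb, of "Z powr (- \<beta>)"] by (simp add: yabs t_def mult_ac)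
    show "\<bar>y\<bar> \<le> t" using mult_left_mono[OF Zle, of "Z powr (- \<beta>)"] by (simp add: yabs t_def)
    show "\<bar>x\<bar> \<le> t" using x1 x2 by simp
    show "y \<le> x" using xy D0 by (smt (verit) mult_nonneg_nonneg powr_ge_zero)
  qed (use n c s \<theta> Z in \<open>auto simp: t_def\<close>)
  also have "\<dots> \<le> K * ?m * t powr (n - 1) * (\<epsilon> * \<theta>\<^sup>2 * Z powr (\<beta> - 1) * Z powr (- 2 * \<beta>))"
    using mult_right_mono[OF D, of "Z powr (- 2 * \<beta>)"] K
    unfolding xy by (intro mult_left_mono) auto
  finally have "(signed_pow x n - signed_pow y n) * Z powr (s * (n + 1) - 1) \<le>
     K * ?m * t powr (n - 1) * (\<epsilon> * \<theta>\<^sup>2 * Z powr (\<beta> - 1) * Z powr (- 2 * \<beta>)) * Z powr (s * (n + 1) - 1)"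
    by (intro mult_right_mono) auto
  also have "\<dots> = K * ?m * \<epsilon> * (\<theta> powr (n - 1) * \<theta>\<^sup>2) *
      (Z powr (- \<beta> * (n - 1)) * Z powr (\<beta> - 1) * Z powr (- 2 * \<beta>) * Z powr (s * (n + 1) - 1))"
    using \<theta> Z by (simp add: t_def powr_mult powr_powr mult_ac)
  also have "Z powr (- \<beta> * (n - 1)) * Z powr (\<beta> - 1) * Z powr (- 2 * \<beta>) * Z powr (s * (n + 1) - 1)
      = Z powr (- (2 - s + (\<beta> - s) * n))"
    unfolding powr_add[symmetric] by (simp add: algebra_simps)
  finally have main: "(signed_pow x n - signed_pow y n) * Z powr (s * (n + 1) - 1) \<le>
     K * ?m * \<epsilon> * \<theta> powr (n + 1) * Z powr (- (2 - s + (\<beta> - s) * n))" by (simp only: t2)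
  have "signed_pow y n * Z powr (s * (n + 1) - 1) = - ((Z powr (- \<beta>) * (1 - Z powr \<beta>)) powr n * Z powr (s * (n + 1) - 1))"
    using Zge1 yabs by (subst signed_pow_nonpos) (auto simp: y_def)
  also have "(Z powr (- \<beta>) * (1 - Z powr \<beta>)) powr n * Z powr (s * (n + 1) - 1)
     = (1 - Z powr \<beta>) powr n * (Z powr (- \<beta> * n) * Z powr (s * (n + 1) - 1))"
    using Zpos Z by (simp add: powr_mult powr_powr mult_ac)
  also have "Z powr (- \<beta> * n) * Z powr (s * (n + 1) - 1) = Z powr (s * (n + 1) - 1 - \<beta> * n)"
    unfolding powr_add[symmetric] by (simp add: algebra_simps)
  finally have "signed_pow y n * Z powr (s * (n + 1) - 1) = - ((1 - Z powr \<beta>) powr n * Z powr (s * (n + 1) - 1 - \<beta> * n))" .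
  moreover have "signed_pow x n = - signed_pow (X powr \<beta> * Z powr (- 2 * \<beta>) - 1) n"
    by (simp add: x_def flip: signed_pow_minus)
  ultimately show ?B using main by (simp add: left_diff_distrib)
qed


text \<open>Integrates the error of \<open>involution_pair_bound\<close> against the kernel. The weight is large only near
\<open>\<theta> = 1\<close>, where \<open>1 - (1 - \<epsilon>) \<theta>\<close> is comparable with \<open>(1 - \<theta>) + \<epsilon>\<close>.\<close>

lemma integral_endpoint_weight:
  fixes \<alpha> \<nu> :: real
  assumes "0 < \<alpha>" "1 < \<nu>"
  obtains C where "0 < C" "\<And>\<epsilon> a. 0 < \<epsilon> \<Longrightarrow> \<epsilon> < 1 \<Longrightarrow> 0 < a \<Longrightarrow> a < 1 \<Longrightarrow>
    integral {a..1} (\<lambda>\<theta>. \<theta> powr (\<alpha> - 1) * (1 - (1 - \<epsilon>) * \<theta>) powr (- \<nu>)) \<le> C * \<epsilon> powr (1 - \<nu>)"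
proof
  define C where "C = 2 powr \<nu> / \<alpha> + 2 * 2 powr \<nu> / (\<nu> - 1)"
  show "0 < C" using assms by (auto simp: C_def intro!: add_pos_pos)
  fix \<epsilon> a :: real
  assume e: "0 < \<epsilon>" "\<epsilon> < 1" and a: "0 < a" "a < 1"
  have i1: "((\<lambda>\<theta>. \<theta> powr (\<alpha> - 1)) has_integral (1 powr \<alpha> / \<alpha> - a powr \<alpha> / \<alpha>)) {a..1}"
    using assms a
    by (intro fundamental_theorem_of_calculus)
       (auto intro!: derivative_eq_intros simp flip: has_real_derivative_iff_has_vector_derivative)
  have i2: "((\<lambda>\<theta>. (1 + \<epsilon> - \<theta>) powr (- \<nu>)) has_integral
      ((1 + \<epsilon> - 1) powr (1 - \<nu>) / (\<nu> - 1) - (1 + \<epsilon> - a) powr (1 - \<nu>) / (\<nu> - 1))) {a..1}"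
  proof (rule fundamental_theorem_of_calculus)
    fix \<theta> assume "\<theta> \<in> {a..1}"
    then have "0 < 1 + \<epsilon> - \<theta>" using e by auto
    moreover have "((\<lambda>\<theta>. 1 + \<epsilon> - \<theta>) has_real_derivative - 1) (at \<theta>)"
      by (auto intro!: derivative_eq_intros)
    ultimately have "((\<lambda>\<theta>. (1 + \<epsilon> - \<theta>) powr (1 - \<nu>)) has_real_derivative (\<nu> - 1) * (1 + \<epsilon> - \<theta>) powr (- \<nu>)) (at \<theta>)"
      using DERIV_fun_powr[of "\<lambda>\<theta>. 1 + \<epsilon> - \<theta>" "- 1" \<theta> "1 - \<nu>"] by (simp add: algebra_simps)
    from DERIV_cdivide[OF this, of "\<nu> - 1"]
    have "((\<lambda>\<theta>. (1 + \<epsilon> - \<theta>) powr (1 - \<nu>) / (\<nu> - 1)) has_real_derivative (1 + \<epsilon> - \<theta>) powr (- \<nu>)) (at \<theta>)"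
      using assms by simp
    then show "((\<lambda>\<theta>. (1 + \<epsilon> - \<theta>) powr (1 - \<nu>) / (\<nu> - 1)) has_vector_derivative (1 + \<epsilon> - \<theta>) powr (- \<nu>)) (at \<theta> within {a..1})"
      unfolding has_real_derivative_iff_has_vector_derivative by (rule has_vector_derivative_at_within)
  qed (use a in auto)
  have pos: "0 < 1 - (1 - \<epsilon>) * \<theta>" if "\<theta> \<le> 1" "0 < \<theta>" for \<theta> :: real
    using mult_left_le[of \<theta> "1 - \<epsilon>"] that e by linarith
  have "integral {a..1} (\<lambda>\<theta>. \<theta> powr (\<alpha> - 1) * (1 - (1 - \<epsilon>) * \<theta>) powr (- \<nu>)) \<le>
    integral {a..1} (\<lambda>\<theta>. 2 powr \<nu> * \<theta> powr (\<alpha> - 1) + 2 * 2 powr \<nu> * (1 + \<epsilon> - \<theta>) powr (- \<nu>))"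
  proof (rule integral_le)
    show "(\<lambda>\<theta>. \<theta> powr (\<alpha> - 1) * (1 - (1 - \<epsilon>) * \<theta>) powr (- \<nu>)) integrable_on {a..1}"
      using pos a by (intro integrable_continuous_real continuous_intros) force+
    show "(\<lambda>\<theta>. 2 powr \<nu> * \<theta> powr (\<alpha> - 1) + 2 * 2 powr \<nu> * (1 + \<epsilon> - \<theta>) powr (- \<nu>)) integrable_on {a..1}"
      using e a by (intro integrable_continuous_real continuous_intros) auto
    fix \<theta> assume th: "\<theta> \<in> {a..1}"
    then have th0: "0 < \<theta>" "\<theta> \<le> 1" using a by auto
    show "\<theta> powr (\<alpha> - 1) * (1 - (1 - \<epsilon>) * \<theta>) powr (- \<nu>) \<le>
        2 powr \<nu> * \<theta> powr (\<alpha> - 1) + 2 * 2 powr \<nu> * (1 + \<epsilon> - \<theta>) powr (- \<nu>)"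
    proof (cases "\<theta> \<le> 1/2")
      case True
      have "1 - (1 - \<epsilon>) * \<theta> \<ge> 1/2" using True e th0 mult_left_le_one_le[of \<theta> "1 - \<epsilon>"] by linarith
      then have "(1 - (1 - \<epsilon>) * \<theta>) powr (- \<nu>) \<le> (1/2) powr (- \<nu>)" using assms by (intro powr_mono2') auto
      also have "\<dots> = 2 powr \<nu>" by (simp add: powr_minus powr_divide)
      finally have "\<theta> powr (\<alpha> - 1) * (1 - (1 - \<epsilon>) * \<theta>) powr (- \<nu>) \<le> \<theta> powr (\<alpha> - 1) * 2 powr \<nu>"
        by (intro mult_left_mono) auto
      moreover have "0 \<le> 2 * 2 powr \<nu> * (1 + \<epsilon> - \<theta>) powr (- \<nu>)" by simp
      ultimately show ?thesis unfolding mult.commute[of "2 powr \<nu>" "\<theta> powr (\<alpha> - 1)"] by linarith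
    next
      case False
      have t1: "\<theta> powr (\<alpha> - 1) \<le> 2"
      proof (cases "\<alpha> \<le> 1")
        case True
        have "\<theta> powr (\<alpha> - 1) \<le> (1/2) powr (\<alpha> - 1)" using True False by (intro powr_mono2') auto
        also have "\<dots> = 2 powr (1 - \<alpha>)" by (simp add: powr_minus powr_divide powr_diff field_simps)
        also have "\<dots> \<le> 2 powr 1" using assms by (intro powr_mono) auto
        finally show ?thesis by simp
      next
        case False
        then have "\<theta> powr (\<alpha> - 1) \<le> 1 powr (\<alpha> - 1)" using th0 by (intro powr_mono2) auto
        then show ?thesis by simp
      qed
      have "(1 + \<epsilon> - \<theta>) / 2 \<le> 1 - (1 - \<epsilon>) * \<theta>"
      proof -
        have "\<epsilon> * (1 / 2) \<le> \<epsilon> * \<theta>" using False e by (intro mult_left_mono) auto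
        then have "(1 + \<epsilon> - \<theta>) / 2 \<le> 1 - \<theta> + \<epsilon> * \<theta>" using th0 by simp
        then show ?thesis by (simp add: algebra_simps)
      qed
      then have "(1 - (1 - \<epsilon>) * \<theta>) powr (- \<nu>) \<le> ((1 + \<epsilon> - \<theta>) / 2) powr (- \<nu>)"
        using assms th0 e by (intro powr_mono2') auto
      also have "\<dots> = 2 powr \<nu> * (1 + \<epsilon> - \<theta>) powr (- \<nu>)"
        using th0 e by (simp add: powr_divide powr_minus_divide)
      finally have "\<theta> powr (\<alpha> - 1) * (1 - (1 - \<epsilon>) * \<theta>) powr (- \<nu>) \<le> 2 * (2 powr \<nu> * (1 + \<epsilon> - \<theta>) powr (- \<nu>))"
        using t1 by (intro mult_mono) auto
      moreover have "0 \<le> 2 powr \<nu> * \<theta> powr (\<alpha> - 1)" by simp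
      ultimately show ?thesis by linarith
    qed
  qed
  also have "\<dots> = 2 powr \<nu> * (1 powr \<alpha> / \<alpha> - a powr \<alpha> / \<alpha>) +
     2 * 2 powr \<nu> * ((1 + \<epsilon> - 1) powr (1 - \<nu>) / (\<nu> - 1) - (1 + \<epsilon> - a) powr (1 - \<nu>) / (\<nu> - 1))"
    by (intro integral_unique has_integral_add has_integral_mult_right i1 i2)
  also have "\<dots> \<le> 2 powr \<nu> * (1 / \<alpha>) + 2 * 2 powr \<nu> * (\<epsilon> powr (1 - \<nu>) / (\<nu> - 1))"
    using assms by (intro add_mono mult_left_mono) auto
  also have "\<dots> \<le> 2 powr \<nu> / \<alpha> * \<epsilon> powr (1 - \<nu>) + 2 * 2 powr \<nu> * (\<epsilon> powr (1 - \<nu>) / (\<nu> - 1))"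
  proof -
    have "1 powr (1 - \<nu>) \<le> \<epsilon> powr (1 - \<nu>)" using assms e by (intro powr_mono2') auto
    then show ?thesis using assms mult_left_mono[of 1 "\<epsilon> powr (1 - \<nu>)" "2 powr \<nu> / \<alpha>"] by simp
  qed
  also have "\<dots> = C * \<epsilon> powr (1 - \<nu>)" by (simp add: C_def algebra_simps)
  finally show "integral {a..1} (\<lambda>\<theta>. \<theta> powr (\<alpha> - 1) * (1 - (1 - \<epsilon>) * \<theta>) powr (- \<nu>)) \<le> C * \<epsilon> powr (1 - \<nu>)" .
qed

text \<open>The reason why \<open>t\<^sub>+ powr s\<close> is harmonic for the operator of order \<open>s\<close>, for every exponent \<open>m\<close>. Once the
points are paired by inversion, the integrand has the primitive
\<open>(1 - z powr s) powr m * (1 - z) powr - (s m) / (s m)\<close>, up to sign, with \<open>z = 1 - c \<theta>\<close>. Between \<open>z = 1\<close>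
and \<open>z = 0\<close> it changes by \<open>1 / (s m)\<close>, the exact contribution of the half-line on which the function is
\<open>0\<close>.\<close>

lemma has_integral_half_line_harmonic:
  fixes s m c \<delta> :: real
  assumes s: "0 < s" "s < 1" and m: "1 < m" and c: "0 < c" "c < 1" and \<delta>: "0 < \<delta>" "\<delta> \<le> 1"
  shows "((\<lambda>\<theta>. (1 - (1 - c * \<theta>) powr s) powr (m - 1) * ((1 - c * \<theta>) powr (s - 1) - 1) * \<theta> powr (- 1 - s * m))
    has_integral ((1 - (1 - c) powr s) powr m - (1 - (1 - c * \<delta>) powr s) powr m * \<delta> powr (- (s * m))) / (s * m)) {\<delta>..1}"
proof -
  define G where "G = (\<lambda>\<theta>. (1 - (1 - c * \<theta>) powr s) powr m * \<theta> powr (- (s * m)) / (s * m))"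
  have "((\<lambda>\<theta>. (1 - (1 - c * \<theta>) powr s) powr (m - 1) * ((1 - c * \<theta>) powr (s - 1) - 1) * \<theta> powr (- 1 - s * m))
    has_integral G 1 - G \<delta>) {\<delta>..1}"
  proof (rule fundamental_theorem_of_calculus)
    fix \<theta> assume th: "\<theta> \<in> {\<delta>..1}"
    then have th0: "0 < \<theta>" "\<theta> \<le> 1" using \<delta> by auto
    define z where "z = 1 - c * \<theta>"
    have "c * \<theta> \<le> c" "0 < c * \<theta>" using c th0 mult_left_le[of \<theta> c] by simp_all
    then have z: "0 < z" "z < 1" using c unfolding z_def by linarith+
    have zs: "z powr s < 1" using z s powr_less_mono2[of s z 1] by simp
    have d0: "((\<lambda>\<theta>. 1 - c * \<theta>) has_real_derivative - c) (at \<theta>)"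
      by (auto intro!: derivative_eq_intros)
    have d1: "((\<lambda>\<theta>. (1 - c * \<theta>) powr s) has_real_derivative s * z powr (s - 1) * - c) (at \<theta>)"
      using DERIV_fun_powr[OF d0, of s] z by (simp add: z_def)
    have d2: "((\<lambda>\<theta>. 1 - (1 - c * \<theta>) powr s) has_real_derivative s * z powr (s - 1) * c) (at \<theta>)"
      using DERIV_diff[OF DERIV_const[of 1] d1] by simp
    have d3: "((\<lambda>\<theta>. (1 - (1 - c * \<theta>) powr s) powr m) has_real_derivative
        m * (1 - z powr s) powr (m - 1) * (s * z powr (s - 1) * c)) (at \<theta>)"
      using DERIV_fun_powr[OF d2, of m] zs by (simp add: z_def)
    have d4: "((\<lambda>\<theta>. \<theta> powr (- (s * m))) has_real_derivative - (s * m) * \<theta> powr (- (s * m) - 1)) (at \<theta>)"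
      using DERIV_fun_powr[OF DERIV_ident, of \<theta> "- (s * m)"] th0 by simp
    have "(G has_real_derivative
       (m * (1 - z powr s) powr (m - 1) * (s * z powr (s - 1) * c) * \<theta> powr (- (s * m)) +
        (1 - z powr s) powr m * (- (s * m) * \<theta> powr (- (s * m) - 1))) / (s * m)) (at \<theta>)"
      unfolding G_def using DERIV_cdivide[OF DERIV_mult[OF d3 d4], of "s * m"] by (simp add: z_def algebra_simps)
    also have "(m * (1 - z powr s) powr (m - 1) * (s * z powr (s - 1) * c) * \<theta> powr (- (s * m)) +
        (1 - z powr s) powr m * (- (s * m) * \<theta> powr (- (s * m) - 1))) / (s * m) =
       (1 - z powr s) powr (m - 1) * (z powr (s - 1) - 1) * \<theta> powr (- 1 - s * m)"
    proof -
      have e1: "(1 - z powr s) powr m = (1 - z powr s) * (1 - z powr s) powr (m - 1)"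
        using powr_mult_base[of "1 - z powr s" "m - 1"] zs by simp
      have e2: "\<theta> powr (- (s * m)) = \<theta> * \<theta> powr (- 1 - s * m)"
        using powr_mult_base[of \<theta> "- 1 - s * m"] th0 by simp
      have e3: "z powr s = z * z powr (s - 1)" using powr_mult_base[of z "s - 1"] z by simp
      have e4: "- (s * m) - 1 = - 1 - s * m" by simp
      have "(m * (1 - z powr s) powr (m - 1) * (s * z powr (s - 1) * c) * \<theta> powr (- (s * m)) +
        (1 - z powr s) powr m * (- (s * m) * \<theta> powr (- (s * m) - 1))) / (s * m) =
       (1 - z powr s) powr (m - 1) * \<theta> powr (- 1 - s * m) * (z powr (s - 1) * (c * \<theta>) - (1 - z powr s))"
        unfolding e1 e2 e4 using s m by (simp add: field_simps)
      also have "c * \<theta> = 1 - z" by (simp add: z_def)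
      also have "z powr (s - 1) * (1 - z) - (1 - z powr s) = z powr (s - 1) - 1"
        unfolding e3 by (simp add: algebra_simps)
      finally show ?thesis by (simp add: mult_ac)
    qed
    finally show "(G has_vector_derivative (1 - (1 - c * \<theta>) powr s) powr (m - 1) * ((1 - c * \<theta>) powr (s - 1) - 1)
         * \<theta> powr (- 1 - s * m)) (at \<theta> within {\<delta>..1})"
      unfolding z_def has_real_derivative_iff_has_vector_derivative by (rule has_vector_derivative_at_within)
  qed (use \<delta> in auto)
  then show ?thesis by (simp add: G_def diff_divide_distrib)
qed


text \<open>The three terms are the contributions of the part of the chord on either side of \<open>0\<close> and of the
complement of the chord. With \<open>X\<close> replaced by \<open>Z\<close> they would add up to at most
\<open>(1 + \<epsilon> powr (s m) - (1 - \<epsilon> powr s) powr m) / (s m)\<close>, of order \<open>\<epsilon> powr s\<close>, apart from the loss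
\<open>\<delta> powr (m (1 - s))\<close> that comes from truncating the harmonic identity at \<open>\<delta>\<close>.\<close>

lemma chord_pair_integral:
  fixes \<beta> s n :: real
  assumes s: "0 < s" "s \<le> \<beta>" "\<beta> < 1" and n: "0 < n"
  obtains C where "0 < C" "\<And>\<epsilon> \<delta>. 0 < \<epsilon> \<Longrightarrow> \<epsilon> < 1 \<Longrightarrow> 0 < \<delta> \<Longrightarrow> \<delta> < 1 \<Longrightarrow>
    integral {\<delta>..1} (\<lambda>\<theta>. signed_pow (1 - ((1 - \<theta>) * (1 + \<epsilon> * \<theta>)) powr \<beta>) n * \<theta> powr (- 1 - s * (n + 1)))
    - integral {\<delta>..1 / \<epsilon>} (\<lambda>\<sigma>. signed_pow (((1 + \<sigma>) * (1 - \<epsilon> * \<sigma>)) powr \<beta> - 1) n * \<sigma> powr (- 1 - s * (n + 1)))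
    + (1 + \<epsilon> powr (s * (n + 1))) / (s * (n + 1))
    \<le> C * (\<epsilon> powr (s * (n + 1) - \<beta> * n) * (1 - \<epsilon>) powr (- max 0 (1 - n)) + \<delta> powr ((n + 1) * (1 - s)))"
proof -
  define m where "m = n + 1"
  define \<nu> where "\<nu> = 2 - s + (\<beta> - s) * n"
  define \<alpha> where "\<alpha> = m * (1 - s)"
  define K where "K = max n (2 * \<beta> powr (n - 1))"
  have m: "1 < m" using n by (simp add: m_def)
  have \<nu>: "1 < \<nu>" using s mult_nonneg_nonneg[of "\<beta> - s" n] n unfolding \<nu>_def by linarith
  have \<alpha>: "0 < \<alpha>" using s m by (simp add: \<alpha>_def)
  have K: "0 < K" using n by (simp add: K_def)
  have sm: "0 < s * m" using s m by simp
  obtain C1 where C1: "0 < C1" "\<And>\<epsilon> a. 0 < \<epsilon> \<Longrightarrow> \<epsilon> < 1 \<Longrightarrow> 0 < a \<Longrightarrow> a < 1 \<Longrightarrow>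
    integral {a..1} (\<lambda>\<theta>. \<theta> powr (\<alpha> - 1) * (1 - (1 - \<epsilon>) * \<theta>) powr (- \<nu>)) \<le> C1 * \<epsilon> powr (1 - \<nu>)"
    using integral_endpoint_weight[OF \<alpha> \<nu>] by blast
  define C where "C = 2 * K * C1 + (m + 1) / (s * m)"
  have "0 < C" using K C1 m sm by (simp add: C_def add_pos_pos)
  moreover have "integral {\<delta>..1} (\<lambda>\<theta>. signed_pow (1 - ((1 - \<theta>) * (1 + \<epsilon> * \<theta>)) powr \<beta>) n * \<theta> powr (- 1 - s * (n + 1)))
    - integral {\<delta>..1 / \<epsilon>} (\<lambda>\<sigma>. signed_pow (((1 + \<sigma>) * (1 - \<epsilon> * \<sigma>)) powr \<beta> - 1) n * \<sigma> powr (- 1 - s * (n + 1)))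
    + (1 + \<epsilon> powr (s * (n + 1))) / (s * (n + 1))
    \<le> C * (\<epsilon> powr (s * (n + 1) - \<beta> * n) * (1 - \<epsilon>) powr (- max 0 (1 - n)) + \<delta> powr ((n + 1) * (1 - s)))"
    if \<epsilon>: "0 < \<epsilon>" "\<epsilon> < 1" and \<delta>: "0 < \<delta>" "\<delta> < 1" for \<epsilon> \<delta>
  proof -
    define c where "c = 1 - \<epsilon>"
    have c: "0 < c" "c < 1" using \<epsilon> by (auto simp: c_def)
    define Z where "Z = (\<lambda>\<theta>. 1 - c * \<theta>)"
    define X where "X = (\<lambda>\<theta>. (1 - \<theta>) * (1 + \<epsilon> * \<theta>))"
    define \<mu> where "\<mu> = c powr (- max 0 (1 - n))"
    have \<mu>: "1 \<le> \<mu>" using powr_mono2'[of "- max 0 (1 - n)" c 1] c by (simp add: \<mu>_def)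
    have Z: "0 < Z \<theta>" "Z \<theta> < 1" if "0 < \<theta>" "\<theta> \<le> 1" for \<theta>
    proof -
      have "c * \<theta> \<le> c" "0 < c * \<theta>" using c that mult_left_le[of \<theta> c] by simp_all
      then show "0 < Z \<theta>" "Z \<theta> < 1" using c unfolding Z_def by linarith+
    qed
    have X: "0 \<le> X \<theta>" if "0 < \<theta>" "\<theta> \<le> 1" for \<theta> using that \<epsilon> by (simp add: X_def)
    have contsp: "continuous_on S (\<lambda>x. signed_pow (f x) n)" if "continuous_on S f" for S :: "real set" and f
      using continuous_on_compose2[OF continuous_on_signed_pow[OF n] that] by simp
    \<comment> \<open>\<open>\<theta> \<mapsto> \<theta> / Z \<theta>\<close> maps \<open>{\<delta>2..1}\<close> onto \<open>{\<delta>..1 / \<epsilon>}\<close>; since \<open>\<delta>2 < \<delta>\<close>, the paired ranges do not match exactly.\<close>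
    define \<delta>2 where "\<delta>2 = \<delta> / (1 + c * \<delta>)"
    have den: "1 < 1 + c * \<delta>" using mult_pos_pos[OF c(1) \<delta>(1)] by simp
    have \<delta>2: "0 < \<delta>2" "\<delta>2 < \<delta>" "\<delta>2 < 1"
    proof -
      show "0 < \<delta>2" unfolding \<delta>2_def using \<delta> den by (intro divide_pos_pos) linarith+
      show "\<delta>2 < \<delta>" using divide_strict_left_mono[OF den \<delta>(1)] den unfolding \<delta>2_def by simp
      then show "\<delta>2 < 1" using \<delta> by simp
    qed
    define f2 where "f2 = (\<lambda>\<sigma>. signed_pow (((1 + \<sigma>) * (1 - \<epsilon> * \<sigma>)) powr \<beta> - 1) n * \<sigma> powr (- 1 - s * m))"
    define g where "g = (\<lambda>\<theta>. \<theta> / Z \<theta>)"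
    define f2' where "f2' = (\<lambda>\<theta>. signed_pow (X \<theta> powr \<beta> * Z \<theta> powr (- 2 * \<beta>) - 1) n * Z \<theta> powr (s * m - 1) * \<theta> powr (- 1 - s * m))"
    have Z1: "Z 1 = \<epsilon>" by (simp add: Z_def c_def)
    have Z2: "Z \<delta>2 = 1 / (1 + c * \<delta>)"
    proof -
      have "1 + c * \<delta> \<noteq> 0" using mult_pos_pos[OF c(1) \<delta>(1)] by linarith
      then show ?thesis by (simp add: Z_def \<delta>2_def field_simps)
    qed
    have g_ends: "g 1 = 1 / \<epsilon>" "g \<delta>2 = \<delta>"
      using mult_pos_pos[OF c(1) \<delta>(1)] by (simp_all add: g_def Z1 Z2) (simp add: \<delta>2_def)
    have g_mono: "g x \<le> g y" if "0 < x" "x \<le> y" "y \<le> 1" for x y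
      using Z[of x] Z[of y] that c unfolding g_def by (simp add: frac_le Z_def mult_left_mono)
    have sub: "((\<lambda>\<theta>. (1 / (Z \<theta>)\<^sup>2) *\<^sub>R f2 (g \<theta>)) has_integral integral {g \<delta>2..g 1} f2) {\<delta>2..1}"
    proof (rule has_integral_substitution[where c = \<delta> and d = "1/\<epsilon>"])
      show "\<delta>2 \<le> 1" using \<delta>2 by simp
      show "g \<delta>2 \<le> g 1" using g_mono[of \<delta>2 1] \<delta>2 by simp
      show "g ` {\<delta>2..1} \<subseteq> {\<delta>..1/\<epsilon>}" using g_mono[of \<delta>2] g_mono[of _ 1] \<delta>2 by (auto simp flip: g_ends)
      have "0 \<le> (1 + x) * (1 - \<epsilon> * x)" if "\<delta> \<le> x" "x \<le> 1 / \<epsilon>" for x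
      proof (rule mult_nonneg_nonneg)
        show "0 \<le> 1 - \<epsilon> * x" using that \<epsilon> by (simp add: field_simps)
      qed (use that \<delta> in auto)
      then show "continuous_on {\<delta>..1/\<epsilon>} f2"
        unfolding f2_def using \<delta> s by (intro continuous_intros contsp continuous_on_powr') auto
      fix \<theta> assume "\<theta> \<in> {\<delta>2..1}"
      then have "0 < Z \<theta>" using Z[of \<theta>] \<delta>2 by auto
      then show "(g has_field_derivative 1 / (Z \<theta>)\<^sup>2) (at \<theta> within {\<delta>2..1})"
        unfolding g_def Z_def by (auto intro!: derivative_eq_intros simp: power2_eq_square field_simps)
    qed
    have f2g: "(1 / (Z \<theta>)\<^sup>2) *\<^sub>R f2 (g \<theta>) = f2' \<theta>" if th: "0 < \<theta>" "\<theta> \<le> 1" for \<theta>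
    proof -
      note z = Z[OF th]
      have "(1 + g \<theta>) * (1 - \<epsilon> * g \<theta>) = X \<theta> / (Z \<theta>)\<^sup>2"
        using z by (simp add: g_def X_def field_simps power2_eq_square) (simp add: Z_def c_def algebra_simps)
      then have "((1 + g \<theta>) * (1 - \<epsilon> * g \<theta>)) powr \<beta> = X \<theta> powr \<beta> * Z \<theta> powr (- 2 * \<beta>)"
      proof -
        have "((Z \<theta>)\<^sup>2) powr \<beta> = (Z \<theta> powr 2) powr \<beta>" using z by simp
        also have "\<dots> = Z \<theta> powr (2 * \<beta>)" by (rule powr_powr)
        finally have "(X \<theta> / (Z \<theta>)\<^sup>2) powr \<beta> = X \<theta> powr \<beta> / Z \<theta> powr (2 * \<beta>)"
          using z X[OF th] by (simp add: powr_divide)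
        then show ?thesis
          unfolding \<open>(1 + g \<theta>) * (1 - \<epsilon> * g \<theta>) = X \<theta> / (Z \<theta>)\<^sup>2\<close> by (simp add: powr_minus divide_inverse)
      qed
      moreover have "1 / (Z \<theta>)\<^sup>2 * g \<theta> powr (- 1 - s * m) = Z \<theta> powr (s * m - 1) * \<theta> powr (- 1 - s * m)"
      proof -
        have "1 / (Z \<theta>)\<^sup>2 = Z \<theta> powr (- 2)" using z by (simp add: powr_minus divide_inverse)
        moreover have "g \<theta> powr (- 1 - s * m) = \<theta> powr (- 1 - s * m) * Z \<theta> powr (1 + s * m)"
          using z th powr_minus[of "Z \<theta>" "- 1 - s * m"] by (simp add: g_def powr_divide add.commute) (simp add: divide_inverse)
        moreover have "Z \<theta> powr (- 2) * Z \<theta> powr (1 + s * m) = Z \<theta> powr (s * m - 1)"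
          unfolding powr_add[symmetric] by (simp add: algebra_simps)
        ultimately show ?thesis by (simp add: mult_ac)
      qed
      moreover have "(1 / (Z \<theta>)\<^sup>2) *\<^sub>R f2 (g \<theta>) = signed_pow (((1 + g \<theta>) * (1 - \<epsilon> * g \<theta>)) powr \<beta> - 1) n * (1 / (Z \<theta>)\<^sup>2 * g \<theta> powr (- 1 - s * m))"
        by (simp add: f2_def)
      ultimately show ?thesis by (simp only: f2'_def mult.assoc)
    qed
    have f2i: "(f2' has_integral integral {\<delta>..1/\<epsilon>} f2) {\<delta>2..1}"
      using has_integral_eq[OF _ sub, of f2'] f2g \<delta>2 unfolding g_ends by auto

    define w where "w = (\<lambda>\<theta>. \<theta> powr (\<alpha> - 1) * Z \<theta> powr (- \<nu>))"
    define M where "M = (\<lambda>\<theta>. (1 - Z \<theta> powr s) powr (m - 1) * (Z \<theta> powr (s - 1) - 1) * \<theta> powr (- 1 - s * m))"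
    define P where "P = (\<lambda>\<theta>. signed_pow (1 - X \<theta> powr \<beta>) n * \<theta> powr (- 1 - s * m))"
    define A where "A = (\<lambda>\<theta>. (1 - Z \<theta> powr \<beta>) powr n * Z \<theta> powr (s * m - 1 - \<beta> * n) * \<theta> powr (- 1 - s * m))"
    have th_exp: "\<theta> powr (n + 1) * \<theta> powr (- 1 - s * m) = \<theta> powr (\<alpha> - 1)" for \<theta>
      unfolding powr_add[symmetric] by (simp add: \<alpha>_def m_def algebra_simps)
    have P_le: "P \<theta> \<le> (1 - Z \<theta> powr \<beta>) powr n * \<theta> powr (- 1 - s * m) + K * \<mu> * \<epsilon> * w \<theta>" if "0 < \<theta>" "\<theta> \<le> 1" for \<theta>
    proof -
      have "P \<theta> \<le> ((1 - Z \<theta> powr \<beta>) powr n + K * \<mu> * \<epsilon> * \<theta> powr (n + 1) * Z \<theta> powr (- \<nu>)) * \<theta> powr (- 1 - s * m)"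
        unfolding P_def using involution_pair_bound(1)[OF s n \<epsilon> that]
        by (intro mult_right_mono) (auto simp: Z_def X_def c_def K_def \<mu>_def \<nu>_def)
      also have "\<dots> = (1 - Z \<theta> powr \<beta>) powr n * \<theta> powr (- 1 - s * m) + K * \<mu> * \<epsilon> * (\<theta> powr (n + 1) * \<theta> powr (- 1 - s * m)) * Z \<theta> powr (- \<nu>)"
        by (simp add: algebra_simps)
      finally show ?thesis unfolding th_exp by (simp add: w_def mult_ac)
    qed
    have f2_le: "- f2' \<theta> \<le> - A \<theta> + K * \<mu> * \<epsilon> * w \<theta>" if "0 < \<theta>" "\<theta> \<le> 1" for \<theta>
    proof -
      have "- f2' \<theta> = - (signed_pow (X \<theta> powr \<beta> * Z \<theta> powr (- 2 * \<beta>) - 1) n * Z \<theta> powr (s * m - 1)) * \<theta> powr (- 1 - s * m)"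
        by (simp add: f2'_def)
      also have "\<dots> \<le> (- ((1 - Z \<theta> powr \<beta>) powr n * Z \<theta> powr (s * m - 1 - \<beta> * n)) + K * \<mu> * \<epsilon> * \<theta> powr (n + 1) * Z \<theta> powr (- \<nu>)) * \<theta> powr (- 1 - s * m)"
        using involution_pair_bound(2)[OF s n \<epsilon> that]
        by (intro mult_right_mono) (auto simp: Z_def X_def c_def K_def \<mu>_def \<nu>_def m_def)
      also have "\<dots> = - A \<theta> + K * \<mu> * \<epsilon> * (\<theta> powr (n + 1) * \<theta> powr (- 1 - s * m)) * Z \<theta> powr (- \<nu>)"
        by (simp add: A_def algebra_simps)
      finally show ?thesis unfolding th_exp by (simp add: w_def mult_ac)
    qed
    \<comment> \<open>Replacing \<open>\<beta>\<close> by the smaller exponent \<open>s\<close> shrinks both factors, which leaves the harmonic integrand \<open>M\<close>.\<close>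
    have main: "(1 - Z \<theta> powr \<beta>) powr n * \<theta> powr (- 1 - s * m) - A \<theta> \<le> - M \<theta>" if "0 < \<theta>" "\<theta> \<le> 1" for \<theta>
    proof -
      note z = Z[OF that]
      have "s * n \<le> \<beta> * n" using s n by simp
      then have e1: "Z \<theta> powr (s - 1) \<le> Z \<theta> powr (s * m - 1 - \<beta> * n)"
        using z by (intro powr_mono') (auto simp: m_def algebra_simps)
      have e2: "Z \<theta> powr \<beta> \<le> Z \<theta> powr s" "Z \<theta> powr s \<le> 1" using z s powr_mono2[of s "Z \<theta>" 1] by (auto intro: powr_mono')
      have e3: "1 \<le> Z \<theta> powr (s - 1)" using powr_mono2'[of "s - 1" "Z \<theta>" 1] z s by simp
      have "(1 - Z \<theta> powr s) powr n * (Z \<theta> powr (s - 1) - 1) \<le> (1 - Z \<theta> powr \<beta>) powr n * (Z \<theta> powr (s * m - 1 - \<beta> * n) - 1)"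
        using e1 e2 e3 n by (intro mult_mono powr_mono2) auto
      from mult_right_mono[OF this, of "\<theta> powr (- 1 - s * m)"]
      show ?thesis unfolding A_def M_def m_def by (simp add: algebra_simps)
    qed
    have contZ: "continuous_on S Z" for S unfolding Z_def by (intro continuous_intros)
    have contX: "continuous_on S X" for S unfolding X_def by (intro continuous_intros)
    have nz: "\<forall>x\<in>{a..1}. Z x \<noteq> 0" "\<forall>x\<in>{a..1}. x \<noteq> 0" "\<forall>x\<in>{a..1}. 1 - Z x powr \<beta> \<noteq> 0" if "0 < a" for a
    proof -
      have "Z x > 0 \<and> x > 0 \<and> 1 - Z x powr \<beta> > 0" if "x \<in> {a..1}" for x
        using powr_less_mono2[of \<beta> "Z x" 1] Z[of x] that \<open>0 < a\<close> s by auto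
      then show "\<forall>x\<in>{a..1}. Z x \<noteq> 0" "\<forall>x\<in>{a..1}. x \<noteq> 0" "\<forall>x\<in>{a..1}. 1 - Z x powr \<beta> \<noteq> 0" by force+
    qed
    have intw: "w integrable_on {a..1}" if "0 < a" for a
      unfolding w_def using nz[OF that] contZ by (intro integrable_continuous_real continuous_intros) auto
    have intA: "A integrable_on {a..1}" if "0 < a" for a
      unfolding A_def using nz[OF that] contZ by (intro integrable_continuous_real continuous_intros) auto
    have intP: "P integrable_on {\<delta>..1}"
      unfolding P_def using nz[OF \<delta>(1)] contX X s \<delta>
      by (intro integrable_continuous_real continuous_intros contsp continuous_on_powr') auto
    have MI: "(M has_integral ((1 - \<epsilon> powr s) powr m - (1 - (1 - c * \<delta>) powr s) powr m * \<delta> powr (- (s * m))) / (s * m)) {\<delta>..1}"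
      using has_integral_half_line_harmonic[of s m c \<delta>] s m c \<delta> unfolding M_def Z_def by (simp add: c_def)
    have i2: "- integral {\<delta>..1/\<epsilon>} f2 \<le> - integral {\<delta>..1} A + K * \<mu> * \<epsilon> * integral {\<delta>2..1} w"
    proof -
      have "((\<lambda>\<theta>. - f2' \<theta>) has_integral - integral {\<delta>..1/\<epsilon>} f2) {\<delta>2..1}" using f2i by (rule has_integral_neg)
      moreover have "((\<lambda>\<theta>. - A \<theta> + K * \<mu> * \<epsilon> * w \<theta>) has_integral - integral {\<delta>2..1} A + K * \<mu> * \<epsilon> * integral {\<delta>2..1} w) {\<delta>2..1}"
        using intw intA \<delta>2 by (intro has_integral_add has_integral_neg has_integral_mult_right) (auto simp: has_integral_integral)
      ultimately have "- integral {\<delta>..1/\<epsilon>} f2 \<le> - integral {\<delta>2..1} A + K * \<mu> * \<epsilon> * integral {\<delta>2..1} w"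
        using f2_le \<delta>2 by (elim has_integral_le) auto
      \<comment> \<open>The mismatched range \<open>{\<delta>2..\<delta>}\<close> has the favourable sign because \<open>A \<ge> 0\<close>.\<close>
      moreover have "integral {\<delta>..1} A \<le> integral {\<delta>2..1} A"
        using intA \<delta> \<delta>2 by (intro integral_subset_le) (auto simp: A_def)
      ultimately show ?thesis by linarith
    qed
    have i1: "integral {\<delta>..1} P - integral {\<delta>..1} A \<le> - integral {\<delta>..1} M + K * \<mu> * \<epsilon> * integral {\<delta>..1} w"
    proof -
      have "((\<lambda>\<theta>. P \<theta> - A \<theta>) has_integral integral {\<delta>..1} P - integral {\<delta>..1} A) {\<delta>..1}"
        using intP intA \<delta> by (intro has_integral_diff) (auto simp: has_integral_integral)
      moreover have "((\<lambda>\<theta>. - M \<theta> + K * \<mu> * \<epsilon> * w \<theta>) has_integral - integral {\<delta>..1} M + K * \<mu> * \<epsilon> * integral {\<delta>..1} w) {\<delta>..1}"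
        using intw MI \<delta> by (intro has_integral_add has_integral_neg has_integral_mult_right)
          (auto simp: has_integral_integral dest: has_integral_integrable)
      moreover have "P \<theta> - A \<theta> \<le> - M \<theta> + K * \<mu> * \<epsilon> * w \<theta>" if "\<theta> \<in> {\<delta>..1}" for \<theta>
        using P_le[of \<theta>] main[of \<theta>] that \<delta> by auto
      ultimately show ?thesis by (elim has_integral_le)
    qed
    have iw: "K * \<mu> * \<epsilon> * integral {a..1} w \<le> K * C1 * (\<epsilon> powr (s * m - \<beta> * n) * \<mu>)" if "0 < a" "a < 1" for a
    proof -
      have "K * \<mu> * \<epsilon> * integral {a..1} w \<le> K * \<mu> * \<epsilon> * (C1 * \<epsilon> powr (1 - \<nu>))"
        using C1(2)[OF \<epsilon> that] K \<mu> \<epsilon> by (intro mult_left_mono) (auto simp: w_def Z_def c_def)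
      also have "\<dots> = K * C1 * ((\<epsilon> * \<epsilon> powr (1 - \<nu>)) * \<mu>)" by (simp only: mult_ac)
      also have "\<epsilon> * \<epsilon> powr (1 - \<nu>) = \<epsilon> powr (s * m - \<beta> * n)"
      proof -
        have "2 - \<nu> = s * m - \<beta> * n" by (simp add: \<nu>_def m_def algebra_simps)
        then show ?thesis using powr_mult_base[of \<epsilon> "1 - \<nu>"] \<epsilon> by simp
      qed
      finally show ?thesis .
    qed
    have iM: "- integral {\<delta>..1} M + (1 + \<epsilon> powr (s * m)) / (s * m)
       \<le> (m + 1) / (s * m) * (\<epsilon> powr (s * m - \<beta> * n) * \<mu> + \<delta> powr \<alpha>)"
    proof -
      have ex: "\<epsilon> powr e \<le> \<epsilon> powr (s * m - \<beta> * n) * \<mu>" if "s \<le> e" for e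
      proof -
        have "s * n \<le> \<beta> * n" using s n by simp
        then have "s * m - \<beta> * n \<le> e" using that by (simp add: m_def algebra_simps)
        then have "\<epsilon> powr e \<le> \<epsilon> powr (s * m - \<beta> * n)" using \<epsilon> by (intro powr_mono') auto
        then show ?thesis using mult_left_mono[OF \<mu>, of "\<epsilon> powr (s * m - \<beta> * n)"] by simp
      qed
      have es1: "\<epsilon> powr s \<le> 1" using powr_mono2[of s \<epsilon> 1] s \<epsilon> by simp
      have b: "1 - m * \<epsilon> powr s \<le> (1 - \<epsilon> powr s) powr m"
        using affine_le_powr[of "1 - \<epsilon> powr s" m] m es1 by simp
      have d: "(1 - (1 - c * \<delta>) powr s) powr m * \<delta> powr (- (s * m)) \<le> \<delta> powr \<alpha>"
      proof -
        note z = Z[of \<delta>]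
        have "1 - Z \<delta> powr s \<le> 1 - Z \<delta>" using powr_mono'[of s 1 "Z \<delta>"] z \<delta> s by simp
        also have "\<dots> \<le> \<delta>" using c \<delta> by (simp add: Z_def)
        finally have "1 - Z \<delta> powr s \<le> \<delta>" .
        moreover have "0 \<le> 1 - Z \<delta> powr s" using powr_mono2[of s "Z \<delta>" 1] z \<delta> s by simp
        ultimately have "(1 - Z \<delta> powr s) powr m * \<delta> powr (- (s * m)) \<le> \<delta> powr m * \<delta> powr (- (s * m))"
          using m by (intro mult_right_mono powr_mono2) auto
        also have "\<dots> = \<delta> powr \<alpha>" unfolding powr_add[symmetric] by (simp add: \<alpha>_def algebra_simps)
        finally show ?thesis by (simp add: Z_def)
      qed
      have "- integral {\<delta>..1} M + (1 + \<epsilon> powr (s * m)) / (s * m) =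
        (1 + \<epsilon> powr (s * m) - (1 - \<epsilon> powr s) powr m + (1 - (1 - c * \<delta>) powr s) powr m * \<delta> powr (- (s * m))) / (s * m)"
        unfolding integral_unique[OF MI] by (simp add: diff_divide_distrib add_divide_distrib)
      also have "\<dots> \<le> (m + 1) * (\<epsilon> powr (s * m - \<beta> * n) * \<mu> + \<delta> powr \<alpha>) / (s * m)"
      proof (rule divide_right_mono)
        have "s \<le> s * m" using s m by simp
        then have "\<epsilon> powr (s * m) \<le> \<epsilon> powr (s * m - \<beta> * n) * \<mu>" by (rule ex)
        moreover have "m * \<epsilon> powr s \<le> m * (\<epsilon> powr (s * m - \<beta> * n) * \<mu>)" using ex[of s] m by (intro mult_left_mono) auto
        moreover have "\<delta> powr \<alpha> \<le> (m + 1) * \<delta> powr \<alpha>" using m by (simp add: algebra_simps)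
        ultimately show "1 + \<epsilon> powr (s * m) - (1 - \<epsilon> powr s) powr m + (1 - (1 - c * \<delta>) powr s) powr m * \<delta> powr (- (s * m))
          \<le> (m + 1) * (\<epsilon> powr (s * m - \<beta> * n) * \<mu> + \<delta> powr \<alpha>)"
          using b d by (simp add: algebra_simps)
      qed (use sm in simp)
      finally show ?thesis by simp
    qed
    have "integral {\<delta>..1} P - integral {\<delta>..1/\<epsilon>} f2 + (1 + \<epsilon> powr (s * m)) / (s * m)
      \<le> 2 * K * C1 * (\<epsilon> powr (s * m - \<beta> * n) * \<mu>) + (m + 1) / (s * m) * (\<epsilon> powr (s * m - \<beta> * n) * \<mu> + \<delta> powr \<alpha>)"
      using i1 i2 iM iw[of \<delta>] iw[of \<delta>2] \<delta> \<delta>2 by linarith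
    also have "\<dots> \<le> 2 * K * C1 * (\<epsilon> powr (s * m - \<beta> * n) * \<mu> + \<delta> powr \<alpha>) + (m + 1) / (s * m) * (\<epsilon> powr (s * m - \<beta> * n) * \<mu> + \<delta> powr \<alpha>)"
      using K C1(1) m sm by (intro add_mono mult_left_mono) auto
    also have "\<dots> = C * (\<epsilon> powr (s * m - \<beta> * n) * \<mu> + \<delta> powr \<alpha>)" unfolding C_def distrib_right ..
    finally show ?thesis unfolding P_def X_def f2_def \<mu>_def c_def \<alpha>_def m_def .
  qed
  ultimately show ?thesis using that by blast
qed


section \<open>Polar coordinates and singular kernels\<close>

lemma nn_integral_power_tail:
  fixes a \<delta> :: real
  assumes "0 < a" "0 < \<delta>"
  shows "(\<integral>\<^sup>+\<sigma>. ennreal (\<sigma> powr (- 1 - a) * indicator {\<delta>..} \<sigma>) \<partial>lborel) = ennreal (\<delta> powr (- a) / a)"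
proof (rule nn_integral_has_integral_lborel)
  have "((\<lambda>\<sigma>. \<sigma> powr (- 1 - a)) has_integral \<delta> powr (- a) / a) {\<delta>..}"
    using has_integral_powr_to_inf[of "- 1 - a" \<delta>] assms by simp
  then show "((\<lambda>\<sigma>. \<sigma> powr (- 1 - a) * indicator {\<delta>..} \<sigma>) has_integral \<delta> powr (- a) / a) UNIV"
    by (subst (asm) has_integral_restrict_UNIV[symmetric]) (erule has_integral_eq[rotated], auto simp: indicator_def)
qed auto

lemma nn_integral_power_near_0:
  fixes a R :: real
  assumes "0 < a" "0 < R"
  shows "(\<integral>\<^sup>+\<sigma>. ennreal (\<sigma> powr (a - 1) * indicator {0..R} \<sigma>) \<partial>lborel) = ennreal (R powr a / a)"
proof (rule nn_integral_has_integral_lborel)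
  have "((\<lambda>\<sigma>. \<sigma> powr (a - 1)) has_integral R powr a / a) {0..R}"
    using has_integral_powr_from_0[of "a - 1" R] assms by simp
  then show "((\<lambda>\<sigma>. \<sigma> powr (a - 1) * indicator {0..R} \<sigma>) has_integral R powr a / a) UNIV"
    by (subst (asm) has_integral_restrict_UNIV[symmetric]) (erule has_integral_eq[rotated], auto simp: indicator_def)
qed auto

lemma nn_integral_even_real:
  fixes f :: "real \<Rightarrow> ennreal"
  assumes [measurable]: "f \<in> borel_measurable borel"
  shows "(\<integral>\<^sup>+t. f \<bar>t\<bar> \<partial>lborel) = 2 * (\<integral>\<^sup>+t. f t * indicator {0..} t \<partial>lborel)"
proof -
  have "(\<integral>\<^sup>+t. f \<bar>t\<bar> \<partial>lborel) = (\<integral>\<^sup>+t. f t * indicator {0..} t + f (- t) * indicator {0..} (- t) \<partial>lborel)"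
  proof (rule nn_integral_cong_AE)
    have "AE t in lborel. t \<noteq> (0::real)" by (rule AE_lborel_singleton)
    then show "AE t in lborel. f \<bar>t\<bar> = f t * indicator {0..} t + f (- t) * indicator {0..} (- t)"
      by eventually_elim (auto simp: indicator_def abs_if)
  qed
  also have "\<dots> = (\<integral>\<^sup>+t. f t * indicator {0..} t \<partial>lborel) + (\<integral>\<^sup>+t. f (- t) * indicator {0..} (- t) \<partial>lborel)"
    by (intro nn_integral_add) auto
  also have "(\<integral>\<^sup>+t. f (- t) * indicator {0..} (- t) \<partial>lborel) = (\<integral>\<^sup>+t. f t * indicator {0..} t \<partial>lborel)"
    using nn_integral_real_affine[of "\<lambda>t. f t * indicator {0..} t" "- 1" 0] by simp
  finally show ?thesis by (simp add: mult_2)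
qed

lemma nn_integral_euclidean_affine:
  fixes f :: "'a::euclidean_space \<Rightarrow> ennreal"
  assumes [measurable]: "f \<in> borel_measurable borel" and c: "c \<noteq> 0"
  shows "(\<integral>\<^sup>+x. f x \<partial>lborel) = ennreal (\<bar>c\<bar> ^ DIM('a)) * (\<integral>\<^sup>+x. f (t + c *\<^sub>R x) \<partial>lborel)"
proof -
  have "(\<integral>\<^sup>+x. f x \<partial>lborel) = (\<integral>\<^sup>+x. f x \<partial>density (distr lborel borel (\<lambda>x. t + c *\<^sub>R x)) (\<lambda>_. ennreal (\<bar>c\<bar> ^ DIM('a))))"
    using arg_cong[OF lborel_affine[OF c, of t], of "\<lambda>M. integral\<^sup>N M f"] by (simp only:)
  also have "\<dots> = ennreal (\<bar>c\<bar> ^ DIM('a)) * (\<integral>\<^sup>+x. f (t + c *\<^sub>R x) \<partial>lborel)"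
    by (subst nn_integral_density, simp, simp, subst nn_integral_distr, simp, simp, subst nn_integral_cmult, simp, rule refl)
  finally show ?thesis .
qed

text \<open>The logarithmic measure of the dilations that carry a given point into the shell \<open>1 \<le> |\<omega>| \<le> 2\<close>, which does
not depend on the point.\<close>

lemma nn_integral_log_shell:
  fixes R :: real
  assumes "0 < R"
  shows "(\<integral>\<^sup>+l. ennreal (1 / \<bar>l\<bar>) * indicator {R / 2..R} \<bar>l\<bar> \<partial>lborel) = ennreal (2 * ln 2)"
proof -
  have "(\<integral>\<^sup>+l. ennreal (1 / \<bar>l\<bar>) * indicator {R / 2..R} \<bar>l\<bar> \<partial>lborel)
      = 2 * (\<integral>\<^sup>+l. (ennreal (1 / l) * indicator {R / 2..R} l) * indicator {0..} l \<partial>lborel)"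
    by (rule nn_integral_even_real) simp
  also have "(\<integral>\<^sup>+l. (ennreal (1 / l) * indicator {R / 2..R} l) * indicator {0..} l \<partial>lborel)
      = (\<integral>\<^sup>+l. ennreal (1 / l) * indicator {R / 2..R} l \<partial>lborel)"
    using assms by (intro nn_integral_cong) (auto simp: indicator_def)
  also have "\<dots> = ennreal (ln R - ln (R / 2))"
    using assms by (intro nn_integral_FTC_Icc) (auto intro!: derivative_eq_intros)
  also have "ln R - ln (R / 2) = ln 2" using assms by (simp add: ln_div)
  finally show ?thesis by (simp add: numeral_mult_ennreal)
qed

text \<open>Polar coordinates without a surface measure: directions are averaged over the shell \<open>1 \<le> |\<omega>| \<le> 2\<close>.
Substituting \<open>x = l \<omega>\<close> for fixed \<open>l\<close> turns the right-hand side into the integral of \<open>f x\<close> times the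
logarithmic measure of \<open>{l. |x| / 2 \<le> |l| \<le> |x|}\<close>.\<close>

lemma nn_integral_polar:
  fixes f :: "'a::euclidean_space \<Rightarrow> ennreal"
  assumes [measurable]: "f \<in> borel_measurable borel"
  shows "ennreal (2 * ln 2) * (\<integral>\<^sup>+x. f x \<partial>lborel) =
    (\<integral>\<^sup>+\<omega>. indicator {1..2} (norm \<omega>) * (\<integral>\<^sup>+l. ennreal (\<bar>l\<bar> powr (real DIM('a) - 1)) * f (l *\<^sub>R \<omega>) \<partial>lborel) \<partial>lborel)"
proof -
  let ?N = "real DIM('a)"
  have "(\<integral>\<^sup>+(\<omega>::'a). indicator {1..2} (norm \<omega>) * (\<integral>\<^sup>+l. ennreal (\<bar>l\<bar> powr (?N - 1)) * f (l *\<^sub>R \<omega>) \<partial>lborel) \<partial>lborel)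
    = (\<integral>\<^sup>+\<omega>. \<integral>\<^sup>+l. indicator {1..2} (norm \<omega>) * (ennreal (\<bar>l\<bar> powr (?N - 1)) * f (l *\<^sub>R \<omega>)) \<partial>lborel \<partial>lborel)"
    by (intro nn_integral_cong nn_integral_cmult[symmetric]) auto
  also have "\<dots> = (\<integral>\<^sup>+l. \<integral>\<^sup>+\<omega>. indicator {1..2} (norm \<omega>) * (ennreal (\<bar>l\<bar> powr (?N - 1)) * f (l *\<^sub>R \<omega>)) \<partial>lborel \<partial>lborel)"
    by (rule lborel_pair.Fubini') measurable
  also have "\<dots> = (\<integral>\<^sup>+l. \<integral>\<^sup>+x. ennreal (1 / \<bar>l\<bar>) * indicator {norm x / 2..norm x} \<bar>l\<bar> * f x \<partial>lborel \<partial>lborel)"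
  proof (rule nn_integral_cong_AE)
    have "AE l in lborel. l \<noteq> (0::real)" by (rule AE_lborel_singleton)
    then show "AE l in lborel. (\<integral>\<^sup>+\<omega>. indicator {1..2} (norm \<omega>) * (ennreal (\<bar>l\<bar> powr (?N - 1)) * f (l *\<^sub>R \<omega>)) \<partial>lborel)
        = (\<integral>\<^sup>+x. ennreal (1 / \<bar>l\<bar>) * indicator {norm x / 2..norm x} \<bar>l\<bar> * f x \<partial>lborel)"
    proof eventually_elim
      case (elim l)
      have "(\<integral>\<^sup>+x. ennreal (1 / \<bar>l\<bar>) * indicator {norm x / 2..norm x} \<bar>l\<bar> * f x \<partial>lborel)
        = ennreal (\<bar>l\<bar> ^ DIM('a)) * (\<integral>\<^sup>+x. ennreal (1 / \<bar>l\<bar>) * indicator {norm (l *\<^sub>R x) / 2..norm (l *\<^sub>R x)} \<bar>l\<bar> * f (l *\<^sub>R x) \<partial>lborel)"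
        using elim nn_integral_euclidean_affine[of "\<lambda>x. ennreal (1 / \<bar>l\<bar>) * indicator {norm x / 2..norm x} \<bar>l\<bar> * f x" l 0]
        by (simp add: indicator_def)
      also have "\<dots> = (\<integral>\<^sup>+x. ennreal (\<bar>l\<bar> ^ DIM('a)) * (ennreal (1 / \<bar>l\<bar>) * indicator {norm (l *\<^sub>R x) / 2..norm (l *\<^sub>R x)} \<bar>l\<bar> * f (l *\<^sub>R x)) \<partial>lborel)"
        by (intro nn_integral_cmult[symmetric]) (simp add: indicator_def)
      also have "\<dots> = (\<integral>\<^sup>+\<omega>. indicator {1..2} (norm \<omega>) * (ennreal (\<bar>l\<bar> powr (?N - 1)) * f (l *\<^sub>R \<omega>)) \<partial>lborel)"
      proof (rule nn_integral_cong)
        fix x :: 'a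
        have "\<bar>l\<bar> ^ DIM('a) * (1 / \<bar>l\<bar>) = \<bar>l\<bar> powr (?N - 1)"
          using elim by (simp add: powr_diff powr_realpow)
        then have 1: "ennreal (\<bar>l\<bar> ^ DIM('a)) * ennreal (1 / \<bar>l\<bar>) = ennreal (\<bar>l\<bar> powr (?N - 1))"
          by (simp flip: ennreal_mult'')
        have 2: "(indicator {norm (l *\<^sub>R x) / 2..norm (l *\<^sub>R x)} \<bar>l\<bar> :: ennreal) = indicator {1..2} (norm x)"
          using elim by (auto simp: indicator_def field_simps)
        show "ennreal (\<bar>l\<bar> ^ DIM('a)) * (ennreal (1 / \<bar>l\<bar>) * indicator {norm (l *\<^sub>R x) / 2..norm (l *\<^sub>R x)} \<bar>l\<bar> * f (l *\<^sub>R x))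
          = indicator {1..2} (norm x) * (ennreal (\<bar>l\<bar> powr (?N - 1)) * f (l *\<^sub>R x))"
          unfolding 1[symmetric] 2 by (simp only: mult_ac)
      qed
      finally show ?case ..
    qed
  qed
  also have "\<dots> = (\<integral>\<^sup>+x. \<integral>\<^sup>+l. ennreal (1 / \<bar>l\<bar>) * indicator {norm x / 2..norm x} \<bar>l\<bar> * f x \<partial>lborel \<partial>lborel)"
    by (rule lborel_pair.Fubini'[symmetric]) (simp add: indicator_def split_beta')
  also have "\<dots> = (\<integral>\<^sup>+x. ennreal (2 * ln 2) * f x \<partial>lborel)"
  proof (rule nn_integral_cong_AE)
    have "AE x in lborel. x \<noteq> (0::'a)" by (rule AE_lborel_singleton)
    then show "AE x in lborel. (\<integral>\<^sup>+l. ennreal (1 / \<bar>l\<bar>) * indicator {norm x / 2..norm x} \<bar>l\<bar> * f x \<partial>lborel) = ennreal (2 * ln 2) * f x"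
    proof eventually_elim
      case (elim x)
      have "(\<integral>\<^sup>+l. ennreal (1 / \<bar>l\<bar>) * indicator {norm x / 2..norm x} \<bar>l\<bar> * f x \<partial>lborel)
        = (\<integral>\<^sup>+l. ennreal (1 / \<bar>l\<bar>) * indicator {norm x / 2..norm x} \<bar>l\<bar> \<partial>lborel) * f x"
        by (intro nn_integral_multc) (simp add: indicator_def)
      then show ?case using nn_integral_log_shell[of "norm x"] elim by simp
    qed
  qed
  also have "\<dots> = ennreal (2 * ln 2) * (\<integral>\<^sup>+x. f x \<partial>lborel)" by (intro nn_integral_cmult) auto
  finally show ?thesis ..
qed

lemma shell_finite: "(\<integral>\<^sup>+(\<omega>::'a::euclidean_space). indicator {1..2} (norm \<omega>) \<partial>lborel) < \<infinity>"
proof -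
  have "(\<integral>\<^sup>+(\<omega>::'a). indicator {1..2} (norm \<omega>) \<partial>lborel) \<le> (\<integral>\<^sup>+\<omega>. indicator (cball (0::'a) 2) \<omega> \<partial>lborel)"
    by (intro nn_integral_mono) (auto simp: indicator_def)
  also have "\<dots> < \<infinity>" using emeasure_bounded_finite[of "cball (0::'a) 2"] by simp
  finally show ?thesis .
qed

text \<open>The bound \<open>B\<close> has to be uniform over the shell, since the radius of \<open>\<omega>\<close> is only known up to a factor \<open>2\<close>.\<close>

lemma nn_integral_radial_finite:
  fixes g :: "real \<Rightarrow> real"
  assumes [measurable]: "g \<in> borel_measurable borel" and g0: "\<And>t. 0 \<le> g t"
    and fin: "\<And>\<rho>. 1 \<le> \<rho> \<Longrightarrow> \<rho> \<le> 2 \<Longrightarrow> (\<integral>\<^sup>+t. ennreal (t powr (real DIM('a) - 1) * g (t * \<rho>)) * indicator {0..} t \<partial>lborel) \<le> ennreal B"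
  shows "(\<integral>\<^sup>+(x::'a::euclidean_space). ennreal (g (norm x)) \<partial>lborel) < \<infinity>"
proof -
  let ?N = "real DIM('a)"
  have "ennreal (2 * ln 2) * (\<integral>\<^sup>+(x::'a). ennreal (g (norm x)) \<partial>lborel)
    = (\<integral>\<^sup>+(\<omega>::'a). indicator {1..2} (norm \<omega>) * (\<integral>\<^sup>+l. ennreal (\<bar>l\<bar> powr (?N - 1)) * ennreal (g (norm (l *\<^sub>R \<omega>))) \<partial>lborel) \<partial>lborel)"
    by (rule nn_integral_polar) simp
  also have "\<dots> \<le> (\<integral>\<^sup>+(\<omega>::'a). indicator {1..2} (norm \<omega>) * (2 * ennreal B) \<partial>lborel)"
  proof (rule nn_integral_mono)
    fix \<omega> :: 'a
    show "indicator {1..2} (norm \<omega>) * (\<integral>\<^sup>+l. ennreal (\<bar>l\<bar> powr (?N - 1)) * ennreal (g (norm (l *\<^sub>R \<omega>))) \<partial>lborel)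
      \<le> indicator {1..2} (norm \<omega>) * (2 * ennreal B)"
    proof (cases "norm \<omega> \<in> {1..2}")
      case True
      have "(\<integral>\<^sup>+l. ennreal (\<bar>l\<bar> powr (?N - 1)) * ennreal (g (norm (l *\<^sub>R \<omega>))) \<partial>lborel)
        = (\<integral>\<^sup>+l. ennreal (\<bar>l\<bar> powr (?N - 1) * g (\<bar>l\<bar> * norm \<omega>)) \<partial>lborel)"
        using g0 by (simp add: ennreal_mult)
      also have "\<dots> = 2 * (\<integral>\<^sup>+t. ennreal (t powr (?N - 1) * g (t * norm \<omega>)) * indicator {0..} t \<partial>lborel)"
        by (rule nn_integral_even_real) simp
      also have "\<dots> \<le> 2 * ennreal B" using fin[of "norm \<omega>"] True by (intro mult_left_mono) auto
      finally show ?thesis by (intro mult_left_mono) auto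
    qed simp
  qed
  also have "\<dots> = (\<integral>\<^sup>+(\<omega>::'a). indicator {1..2} (norm \<omega>) \<partial>lborel) * (2 * ennreal B)"
    by (intro nn_integral_multc) simp
  also have "\<dots> < \<infinity>" using shell_finite[where 'a='a] by (simp add: ennreal_mult_less_top)
  finally show ?thesis by (auto simp: ennreal_mult_less_top)
qed

lemma nn_integral_kernel_tail_finite:
  fixes a \<delta> :: real
  assumes "0 < a" "0 < \<delta>"
  shows "(\<integral>\<^sup>+(x::'a::euclidean_space). ennreal (indicator {\<delta><..} (norm x) / norm x powr (real DIM('a) + a)) \<partial>lborel) < \<infinity>"
proof (rule nn_integral_radial_finite[where B = "(\<delta> / 2) powr (- a) / a"])
  fix \<rho> :: real assume \<rho>: "1 \<le> \<rho>" "\<rho> \<le> 2"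
  let ?N = "real DIM('a)"
  have "(\<integral>\<^sup>+t. ennreal (t powr (?N - 1) * (indicator {\<delta><..} (t * \<rho>) / (t * \<rho>) powr (?N + a))) * indicator {0..} t \<partial>lborel)
    \<le> (\<integral>\<^sup>+t. ennreal (t powr (- 1 - a) * indicator {\<delta> / 2..} t) \<partial>lborel)"
  proof (rule nn_integral_mono)
    fix t :: real
    show "ennreal (t powr (?N - 1) * (indicator {\<delta><..} (t * \<rho>) / (t * \<rho>) powr (?N + a))) * indicator {0..} t
       \<le> ennreal (t powr (- 1 - a) * indicator {\<delta> / 2..} t)"
    proof (cases "0 < t \<and> \<delta> < t * \<rho>")
      case True
      have "t * \<rho> \<le> t * 2" using \<rho> True by (intro mult_left_mono) auto
      then have "\<delta> / 2 \<le> t" using True by linarith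
      have "t powr (?N - 1) / (t * \<rho>) powr (?N + a) \<le> t powr (?N - 1) / t powr (?N + a)"
        using True \<rho> assms by (intro divide_left_mono powr_mono2) (auto simp: mult_le_cancel_left1)
      also have "\<dots> = t powr (- 1 - a)" by (simp flip: powr_diff)
      finally show ?thesis using True \<open>\<delta> / 2 \<le> t\<close> by (simp add: ennreal_leI)
    next
      case False
      then consider "t < 0" | "t = 0" | "0 \<le> t" "\<not> \<delta> < t * \<rho>" by linarith
      then show ?thesis using assms by cases (auto simp: indicator_def)
    qed
  qed
  also have "\<dots> = ennreal ((\<delta> / 2) powr (- a) / a)" using assms by (intro nn_integral_power_tail) auto
  finally show "(\<integral>\<^sup>+t. ennreal (t powr (?N - 1) * (indicator {\<delta><..} (t * \<rho>) / (t * \<rho>) powr (?N + a))) * indicator {0..} t \<partial>lborel)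
     \<le> ennreal ((\<delta> / 2) powr (- a) / a)" .
qed (auto simp: indicator_def)

lemma nn_integral_kernel_near_finite:
  fixes a R :: real
  assumes "0 < a" "0 < R"
  shows "(\<integral>\<^sup>+(x::'a::euclidean_space). ennreal (indicator {..R} (norm x) * norm x powr (a - real DIM('a))) \<partial>lborel) < \<infinity>"
proof (rule nn_integral_radial_finite[where B = "2 powr a * (R powr a / a)"])
  fix \<rho> :: real assume \<rho>: "1 \<le> \<rho>" "\<rho> \<le> 2"
  let ?N = "real DIM('a)"
  have "(\<integral>\<^sup>+t. ennreal (t powr (?N - 1) * (indicator {..R} (t * \<rho>) * (t * \<rho>) powr (a - ?N))) * indicator {0..} t \<partial>lborel)
    \<le> (\<integral>\<^sup>+t. ennreal (2 powr a) * ennreal (t powr (a - 1) * indicator {0..R} t) \<partial>lborel)"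
  proof (rule nn_integral_mono)
    fix t :: real
    show "ennreal (t powr (?N - 1) * (indicator {..R} (t * \<rho>) * (t * \<rho>) powr (a - ?N))) * indicator {0..} t
       \<le> ennreal (2 powr a) * ennreal (t powr (a - 1) * indicator {0..R} t)"
    proof (cases "0 < t \<and> t * \<rho> \<le> R")
      case True
      have "t \<le> t * \<rho>" using True \<rho> by (simp add: mult_le_cancel_left1)
      then have "t \<le> R" using True by linarith
      have "\<rho> powr (a - ?N) \<le> \<rho> powr a" using \<rho> by (intro powr_mono) auto
      also have "\<dots> \<le> 2 powr a" using \<rho> assms by (intro powr_mono2) auto
      finally have "t powr (?N - 1) * (t powr (a - ?N) * \<rho> powr (a - ?N)) \<le> t powr (?N - 1) * (t powr (a - ?N) * 2 powr a)"
        by (intro mult_left_mono) auto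
      also have "\<dots> = (t powr (?N - 1) * t powr (a - ?N)) * 2 powr a" by simp
      also have "\<dots> = 2 powr a * t powr (a - 1)" by (simp flip: powr_add)
      finally have "t powr (?N - 1) * (t * \<rho>) powr (a - ?N) \<le> 2 powr a * t powr (a - 1)"
        using True \<rho> by (simp add: powr_mult)
      then show ?thesis using True \<open>t \<le> R\<close> by (simp add: ennreal_leI flip: ennreal_mult)
    next
      case False
      then consider "t < 0" | "t = 0" | "0 \<le> t" "\<not> t * \<rho> \<le> R" by linarith
      then show ?thesis using assms by cases (auto simp: indicator_def)
    qed
  qed
  also have "\<dots> = ennreal (2 powr a) * ennreal (R powr a / a)"
    using assms by (subst nn_integral_cmult) (auto simp: nn_integral_power_near_0)
  also have "\<dots> = ennreal (2 powr a * (R powr a / a))" using assms by (simp flip: ennreal_mult)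
  finally show "(\<integral>\<^sup>+t. ennreal (t powr (?N - 1) * (indicator {..R} (t * \<rho>) * (t * \<rho>) powr (a - ?N))) * indicator {0..} t \<partial>lborel)
     \<le> ennreal (2 powr a * (R powr a / a))" .
qed (auto simp: indicator_def)

lemma nn_integral_translate_singularity:
  fixes \<gamma> c :: real
  assumes "0 \<le> \<gamma>" "\<gamma> < 1"
  shows "(\<integral>\<^sup>+t. ennreal (\<bar>c - t\<bar> powr (- \<gamma>)) * indicator {0..1} t \<partial>lborel) \<le> ennreal (1 + 2 / (1 - \<gamma>))"
proof -
  have "(\<integral>\<^sup>+t. ennreal (\<bar>c - t\<bar> powr (- \<gamma>)) * indicator {0..1} t \<partial>lborel)
     \<le> (\<integral>\<^sup>+t. indicator {0..1} t + ennreal (\<bar>c - t\<bar> powr (- \<gamma>) * indicator {0..1} \<bar>c - t\<bar>) \<partial>lborel)"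
  proof (rule nn_integral_mono)
    fix t :: real
    show "ennreal (\<bar>c - t\<bar> powr (- \<gamma>)) * indicator {0..1} t \<le> indicator {0..1} t + ennreal (\<bar>c - t\<bar> powr (- \<gamma>) * indicator {0..1} \<bar>c - t\<bar>)"
    proof (cases "\<bar>c - t\<bar> \<le> 1")
      case False
      then have "\<bar>c - t\<bar> powr (- \<gamma>) \<le> 1 powr (- \<gamma>)" using assms by (intro powr_mono2') auto
      then have "ennreal (\<bar>c - t\<bar> powr (- \<gamma>)) \<le> 1" by simp
      then show ?thesis by (auto simp: indicator_def)
    qed (auto simp: indicator_def)
  qed
  also have "\<dots> = (\<integral>\<^sup>+t. indicator {0..1::real} t \<partial>lborel) + (\<integral>\<^sup>+t. ennreal (\<bar>c - t\<bar> powr (- \<gamma>) * indicator {0..1} \<bar>c - t\<bar>) \<partial>lborel)"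
    by (intro nn_integral_add) (auto simp: indicator_def)
  also have "(\<integral>\<^sup>+t. ennreal (\<bar>c - t\<bar> powr (- \<gamma>) * indicator {0..1} \<bar>c - t\<bar>) \<partial>lborel)
     = (\<integral>\<^sup>+t. ennreal (\<bar>t\<bar> powr (- \<gamma>) * indicator {0..1} \<bar>t\<bar>) \<partial>lborel)"
    by (subst nn_integral_real_affine[where c = "- 1" and t = c]) (auto simp: indicator_def)
  also have "\<dots> = 2 * (\<integral>\<^sup>+t. ennreal (t powr (- \<gamma>) * indicator {0..1} t) * indicator {0..} t \<partial>lborel)"
    by (rule nn_integral_even_real) simp
  also have "(\<integral>\<^sup>+t. ennreal (t powr (- \<gamma>) * indicator {0..1} t) * indicator {0..} t \<partial>lborel)
     = (\<integral>\<^sup>+t. ennreal (t powr ((1 - \<gamma>) - 1) * indicator {0..1} t) \<partial>lborel)"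
    by (intro nn_integral_cong) (auto simp: indicator_def)
  also have "\<dots> = ennreal (1 powr (1 - \<gamma>) / (1 - \<gamma>))" using assms by (intro nn_integral_power_near_0) auto
  also have "(\<integral>\<^sup>+t. indicator {0..1::real} t \<partial>lborel) + 2 * ennreal (1 powr (1 - \<gamma>) / (1 - \<gamma>)) = ennreal (1 + 2 / (1 - \<gamma>))"
    using assms by (simp add: ennreal_plus numeral_mult_ennreal)
  finally show ?thesis .
qed

text \<open>The bound does not depend on the direction \<open>e\<close>. Translating the domain by \<open>t e\<close> with \<open>0 \<le> t \<le> 1\<close> and
averaging over \<open>t\<close> replaces the singular factor by \<open>|\<omega> \<bullet> e - t| powr - \<gamma>\<close>, whose mean over \<open>t\<close> is bounded.\<close>

lemma nn_integral_hyperplane_singularity: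
  fixes \<gamma> :: real
  assumes \<gamma>: "0 \<le> \<gamma>" "\<gamma> < 1"
  obtains B where "0 \<le> B" "\<And>e::'a::euclidean_space. norm e = 1 \<Longrightarrow>
    (\<integral>\<^sup>+\<omega>. ennreal (\<bar>\<omega> \<bullet> e\<bar> powr (- \<gamma>)) * indicator {..2} (norm \<omega>) \<partial>lborel) \<le> ennreal B"
proof
  define V where "V = measure lborel (cball (0::'a) 3)"
  have V: "emeasure lborel (cball (0::'a) 3) = ennreal V"
    unfolding V_def using emeasure_lborel_cball_finite[of 0 3]
    by (intro emeasure_eq_ennreal_measure) (auto simp: less_top)
  have V0: "0 \<le> V" by (simp add: V_def)
  define B where "B = V * (1 + 2 / (1 - \<gamma>))"
  show "0 \<le> B" using \<gamma> V0 by (simp add: B_def)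
  fix e :: 'a assume e: "norm e = 1"
  have shift: "(\<integral>\<^sup>+\<omega>. ennreal (\<bar>\<omega> \<bullet> e\<bar> powr (- \<gamma>)) * indicator {..2} (norm \<omega>) \<partial>lborel)
    \<le> (\<integral>\<^sup>+\<omega>. ennreal (\<bar>\<omega> \<bullet> e - t\<bar> powr (- \<gamma>)) * indicator {..3} (norm \<omega>) \<partial>lborel)" if t: "t \<in> {0..1}" for t
  proof -
    have "(\<integral>\<^sup>+\<omega>. ennreal (\<bar>\<omega> \<bullet> e\<bar> powr (- \<gamma>)) * indicator {..2} (norm \<omega>) \<partial>lborel)
      = (\<integral>\<^sup>+\<omega>. ennreal (\<bar>(\<omega> - t *\<^sub>R e) \<bullet> e\<bar> powr (- \<gamma>)) * indicator {..2} (norm (\<omega> - t *\<^sub>R e)) \<partial>lborel)"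
      using nn_integral_euclidean_affine[of "\<lambda>\<omega>. ennreal (\<bar>\<omega> \<bullet> e\<bar> powr (- \<gamma>)) * indicator {..2} (norm \<omega>)" 1 "- (t *\<^sub>R e)"]
      by (simp add: indicator_def)
    also have "\<dots> \<le> (\<integral>\<^sup>+\<omega>. ennreal (\<bar>\<omega> \<bullet> e - t\<bar> powr (- \<gamma>)) * indicator {..3} (norm \<omega>) \<partial>lborel)"
    proof (rule nn_integral_mono)
      fix \<omega> :: 'a
      have ee: "e \<bullet> e = 1" using e by (simp add: norm_eq_1)
      have "norm \<omega> \<le> norm (\<omega> - t *\<^sub>R e) + norm (t *\<^sub>R e)" by (metis diff_add_cancel norm_triangle_ineq)
      then have "norm \<omega> \<le> norm (\<omega> - t *\<^sub>R e) + 1" using e t by simp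
      then show "ennreal (\<bar>(\<omega> - t *\<^sub>R e) \<bullet> e\<bar> powr (- \<gamma>)) * indicator {..2} (norm (\<omega> - t *\<^sub>R e))
        \<le> ennreal (\<bar>\<omega> \<bullet> e - t\<bar> powr (- \<gamma>)) * indicator {..3} (norm \<omega>)"
        by (auto simp: indicator_def inner_diff_left ee)
    qed
    finally show ?thesis .
  qed
  let ?I = "(\<integral>\<^sup>+\<omega>. ennreal (\<bar>\<omega> \<bullet> e\<bar> powr (- \<gamma>)) * indicator {..2} (norm \<omega>) \<partial>lborel)"
  have "?I = (\<integral>\<^sup>+t. ?I * indicator {0..1::real} t \<partial>lborel)" by (simp add: nn_integral_cmult)
  also have "\<dots> \<le> (\<integral>\<^sup>+t. (\<integral>\<^sup>+\<omega>. ennreal (\<bar>\<omega> \<bullet> e - t\<bar> powr (- \<gamma>)) * indicator {..3} (norm \<omega>) \<partial>lborel) * indicator {0..1::real} t \<partial>lborel)"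
    using shift by (intro nn_integral_mono) (auto simp: indicator_def)
  also have "\<dots> = (\<integral>\<^sup>+t. \<integral>\<^sup>+\<omega>. ennreal (\<bar>\<omega> \<bullet> e - t\<bar> powr (- \<gamma>)) * indicator {..3} (norm \<omega>) * indicator {0..1::real} t \<partial>lborel \<partial>lborel)"
    by (intro nn_integral_cong nn_integral_multc[symmetric]) auto
  also have "\<dots> = (\<integral>\<^sup>+\<omega>. \<integral>\<^sup>+t. ennreal (\<bar>\<omega> \<bullet> e - t\<bar> powr (- \<gamma>)) * indicator {..3} (norm \<omega>) * indicator {0..1::real} t \<partial>lborel \<partial>lborel)"
    by (rule lborel_pair.Fubini') measurable
  also have "\<dots> = (\<integral>\<^sup>+\<omega>. indicator {..3} (norm \<omega>) * (\<integral>\<^sup>+t. ennreal (\<bar>\<omega> \<bullet> e - t\<bar> powr (- \<gamma>)) * indicator {0..1::real} t \<partial>lborel) \<partial>lborel)"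
    by (intro nn_integral_cong) (subst nn_integral_cmult[symmetric], auto simp: mult_ac)
  also have "\<dots> \<le> (\<integral>\<^sup>+(\<omega>::'a). indicator {..3} (norm \<omega>) * ennreal (1 + 2 / (1 - \<gamma>)) \<partial>lborel)"
    using nn_integral_translate_singularity[OF \<gamma>] by (intro nn_integral_mono mult_left_mono) auto
  also have "\<dots> = ennreal V * ennreal (1 + 2 / (1 - \<gamma>))"
  proof -
    have "(\<lambda>\<omega>::'a. indicator {..3} (norm \<omega>) :: ennreal) = indicator (cball 0 3)" by (auto simp: indicator_def)
    then have "(\<integral>\<^sup>+(\<omega>::'a). indicator {..3} (norm \<omega>) \<partial>lborel) = ennreal V" using V by simp
    then show ?thesis by (simp add: nn_integral_multc)
  qed
  also have "\<dots> = ennreal B" using V0 \<gamma> by (simp add: B_def ennreal_mult)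
  finally show "?I \<le> ennreal B" .
qed


section \<open>The operator on an arbitrary chord\<close>

lemma integrable_kernel_tail_real:
  fixes a \<delta> :: real
  assumes "0 < a" "0 < \<delta>"
  shows "integrable lborel (\<lambda>\<sigma>::real. \<bar>\<sigma>\<bar> powr (- 1 - a) * indicator {\<delta><..} \<bar>\<sigma>\<bar>)"
    and "(LINT \<sigma>|lborel. \<bar>\<sigma>\<bar> powr (- 1 - a) * indicator {\<delta><..} \<bar>\<sigma>\<bar>) \<le> 2 * \<delta> powr (- a) / a"
proof -
  have "(\<integral>\<^sup>+\<sigma>. ennreal (\<bar>\<sigma>\<bar> powr (- 1 - a) * indicator {\<delta><..} \<bar>\<sigma>\<bar>) \<partial>lborel)
    = 2 * (\<integral>\<^sup>+t. ennreal (t powr (- 1 - a) * indicator {\<delta><..} t) * indicator {0..} t \<partial>lborel)"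
    by (rule nn_integral_even_real) simp
  also have "\<dots> \<le> 2 * (\<integral>\<^sup>+t. ennreal (t powr (- 1 - a) * indicator {\<delta>..} t) \<partial>lborel)"
    by (intro mult_left_mono nn_integral_mono) (auto simp: indicator_def)
  also have "\<dots> = ennreal (2 * \<delta> powr (- a) / a)"
    using assms by (subst nn_integral_power_tail) (auto simp: numeral_mult_ennreal)
  finally have le: "(\<integral>\<^sup>+\<sigma>. ennreal (\<bar>\<sigma>\<bar> powr (- 1 - a) * indicator {\<delta><..} \<bar>\<sigma>\<bar>) \<partial>lborel) \<le> ennreal (2 * \<delta> powr (- a) / a)" .
  then show int: "integrable lborel (\<lambda>\<sigma>::real. \<bar>\<sigma>\<bar> powr (- 1 - a) * indicator {\<delta><..} \<bar>\<sigma>\<bar>)"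
    by (intro integrableI_bounded) (auto simp: abs_mult less_top[symmetric] top_unique)
  show "(LINT \<sigma>|lborel. \<bar>\<sigma>\<bar> powr (- 1 - a) * indicator {\<delta><..} \<bar>\<sigma>\<bar>) \<le> 2 * \<delta> powr (- a) / a"
    using le assms by (simp add: nn_integral_eq_integral[OF int])
qed

text \<open>The integrand of the operator with parameters \<open>s\<close> and \<open>m = n + 1\<close>, truncated at \<open>\<delta>\<close>, along a line. If
\<open>h = r\<^sup>2 - |x|\<^sup>2\<close>, then \<open>h + k t - q t\<^sup>2\<close> is \<open>r\<^sup>2 - |x + t \<omega>|\<^sup>2\<close> for \<open>k = - 2 x \<bullet> \<omega>\<close> and \<open>q = |\<omega>|\<^sup>2\<close>.\<close>

definition chord_integrand :: "real \<Rightarrow> real \<Rightarrow> real \<Rightarrow> real \<Rightarrow> real \<Rightarrow> real \<Rightarrow> real \<Rightarrow> real \<Rightarrow> real" where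
  "chord_integrand s \<beta> n h k q \<delta> t =
     signed_pow (h powr \<beta> - max 0 (h + k * t - q * t\<^sup>2) powr \<beta>) n * \<bar>t\<bar> powr (- 1 - s * (n + 1)) * indicator {\<delta><..} \<bar>t\<bar>"

lemma chord_integrand_measurable [measurable]: "chord_integrand s \<beta> n h k q \<delta> \<in> borel_measurable borel"
  unfolding chord_integrand_def[abs_def] by measurable

lemma integrable_chord_integrand:
  assumes "0 < s" "0 < \<beta>" "0 < n" "0 < q" "0 < \<delta>" "0 \<le> h"
  shows "integrable lborel (chord_integrand s \<beta> n h k q \<delta>)"
proof (rule Bochner_Integration.integrable_bound)
  define B where "B = h powr \<beta> + (h + k\<^sup>2 / (4 * q)) powr \<beta>"
  have sa: "0 < s * (n + 1)" using assms by simp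
  show "integrable lborel (\<lambda>t. B powr n * (\<bar>t\<bar> powr (- 1 - s * (n + 1)) * indicator {\<delta><..} \<bar>t\<bar>))"
    using integrable_kernel_tail_real(1)[OF sa assms(5)] by (rule integrable_mult_right)
  have "norm (chord_integrand s \<beta> n h k q \<delta> t) \<le> norm (B powr n * (\<bar>t\<bar> powr (- 1 - s * (n + 1)) * indicator {\<delta><..} \<bar>t\<bar>))" for t
  proof -
    have "k * t - q * t\<^sup>2 \<le> k\<^sup>2 / (4 * q)"
    proof -
      have "0 \<le> (k - 2 * q * t)\<^sup>2 / (4 * q)" using assms by simp
      also have "\<dots> = k\<^sup>2 / (4 * q) - (k * t - q * t\<^sup>2)" using assms by (simp add: power2_eq_square field_simps)
      finally show ?thesis by simp
    qed
    then have "max 0 (h + k * t - q * t\<^sup>2) powr \<beta> \<le> (h + k\<^sup>2 / (4 * q)) powr \<beta>"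
      using assms by (intro powr_mono2) auto
    then have "\<bar>h powr \<beta> - max 0 (h + k * t - q * t\<^sup>2) powr \<beta>\<bar> \<le> B"
      unfolding B_def using powr_ge_zero[of h \<beta>] powr_ge_zero[of "max 0 (h + k * t - q * t\<^sup>2)" \<beta>] by linarith
    then have "\<bar>h powr \<beta> - max 0 (h + k * t - q * t\<^sup>2) powr \<beta>\<bar> powr n \<le> B powr n"
      using assms by (intro powr_mono2) auto
    then show ?thesis
      unfolding chord_integrand_def by (auto simp: abs_mult abs_signed_pow mult.assoc intro!: mult_right_mono)
  qed
  then show "AE t in lborel. norm (chord_integrand s \<beta> n h k q \<delta> t) \<le> norm (B powr n * (\<bar>t\<bar> powr (- 1 - s * (n + 1)) * indicator {\<delta><..} \<bar>t\<bar>))"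
    by simp
qed simp

lemma chord_integrand_le_tail:
  assumes "0 < n" "0 \<le> h"
  shows "chord_integrand s \<beta> n h k q \<delta> t \<le> h powr (\<beta> * n) * (\<bar>t\<bar> powr (- 1 - s * (n + 1)) * indicator {\<delta><..} \<bar>t\<bar>)"
proof -
  have "signed_pow (h powr \<beta> - max 0 (h + k * t - q * t\<^sup>2) powr \<beta>) n \<le> signed_pow (h powr \<beta>) n"
    using assms by (intro signed_pow_mono) auto
  also have "\<dots> = h powr (\<beta> * n)" by (simp add: signed_pow_nonneg powr_powr)
  finally show ?thesis unfolding chord_integrand_def mult.assoc by (intro mult_right_mono) auto
qed

lemma LINT_chord_split:
  fixes f :: "real \<Rightarrow> real"
  assumes int: "integrable lborel f" and z: "\<And>t. \<bar>t\<bar> \<le> \<delta> \<Longrightarrow> f t = 0" and \<delta>: "0 < \<delta>"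
    and I: "((\<lambda>t. f (- t)) has_integral I) {\<delta>..}" and J: "(f has_integral J) {\<delta>..}"
  shows "(LINT t|lborel. f t) = I + J"
proof -
  have J': "((\<lambda>t. f t * indicator {\<delta>..} t) has_integral J) UNIV"
    using J by (subst (asm) has_integral_restrict_UNIV[symmetric]) (erule has_integral_eq[rotated], auto simp: indicator_def)
  have I': "((\<lambda>t. f (- t) * indicator {\<delta>..} t) has_integral I) UNIV"
    using I by (subst (asm) has_integral_restrict_UNIV[symmetric]) (erule has_integral_eq[rotated], auto simp: indicator_def)
  have int': "integrable lborel (\<lambda>t. f (- t))"
    using lborel_integrable_real_affine[OF int, of "- 1" 0] by simp
  have i1: "integrable lborel (\<lambda>t. f t * indicator {\<delta>..} t)"
    using integrable_mult_indicator[OF _ int, of "{\<delta>..}"] by (simp add: mult.commute)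
  have i2: "integrable lborel (\<lambda>t. f (- t) * indicator {\<delta>..} t)"
    using integrable_mult_indicator[OF _ int', of "{\<delta>..}"] by (simp add: mult.commute)
  have i3: "integrable lborel (\<lambda>t. f t * indicator {\<delta>..} (- t))"
    using lborel_integrable_real_affine[OF i2, of "- 1" 0] by simp
  have "f t = f t * indicator {\<delta>..} t + f t * indicator {\<delta>..} (- t)" for t
    using z[of t] \<delta> by (auto simp: indicator_def abs_if split: if_splits)
  then have "(LINT t|lborel. f t) = (LINT t|lborel. f t * indicator {\<delta>..} t + f t * indicator {\<delta>..} (- t))" by simp
  also have "\<dots> = (LINT t|lborel. f t * indicator {\<delta>..} t) + (LINT t|lborel. f t * indicator {\<delta>..} (- t))"
    by (rule Bochner_Integration.integral_add[OF i1 i3])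
  also have "(LINT t|lborel. f t * indicator {\<delta>..} (- t)) = (LINT t|lborel. f (- t) * indicator {\<delta>..} t)"
    using lborel_integral_real_affine[of "- 1" "\<lambda>t. f (- t) * indicator {\<delta>..} t" 0] by simp
  also have "\<dots> = I" using has_integral_unique[OF has_integral_integral_lborel[OF i2] I'] .
  also have "(LINT t|lborel. f t * indicator {\<delta>..} t) = J" using has_integral_unique[OF has_integral_integral_lborel[OF i1] J'] .
  finally show ?thesis by simp
qed

text \<open>Beyond the end \<open>r\<close> of the chord the barrier is \<open>0\<close> and the integrand is the kernel alone.\<close>

lemma has_integral_tail_glue:
  fixes f g :: "real \<Rightarrow> real"
  assumes d: "\<delta> \<le> r" and sa: "0 < a" and r: "0 < r"
    and g: "continuous_on {\<delta>..r} g" "\<And>t. \<delta> < t \<Longrightarrow> t \<le> r \<Longrightarrow> f t = g t"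
    and tail: "\<And>t. r < t \<Longrightarrow> f t = t powr (- 1 - a)"
  shows "(f has_integral integral {\<delta>..r} g + r powr (- a) / a) {\<delta>..}"
proof -
  have 1: "(f has_integral integral {\<delta>..r} g) {\<delta>..r}"
    using has_integral_spike_finite[of "{\<delta>}" "{\<delta>..r}" f g "integral {\<delta>..r} g"] g
      integrable_integral[OF integrable_continuous_real[OF g(1)]] by auto
  have "((\<lambda>t. t powr (- 1 - a)) has_integral r powr (- a) / a) {r..}"
    using has_integral_powr_to_inf[of "- 1 - a" r] sa r by simp
  then have 2: "(f has_integral r powr (- a) / a) {r..}"
    by (rule has_integral_spike_finite[rotated 2, of _ _ _ "{r}"]) (auto simp: tail)
  have "negligible ({\<delta>..r} \<inter> {r..})"
    by (rule negligible_subset[of "{r}"]) auto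
  moreover have "{\<delta>..r} \<union> {r..} = {\<delta>..}" using d by auto
  ultimately show ?thesis using has_integral_Un[OF 1 2] by simp
qed

text \<open>Only \<open>\<delta> < 1\<close> needs cancellation. For \<open>\<delta> \<ge> 1\<close> the tail of the kernel is already below the term in \<open>\<delta>\<close>.\<close>

lemma chord_unit:
  fixes \<beta> s n :: real
  assumes s: "0 < s" "s \<le> \<beta>" "\<beta> < 1" and n: "0 < n"
  obtains C where "0 < C" "\<And>\<epsilon> \<delta>. 0 < \<epsilon> \<Longrightarrow> \<epsilon> < 1 \<Longrightarrow> 0 < \<delta> \<Longrightarrow>
    (LINT t|lborel. chord_integrand s \<beta> n 1 (1 - \<epsilon>) \<epsilon> \<delta> t)
    \<le> C * (\<epsilon> powr (s * (n + 1) - \<beta> * n) * (1 - \<epsilon>) powr (- max 0 (1 - n)) + \<delta> powr ((n + 1) * (1 - s)))"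
proof -
  define a where "a = s * (n + 1)"
  have a: "0 < a" using s n by (simp add: a_def)
  obtain C1 where C1: "0 < C1" "\<And>\<epsilon> \<delta>. 0 < \<epsilon> \<Longrightarrow> \<epsilon> < 1 \<Longrightarrow> 0 < \<delta> \<Longrightarrow> \<delta> < 1 \<Longrightarrow>
    integral {\<delta>..1} (\<lambda>\<theta>. signed_pow (1 - ((1 - \<theta>) * (1 + \<epsilon> * \<theta>)) powr \<beta>) n * \<theta> powr (- 1 - s * (n + 1)))
    - integral {\<delta>..1 / \<epsilon>} (\<lambda>\<sigma>. signed_pow (((1 + \<sigma>) * (1 - \<epsilon> * \<sigma>)) powr \<beta> - 1) n * \<sigma> powr (- 1 - s * (n + 1)))
    + (1 + \<epsilon> powr (s * (n + 1))) / (s * (n + 1))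
    \<le> C1 * (\<epsilon> powr (s * (n + 1) - \<beta> * n) * (1 - \<epsilon>) powr (- max 0 (1 - n)) + \<delta> powr ((n + 1) * (1 - s)))"
    using chord_pair_integral[OF s n] by blast
  define C where "C = C1 + 2 / a"
  have "0 < C" using C1 a by (simp add: C_def add_pos_pos)
  moreover have "(LINT t|lborel. chord_integrand s \<beta> n 1 (1 - \<epsilon>) \<epsilon> \<delta> t)
    \<le> C * (\<epsilon> powr (s * (n + 1) - \<beta> * n) * (1 - \<epsilon>) powr (- max 0 (1 - n)) + \<delta> powr ((n + 1) * (1 - s)))"
    if \<epsilon>: "0 < \<epsilon>" "\<epsilon> < 1" and \<delta>: "0 < \<delta>" for \<epsilon> \<delta>
  proof -
    let ?f = "chord_integrand s \<beta> n 1 (1 - \<epsilon>) \<epsilon> \<delta>"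
    let ?R = "\<epsilon> powr (s * (n + 1) - \<beta> * n) * (1 - \<epsilon>) powr (- max 0 (1 - n)) + \<delta> powr ((n + 1) * (1 - s))"
    have R: "0 \<le> ?R" "\<delta> powr ((n + 1) * (1 - s)) \<le> ?R" by simp_all
    have int: "integrable lborel ?f" using s n \<epsilon> \<delta> by (intro integrable_chord_integrand) auto
    have N: "1 + (1 - \<epsilon>) * t - \<epsilon> * t\<^sup>2 = (1 + t) * (1 - \<epsilon> * t)" for t by (simp add: power2_eq_square algebra_simps)
    show ?thesis
    proof (cases "\<delta> < 1")
      case False
      have "(LINT t|lborel. ?f t) \<le> (LINT t|lborel. \<bar>t\<bar> powr (- 1 - a) * indicator {\<delta><..} \<bar>t\<bar>)"
        using chord_integrand_le_tail[of n 1 s \<beta> "1 - \<epsilon>" \<epsilon> \<delta>] n integrable_kernel_tail_real(1)[OF a \<delta>] int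
        by (intro integral_mono) (auto simp: a_def)
      also have "\<dots> \<le> 2 * \<delta> powr (- a) / a" by (rule integrable_kernel_tail_real(2)[OF a \<delta>])
      also have "\<dots> = 2 / a * \<delta> powr (- a)" by simp
      also have "\<dots> \<le> 2 / a * \<delta> powr ((n + 1) * (1 - s))"
      proof (intro mult_left_mono powr_mono)
        have "0 \<le> (n + 1) * (1 - s)" using n s by simp
        then show "- a \<le> (n + 1) * (1 - s)" using a by linarith
      qed (use False a in auto)
      also have "\<dots> \<le> 2 / a * ?R" using R a by (intro mult_left_mono) auto
      also have "\<dots> \<le> C * ?R" using R C1 by (intro mult_right_mono) (auto simp: C_def)
      finally show ?thesis .
    next
      case True
      let ?P = "\<lambda>\<theta>. signed_pow (1 - ((1 - \<theta>) * (1 + \<epsilon> * \<theta>)) powr \<beta>) n * \<theta> powr (- 1 - a)"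
      let ?Q = "\<lambda>\<sigma>. signed_pow (((1 + \<sigma>) * (1 - \<epsilon> * \<sigma>)) powr \<beta> - 1) n * \<sigma> powr (- 1 - a)"
      have contsp: "continuous_on S (\<lambda>x. signed_pow (f x) n)" if "continuous_on S f" for S :: "real set" and f
        using continuous_on_compose2[OF continuous_on_signed_pow[OF n] that] by simp
      have pos1: "0 \<le> (1 - t) * (1 + \<epsilon> * t)" if "\<delta> \<le> t" "t \<le> 1" for t
        using that \<delta> \<epsilon> by (intro mult_nonneg_nonneg) auto
      have pos2: "0 \<le> (1 + t) * (1 - \<epsilon> * t)" if "\<delta> \<le> t" "t \<le> 1 / \<epsilon>" for t
        using that \<delta> \<epsilon> by (intro mult_nonneg_nonneg) (auto simp: field_simps)
      have neg1: "(1 - t) * (1 + \<epsilon> * t) \<le> 0" if "1 < t" for t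
        using that \<epsilon> mult_pos_pos[of \<epsilon> t] by (intro mult_nonpos_nonneg) linarith+
      have neg2: "(1 + t) * (1 - \<epsilon> * t) \<le> 0" if "1 / \<epsilon> < t" for t
      proof (rule mult_nonneg_nonpos)
        have "0 < 1 / \<epsilon>" using \<epsilon> by simp
        then show "0 \<le> 1 + t" using that by linarith
        show "1 - \<epsilon> * t \<le> 0" using that \<epsilon> by (simp add: field_simps)
      qed
      have "1 < 1 / \<epsilon>" using \<epsilon> by simp
      have fm: "?f (- t) = signed_pow (1 - max 0 ((1 - t) * (1 + \<epsilon> * t)) powr \<beta>) n * t powr (- 1 - a)" if "\<delta> < t" for t
        using N[of "- t"] that \<delta> by (simp add: chord_integrand_def a_def)
      have fp: "?f t = signed_pow (1 - max 0 ((1 + t) * (1 - \<epsilon> * t)) powr \<beta>) n * t powr (- 1 - a)" if "\<delta> < t" for t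
        using N[of t] that \<delta> by (simp add: chord_integrand_def a_def)
      have I: "((\<lambda>t. ?f (- t)) has_integral integral {\<delta>..1} ?P + 1 powr (- a) / a) {\<delta>..}"
      proof (rule has_integral_tail_glue)
        show "continuous_on {\<delta>..1} ?P"
          using pos1 s \<delta> by (intro continuous_intros contsp continuous_on_powr') auto
        show "?f (- t) = ?P t" if "\<delta> < t" "t \<le> 1" for t using fm[of t] pos1[of t] that by simp
        show "?f (- t) = t powr (- 1 - a)" if "1 < t" for t
          using fm[of t] neg1[of t] that True by (simp add: max_def signed_pow_nonneg)
      qed (use True a in auto)
      have J: "(?f has_integral integral {\<delta>..1/\<epsilon>} (\<lambda>t. - ?Q t) + (1 / \<epsilon>) powr (- a) / a) {\<delta>..}"
      proof (rule has_integral_tail_glue)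
        show "continuous_on {\<delta>..1/\<epsilon>} (\<lambda>t. - ?Q t)"
          using pos2 s \<delta> by (intro continuous_intros contsp continuous_on_powr') auto
        show "?f t = - ?Q t" if "\<delta> < t" "t \<le> 1/\<epsilon>" for t
        proof -
          have "?f t = signed_pow (- (((1 + t) * (1 - \<epsilon> * t)) powr \<beta> - 1)) n * t powr (- 1 - a)"
            using fp[of t] pos2[of t] that by simp
          then show ?thesis unfolding signed_pow_minus by simp
        qed
        show "?f t = t powr (- 1 - a)" if "1/\<epsilon> < t" for t
          using fp[of t] neg2[of t] that True \<open>1 < 1/\<epsilon>\<close> by (simp add: max_def signed_pow_nonneg)
        show "\<delta> \<le> 1 / \<epsilon>" using True \<open>1 < 1/\<epsilon>\<close> by linarith
      qed (use True a \<epsilon> in auto)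
      have "(LINT t|lborel. ?f t) = (integral {\<delta>..1} ?P + 1 powr (- a) / a) + (integral {\<delta>..1/\<epsilon>} (\<lambda>t. - ?Q t) + (1 / \<epsilon>) powr (- a) / a)"
        by (rule LINT_chord_split[OF int _ \<delta> I J]) (auto simp: chord_integrand_def)
      also have "\<dots> = integral {\<delta>..1} ?P - integral {\<delta>..1/\<epsilon>} ?Q + (1 + \<epsilon> powr a) / a"
        using \<epsilon> by (simp add: powr_divide powr_minus add_divide_distrib)
      also have "\<dots> \<le> C1 * ?R" using C1(2)[OF \<epsilon> \<delta> True] by (simp only: a_def)
      also have "\<dots> \<le> C * ?R" using R a by (intro mult_right_mono) (auto simp: C_def)
      finally show ?thesis .
    qed
  qed
  ultimately show ?thesis using that by blast
qed

text \<open>The roots of \<open>h + k t - q t\<^sup>2\<close> are \<open>- a\<close> and \<open>b\<close>. Dilating by the distance \<open>a\<close> to the nearer end gives the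
normalised chord with \<open>\<epsilon> = a / b\<close>.\<close>

lemma chord_scale:
  fixes h k q s \<beta> n :: real
  assumes h: "0 < h" and k: "0 < k" and q: "0 < q" and n: "0 < n" and \<delta>: "0 < \<delta>"
  defines "b \<equiv> (k + sqrt (k\<^sup>2 + 4 * q * h)) / (2 * q)"
  defines "a \<equiv> h / (q * b)"
  shows "0 < a" "a < b" "q * a * b = h" "q * (b - a) = k" "b \<le> (k + sqrt (q * h)) / q"
    and "(LINT t|lborel. chord_integrand s \<beta> n h k q \<delta> t) =
      h powr (\<beta> * n) * a powr (- (s * (n + 1))) * (LINT t|lborel. chord_integrand s \<beta> n 1 (1 - a / b) (a / b) (\<delta> / a) t)"
proof -
  define D where "D = sqrt (k\<^sup>2 + 4 * q * h)"
  have D2: "D\<^sup>2 = k\<^sup>2 + 4 * q * h" using q h by (simp add: D_def)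
  have Dk: "k < D" unfolding D_def using k q h by (intro real_less_rsqrt) simp
  have b: "b = (k + D) / (2 * q)" by (simp add: b_def D_def)
  have b0: "0 < b" using k Dk q by (simp add: b)
  show a0: "0 < a" using h q b0 by (simp add: a_def)
  show qab: "q * a * b = h" using q b0 by (simp add: a_def)
  have "q * b\<^sup>2 - k * b = h"
  proof -
    have "q * b\<^sup>2 - k * b = ((k + D)\<^sup>2 - 2 * k * (k + D)) / (4 * q)" using q by (simp add: b power2_eq_square field_simps)
    also have "(k + D)\<^sup>2 - 2 * k * (k + D) = D\<^sup>2 - k\<^sup>2" by (simp add: power2_eq_square algebra_simps)
    also have "\<dots> / (4 * q) = h" using D2 q by simp
    finally show ?thesis .
  qed
  then have "(q * (b - a)) * b = k * b" using qab by (simp add: power2_eq_square algebra_simps)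
  then show qk: "q * (b - a) = k" using b0 by simp
  then show ab: "a < b" using k q by (smt (verit) mult_nonneg_nonpos)
  have "D \<le> k + 2 * sqrt (q * h)"
    unfolding D_def using k q h by (intro real_le_lsqrt) (auto simp: power2_sum power_mult_distrib)
  then have "(k + D) / (2 * q) \<le> 2 * (k + sqrt (q * h)) / (2 * q)" using q by (intro divide_right_mono) auto
  also have "\<dots> = (k + sqrt (q * h)) / q" using q by (simp add: field_simps)
  finally show "b \<le> (k + sqrt (q * h)) / q" by (simp only: b)
  have pt: "chord_integrand s \<beta> n h k q \<delta> (a * t) =
      h powr (\<beta> * n) * a powr (- 1 - s * (n + 1)) * chord_integrand s \<beta> n 1 (1 - a / b) (a / b) (\<delta> / a) t" for t
  proof -
    have "k * (a * t) = h * ((1 - a / b) * t)"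
      unfolding qk[symmetric] qab[symmetric] using b0 by (simp add: field_simps)
    moreover have "q * (a * t)\<^sup>2 = h * (a / b * t\<^sup>2)"
      unfolding qab[symmetric] using b0 by (simp add: power2_eq_square field_simps)
    ultimately have "h + k * (a * t) - q * (a * t)\<^sup>2 = h * (1 + (1 - a / b) * t - a / b * t\<^sup>2)"
      by (simp add: algebra_simps)
    then have "max 0 (h + k * (a * t) - q * (a * t)\<^sup>2) = h * max 0 (1 + (1 - a / b) * t - a / b * t\<^sup>2)"
      using h by (simp add: max_def zero_le_mult_iff)
    then have "h powr \<beta> - max 0 (h + k * (a * t) - q * (a * t)\<^sup>2) powr \<beta>
       = h powr \<beta> * (1 powr \<beta> - max 0 (1 + (1 - a / b) * t - a / b * t\<^sup>2) powr \<beta>)"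
      using h by (simp add: powr_mult right_diff_distrib)
    moreover have "signed_pow (h powr \<beta> * X) n = h powr (\<beta> * n) * signed_pow X n" for X
      by (simp add: signed_pow_mult powr_powr)
    moreover have "\<bar>a * t\<bar> powr (- 1 - s * (n + 1)) = a powr (- 1 - s * (n + 1)) * \<bar>t\<bar> powr (- 1 - s * (n + 1))"
      using a0 by (simp add: abs_mult powr_mult)
    moreover have "(indicator {\<delta><..} \<bar>a * t\<bar> :: real) = indicator {\<delta> / a<..} \<bar>t\<bar>"
      using a0 by (auto simp: indicator_def abs_mult field_simps)
    ultimately show ?thesis unfolding chord_integrand_def by simp
  qed
  have "(LINT t|lborel. chord_integrand s \<beta> n h k q \<delta> t) = a * (LINT t|lborel. chord_integrand s \<beta> n h k q \<delta> (a * t))"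
    using lborel_integral_real_affine[of a "chord_integrand s \<beta> n h k q \<delta>" 0] a0 by simp
  also have "\<dots> = h powr (\<beta> * n) * (a * a powr (- 1 - s * (n + 1))) * (LINT t|lborel. chord_integrand s \<beta> n 1 (1 - a / b) (a / b) (\<delta> / a) t)"
    unfolding pt by simp
  also have "a * a powr (- 1 - s * (n + 1)) = a powr (- (s * (n + 1)))"
    using powr_mult_base[of a "- 1 - s * (n + 1)"] a0 by simp
  finally show "(LINT t|lborel. chord_integrand s \<beta> n h k q \<delta> t) =
      h powr (\<beta> * n) * a powr (- (s * (n + 1))) * (LINT t|lborel. chord_integrand s \<beta> n 1 (1 - a / b) (a / b) (\<delta> / a) t)" .
qed

text \<open>The bound is uniform as \<open>h\<close> tends to \<open>0\<close>, apart from the truncation error. Indeed \<open>h = q a b\<close> and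
\<open>\<epsilon> = a / b\<close> make the powers of \<open>a\<close> cancel in \<open>h powr (\<beta> n) * a powr - (s m) * \<epsilon> powr (s m - \<beta> n)\<close>, and
\<open>1 - \<epsilon> = k / (q b)\<close>. What remains is a nonnegative power \<open>e\<close> of the bounded length \<open>b\<close>.\<close>

lemma chord_bound:
  fixes s \<beta> n H K :: real
  assumes s: "0 < s" "s \<le> \<beta>" "\<beta> < 1" and n: "0 < n" and HK: "0 < H" "0 < K"
  obtains C where "0 < C" "\<And>h k q \<delta>. 0 < h \<Longrightarrow> h \<le> H \<Longrightarrow> k \<noteq> 0 \<Longrightarrow> \<bar>k\<bar> \<le> K \<Longrightarrow> 1 \<le> q \<Longrightarrow> q \<le> 4 \<Longrightarrow> 0 < \<delta> \<Longrightarrow>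
    (LINT t|lborel. chord_integrand s \<beta> n h k q \<delta> t)
    \<le> C * (\<bar>k\<bar> powr (- max 0 (1 - n)) + h powr (\<beta> * n - (n + 1)) * \<delta> powr ((n + 1) * (1 - s)))"
proof -
  define m where "m = n + 1"
  define \<mu> where "\<mu> = max 0 (1 - n)"
  define R where "R = K + 2 * sqrt H"
  define e where "e = 2 * \<beta> * n - s * m + \<mu>"
  obtain C1 where C1: "0 < C1" "\<And>\<epsilon> \<delta>. 0 < \<epsilon> \<Longrightarrow> \<epsilon> < 1 \<Longrightarrow> 0 < \<delta> \<Longrightarrow>
    (LINT t|lborel. chord_integrand s \<beta> n 1 (1 - \<epsilon>) \<epsilon> \<delta> t)
    \<le> C1 * (\<epsilon> powr (s * (n + 1) - \<beta> * n) * (1 - \<epsilon>) powr (- max 0 (1 - n)) + \<delta> powr ((n + 1) * (1 - s)))"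
    using chord_unit[OF s n] by blast
  have R: "0 < R" using HK by (simp add: R_def add_pos_nonneg)
  have e: "0 \<le> e"
  proof -
    have "s * n \<le> \<beta> * n" using s n by simp
    then have "s * (n - 1) + \<mu> \<le> e" by (simp add: e_def m_def algebra_simps)
    moreover have "0 \<le> s * (n - 1) + \<mu>"
    proof (cases "1 \<le> n")
      case True then show ?thesis using s by (simp add: \<mu>_def)
    next
      case False
      have "s * (1 - n) \<le> 1 * (1 - n)" using False s by (intro mult_right_mono) auto
      then show ?thesis using False by (simp add: \<mu>_def algebra_simps)
    qed
    ultimately show ?thesis by linarith
  qed
  have \<mu>: "0 \<le> \<mu>" by (simp add: \<mu>_def)
  define A where "A = 4 powr (\<beta> * n + \<mu>) * R powr e"
  define B where "B = (4 * R) powr m"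
  define C where "C = C1 * (A + B)"
  have AB: "0 < A" "0 < B" using R by (simp_all add: A_def B_def)
  then have "0 < C" using C1 by (simp add: C_def)
  moreover
  have pos: "(LINT t|lborel. chord_integrand s \<beta> n h k q \<delta> t)
    \<le> C * (k powr (- \<mu>) + h powr (\<beta> * n - m) * \<delta> powr (m * (1 - s)))"
    if h: "0 < h" "h \<le> H" and k: "0 < k" "k \<le> K" and q: "1 \<le> q" "q \<le> 4" and \<delta>: "0 < \<delta>" for h k q \<delta>
  proof -
    have q0: "0 < q" using q by simp
    define b where "b = (k + sqrt (k\<^sup>2 + 4 * q * h)) / (2 * q)"
    define a where "a = h / (q * b)"
    note sc = chord_scale(1-5)[OF h(1) k(1) q0 n \<delta>, folded b_def, folded a_def]
      chord_scale(6)[OF h(1) k(1) q0 n \<delta>, of s \<beta>, folded b_def, folded a_def]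
    note a = sc(1) and ab = sc(2) and qab = sc(3) and qk = sc(4)
    have b: "0 < b" using a ab by linarith
    have bR: "b \<le> R"
    proof -
      have "sqrt (q * h) \<le> sqrt (4 * H)" using q h by (intro real_sqrt_le_mono mult_mono) auto
      then have "(k + sqrt (q * h)) / q \<le> (K + 2 * sqrt H) / q" using k q by (intro divide_right_mono add_mono) (auto simp: real_sqrt_mult)
      also have "\<dots> \<le> R" using q R unfolding R_def[symmetric] by (simp add: field_simps mult_le_cancel_left1)
      finally show ?thesis using sc(5) by linarith
    qed
    define \<epsilon> where "\<epsilon> = a / b"
    have \<epsilon>: "0 < \<epsilon>" "\<epsilon> < 1" using a ab b by (simp_all add: \<epsilon>_def)
    have c: "1 - \<epsilon> = k / (q * b)" unfolding qk[symmetric] using b q by (simp add: \<epsilon>_def field_simps)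
    have "(LINT t|lborel. chord_integrand s \<beta> n h k q \<delta> t) \<le>
       h powr (\<beta> * n) * a powr (- (s * m)) * (C1 * (\<epsilon> powr (s * m - \<beta> * n) * (1 - \<epsilon>) powr (- \<mu>) + (\<delta> / a) powr (m * (1 - s))))"
      using C1(2)[OF \<epsilon>, of "\<delta> / a"] \<delta> a unfolding sc(6) \<epsilon>_def m_def \<mu>_def by (intro mult_left_mono) auto
    also have "\<dots> = C1 * (h powr (\<beta> * n) * a powr (- (s * m)) * \<epsilon> powr (s * m - \<beta> * n) * (1 - \<epsilon>) powr (- \<mu>)
       + h powr (\<beta> * n) * a powr (- (s * m)) * (\<delta> / a) powr (m * (1 - s)))" by (simp add: algebra_simps)
    also have "h powr (\<beta> * n) * a powr (- (s * m)) * \<epsilon> powr (s * m - \<beta> * n) * (1 - \<epsilon>) powr (- \<mu>)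
       = q powr (\<beta> * n + \<mu>) * b powr e * k powr (- \<mu>)"
    proof -
      have "h powr (\<beta> * n) = q powr (\<beta> * n) * a powr (\<beta> * n) * b powr (\<beta> * n)"
        unfolding qab[symmetric] using q a b by (simp add: powr_mult)
      moreover have "\<epsilon> powr (s * m - \<beta> * n) = a powr (s * m - \<beta> * n) * b powr (\<beta> * n - s * m)"
        using a b powr_minus[of b "s * m - \<beta> * n"] by (simp add: \<epsilon>_def powr_divide) (simp add: divide_inverse)
      moreover have "(1 - \<epsilon>) powr (- \<mu>) = k powr (- \<mu>) * (q powr \<mu> * b powr \<mu>)"
        using k q b unfolding c by (simp add: powr_divide powr_mult powr_minus_divide)
      ultimately have "h powr (\<beta> * n) * a powr (- (s * m)) * \<epsilon> powr (s * m - \<beta> * n) * (1 - \<epsilon>) powr (- \<mu>)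
        = (q powr (\<beta> * n) * q powr \<mu>) * (a powr (\<beta> * n) * a powr (- (s * m)) * a powr (s * m - \<beta> * n))
          * (b powr (\<beta> * n) * b powr (\<beta> * n - s * m) * b powr \<mu>) * k powr (- \<mu>)" by (simp only: mult_ac)
      also have "a powr (\<beta> * n) * a powr (- (s * m)) * a powr (s * m - \<beta> * n) = 1"
        unfolding powr_add[symmetric] using a by simp
      also have "b powr (\<beta> * n) * b powr (\<beta> * n - s * m) * b powr \<mu> = b powr e"
        unfolding powr_add[symmetric] by (simp add: e_def algebra_simps)
      finally show ?thesis by (simp add: powr_add)
    qed
    also have "h powr (\<beta> * n) * a powr (- (s * m)) * (\<delta> / a) powr (m * (1 - s)) = h powr (\<beta> * n) * a powr (- m) * \<delta> powr (m * (1 - s))"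
    proof -
      have "(\<delta> / a) powr (m * (1 - s)) = \<delta> powr (m * (1 - s)) * a powr (- (m * (1 - s)))"
        using \<delta> a by (simp add: powr_divide powr_minus_divide)
      moreover have "a powr (- (s * m)) * a powr (- (m * (1 - s))) = a powr (- m)"
        unfolding powr_add[symmetric] by (simp add: algebra_simps)
      ultimately show ?thesis by (metis mult.assoc mult.commute)
    qed
    also have "q powr (\<beta> * n + \<mu>) * b powr e * k powr (- \<mu>) \<le> A * k powr (- \<mu>)"
      unfolding A_def using q b bR e s n \<mu> by (intro mult_right_mono mult_mono powr_mono2) auto
    also have "h powr (\<beta> * n) * a powr (- m) * \<delta> powr (m * (1 - s)) \<le> B * (h powr (\<beta> * n - m) * \<delta> powr (m * (1 - s)))"
    proof -
      have "q * b \<le> 4 * R" using q b bR by (intro mult_mono) auto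
      then have "h / (4 * R) \<le> a" unfolding a_def using h q b R by (intro divide_left_mono) auto
      then have "a powr (- m) \<le> (h / (4 * R)) powr (- m)" using h R n by (intro powr_mono2') (auto simp: m_def)
      also have "\<dots> = B * h powr (- m)" using h R by (simp add: B_def powr_divide powr_minus_divide)
      finally have "h powr (\<beta> * n) * a powr (- m) \<le> h powr (\<beta> * n) * (B * h powr (- m))" by (intro mult_left_mono) auto
      also have "\<dots> = B * (h powr (\<beta> * n) * h powr (- m))" by simp
      also have "h powr (\<beta> * n) * h powr (- m) = h powr (\<beta> * n - m)" unfolding powr_add[symmetric] by simp
      finally show ?thesis unfolding mult.assoc[symmetric] by (intro mult_right_mono) auto
    qed
    also have "C1 * (A * k powr (- \<mu>) + B * (h powr (\<beta> * n - m) * \<delta> powr (m * (1 - s)))) \<le>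
      C1 * ((A + B) * k powr (- \<mu>) + (A + B) * (h powr (\<beta> * n - m) * \<delta> powr (m * (1 - s))))"
      using C1 AB by (intro mult_left_mono add_mono mult_right_mono) auto
    also have "\<dots> = C * (k powr (- \<mu>) + h powr (\<beta> * n - m) * \<delta> powr (m * (1 - s)))" by (simp add: C_def algebra_simps)
    finally show ?thesis using C1 by (simp add: mult_left_mono)
  qed
  have "(LINT t|lborel. chord_integrand s \<beta> n h k q \<delta> t)
    \<le> C * (\<bar>k\<bar> powr (- max 0 (1 - n)) + h powr (\<beta> * n - (n + 1)) * \<delta> powr ((n + 1) * (1 - s)))"
    if h: "0 < h" "h \<le> H" and k: "k \<noteq> 0" "\<bar>k\<bar> \<le> K" and q: "1 \<le> q" "q \<le> 4" and \<delta>: "0 < \<delta>" for h k q \<delta>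
  proof -
    have "(LINT t|lborel. chord_integrand s \<beta> n h k q \<delta> t) = (LINT t|lborel. chord_integrand s \<beta> n h \<bar>k\<bar> q \<delta> t)"
    proof (cases "0 < k")
      case False
      have "chord_integrand s \<beta> n h k q \<delta> (- t) = chord_integrand s \<beta> n h (- k) q \<delta> t" for t
        by (simp add: chord_integrand_def)
      then show ?thesis using False
        lborel_integral_real_affine[of "- 1" "chord_integrand s \<beta> n h k q \<delta>" 0] by (simp add: abs_if)
    qed simp
    then show ?thesis using pos[OF h _ k(2) q \<delta>] k by (simp add: \<mu>_def m_def)
  qed
  ultimately show ?thesis using that by blast
qed


section \<open>The operator on the barrier of a ball\<close>

lemma integrable_kernel_tail:
  fixes a \<delta> :: real
  assumes "0 < a" "0 < \<delta>"
  shows "integrable lborel (\<lambda>x::'a::euclidean_space. indicator {\<delta><..} (norm x) / norm x powr (real DIM('a) + a))"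
  using nn_integral_kernel_tail_finite[OF assms, where 'a='a]
  by (intro integrableI_bounded) (auto simp: indicator_def)

text \<open>An upper bound for an integral, as a relation between the integrals of the positive and of the negative
part. In this form the chord estimates can be integrated over directions by Tonelli's theorem; the next
lemma converts back.\<close>

lemma nn_integral_pos_le_neg:
  fixes f :: "'b \<Rightarrow> real"
  assumes "integrable M f" "(LINT x|M. f x) \<le> c" "0 \<le> c"
  shows "(\<integral>\<^sup>+x. ennreal (f x) \<partial>M) \<le> (\<integral>\<^sup>+x. ennreal (- f x) \<partial>M) + ennreal c"
proof -
  have fin: "(\<integral>\<^sup>+x. ennreal (f x) \<partial>M) < \<infinity>" "(\<integral>\<^sup>+x. ennreal (- f x) \<partial>M) < \<infinity>"
    using assms(1) unfolding real_integrable_def by (auto simp: less_top)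
  then obtain P Q where P: "(\<integral>\<^sup>+x. ennreal (f x) \<partial>M) = ennreal P" "0 \<le> P" and Q: "(\<integral>\<^sup>+x. ennreal (- f x) \<partial>M) = ennreal Q" "0 \<le> Q"
    by (metis ennreal_cases infinity_ennreal_def order_less_irrefl)
  have "(LINT x|M. f x) = P - Q" using real_lebesgue_integral_def[OF assms(1)] P Q by simp
  then have "P \<le> Q + c" using assms by simp
  then show ?thesis using P Q assms(3) by (simp flip: ennreal_plus add: ennreal_leI)
qed

lemma integral_le_of_nn_integral:
  fixes f :: "'b \<Rightarrow> real"
  assumes "integrable M f" "(\<integral>\<^sup>+x. ennreal (f x) \<partial>M) \<le> (\<integral>\<^sup>+x. ennreal (- f x) \<partial>M) + ennreal c" "0 \<le> c"
  shows "(LINT x|M. f x) \<le> c"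
proof -
  have fin: "(\<integral>\<^sup>+x. ennreal (f x) \<partial>M) < \<infinity>" "(\<integral>\<^sup>+x. ennreal (- f x) \<partial>M) < \<infinity>"
    using assms(1) unfolding real_integrable_def by (auto simp: less_top)
  then obtain P Q where P: "(\<integral>\<^sup>+x. ennreal (f x) \<partial>M) = ennreal P" "0 \<le> P" and Q: "(\<integral>\<^sup>+x. ennreal (- f x) \<partial>M) = ennreal Q" "0 \<le> Q"
    by (metis ennreal_cases infinity_ennreal_def order_less_irrefl)
  have "ennreal P \<le> ennreal (Q + c)" using assms P Q by simp
  then have "P \<le> Q + c" using Q assms(3) by (subst (asm) ennreal_le_iff) auto
  then show ?thesis using real_lebesgue_integral_def[OF assms(1)] P Q by simp
qed

definition ball_profile :: "real \<Rightarrow> real \<Rightarrow> 'a::euclidean_space \<Rightarrow> real" where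
  "ball_profile r \<beta> x = max 0 (r\<^sup>2 - (norm x)\<^sup>2) powr \<beta>"

lemma continuous_ball_profile: "0 < \<beta> \<Longrightarrow> continuous_on UNIV (ball_profile r \<beta>)"
  unfolding ball_profile_def[abs_def] by (intro continuous_intros continuous_on_powr') auto

lemma ball_profile_measurable [measurable]: "ball_profile r \<beta> \<in> borel_measurable borel"
  unfolding ball_profile_def[abs_def] by measurable

lemma ball_profile_nonneg: "0 \<le> ball_profile r \<beta> x" by (simp add: ball_profile_def)

lemma ball_profile_le: "0 < \<beta> \<Longrightarrow> 0 \<le> r \<Longrightarrow> ball_profile r \<beta> x \<le> (r\<^sup>2) powr \<beta>"
  unfolding ball_profile_def by (intro powr_mono2) auto

definition trunc_kernel :: "real \<Rightarrow> real \<Rightarrow> 'a::euclidean_space \<Rightarrow> real" where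
  "trunc_kernel a \<delta> z = indicator {\<delta><..} (norm z) / norm z powr (real DIM('a) + a)"

lemma trunc_kernel_measurable [measurable]: "trunc_kernel a \<delta> \<in> borel_measurable borel"
  unfolding trunc_kernel_def[abs_def] by measurable

lemma trunc_kernel_nonneg: "0 \<le> trunc_kernel a \<delta> z" by (simp add: trunc_kernel_def)

lemma trunc_kernel_minus: "trunc_kernel a \<delta> (- z) = trunc_kernel a \<delta> z" by (simp add: trunc_kernel_def)

lemma integrable_trunc_kernel:
  "0 < a \<Longrightarrow> 0 < \<delta> \<Longrightarrow> integrable lborel (trunc_kernel a \<delta> :: 'a::euclidean_space \<Rightarrow> real)"
  unfolding trunc_kernel_def[abs_def] by (rule integrable_kernel_tail)

lemma integrable_bounded_times_kernel:
  fixes f :: "'a::euclidean_space \<Rightarrow> real"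
  assumes [measurable]: "f \<in> borel_measurable borel" and B: "\<And>z. \<bar>f z\<bar> \<le> B" and "0 < a" "0 < \<delta>"
  shows "integrable lborel (\<lambda>z. f z * trunc_kernel a \<delta> z)"
proof (rule Bochner_Integration.integrable_bound)
  show "integrable lborel (\<lambda>z::'a. B * trunc_kernel a \<delta> z)"
    using integrable_trunc_kernel[OF assms(3,4)] by (rule integrable_mult_right)
  have "norm (f z * trunc_kernel a \<delta> z) \<le> norm (B * trunc_kernel a \<delta> z)" for z
    using mult_right_mono[OF order_trans[OF B[of z] abs_ge_self[of B]] trunc_kernel_nonneg[of a \<delta> z]] trunc_kernel_nonneg[of a \<delta> z]
    by (simp add: abs_mult)
  then show "AE z in lborel. norm (f z * trunc_kernel a \<delta> z) \<le> norm (B * trunc_kernel a \<delta> z)" by simp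
qed measurable

text \<open>Averages \<open>chord_bound\<close> over the directions \<open>\<omega>\<close>. The point stays away from the centre, where every chord is
bisected; for \<open>|x| \<ge> r / 2\<close> the loss \<open>|x \<bullet> \<omega>| powr - \<mu>\<close> from
nearly bisected chords is integrable, uniformly in \<open>x\<close>, because \<open>\<mu> < 1\<close>.\<close>

lemma ball_profile_operator_bound:
  fixes s \<beta> n r :: real
  assumes s: "0 < s" "s \<le> \<beta>" "\<beta> < 1" and n: "0 < n" and r: "0 < r"
  obtains C where "0 < C" "\<And>(x::'a::euclidean_space) \<delta>. r / 2 \<le> norm x \<Longrightarrow> norm x < r \<Longrightarrow> 0 < \<delta> \<Longrightarrow>
    (LINT z|lborel. signed_pow (ball_profile r \<beta> x - ball_profile r \<beta> (x + z)) n * trunc_kernel (s * (n + 1)) \<delta> z)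
    \<le> C * (1 + (r\<^sup>2 - (norm x)\<^sup>2) powr (\<beta> * n - (n + 1)) * \<delta> powr ((n + 1) * (1 - s)))"
proof -
  let ?N = "real DIM('a)"
  define a where "a = s * (n + 1)"
  define \<mu> where "\<mu> = max 0 (1 - n)"
  define \<alpha> where "\<alpha> = (n + 1) * (1 - s)"
  have a: "0 < a" using s n by (simp add: a_def)
  have \<mu>: "0 \<le> \<mu>" "\<mu> < 1" using n by (auto simp: \<mu>_def)
  have \<alpha>: "0 < \<alpha>" using s n by (simp add: \<alpha>_def)
  obtain C1 where C1: "0 < C1" "\<And>h k q \<delta>. 0 < h \<Longrightarrow> h \<le> r\<^sup>2 \<Longrightarrow> k \<noteq> 0 \<Longrightarrow> \<bar>k\<bar> \<le> 4 * r \<Longrightarrow> 1 \<le> q \<Longrightarrow> q \<le> 4 \<Longrightarrow> 0 < \<delta> \<Longrightarrow>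
    (LINT t|lborel. chord_integrand s \<beta> n h k q \<delta> t) \<le> C1 * (\<bar>k\<bar> powr (- \<mu>) + h powr (\<beta> * n - (n + 1)) * \<delta> powr \<alpha>)"
    using chord_bound[OF s n, of "r\<^sup>2" "4 * r"] r unfolding \<mu>_def \<alpha>_def by (metis mult_pos_pos zero_less_numeral zero_less_power)
  obtain B where B: "0 \<le> B" "\<And>e::'a. norm e = 1 \<Longrightarrow>
    (\<integral>\<^sup>+\<omega>. ennreal (\<bar>\<omega> \<bullet> e\<bar> powr (- \<mu>)) * indicator {..2} (norm \<omega>) \<partial>lborel) \<le> ennreal B"
    using nn_integral_hyperplane_singularity[OF \<mu>] by blast
  define V where "V = enn2real (\<integral>\<^sup>+(\<omega>::'a). indicator {1..2} (norm \<omega>) \<partial>lborel)"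
  have V: "(\<integral>\<^sup>+(\<omega>::'a). indicator {1..2} (norm \<omega>) \<partial>lborel) = ennreal V" "0 \<le> V"
    using shell_finite[where 'a='a] by (auto simp: V_def less_top)
  define C where "C = C1 * (r powr (- \<mu>) * B + V + 1) / (2 * ln 2)"
  have "0 < C" using C1 B V by (simp add: C_def add_nonneg_pos)
  moreover have "(LINT z|lborel. signed_pow (ball_profile r \<beta> x - ball_profile r \<beta> (x + z)) n * trunc_kernel a \<delta> z)
    \<le> C * (1 + (r\<^sup>2 - (norm x)\<^sup>2) powr (\<beta> * n - (n + 1)) * \<delta> powr \<alpha>)"
    if x: "r / 2 \<le> norm x" "norm x < r" and \<delta>: "0 < \<delta>" for x :: 'a and \<delta>
  proof -
    define h where "h = r\<^sup>2 - (norm x)\<^sup>2"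
    have h: "0 < h" "h \<le> r\<^sup>2" using x by (simp_all add: h_def power_strict_mono)
    define E where "E = h powr (\<beta> * n - (n + 1)) * \<delta> powr \<alpha>"
    have E: "0 \<le> E" by (simp add: E_def)
    define \<rho> where "\<rho> = (\<lambda>z::'a. h - 2 * (x \<bullet> z) - (norm z)\<^sup>2)"
    have nxz: "(norm (x + z))\<^sup>2 = (norm x)\<^sup>2 + 2 * (x \<bullet> z) + (norm z)\<^sup>2" for z
      by (simp add: power2_norm_eq_inner inner_add_left inner_add_right inner_commute[of z x])
    have rho: "ball_profile r \<beta> (x + z) = max 0 (\<rho> z) powr \<beta>" "ball_profile r \<beta> x = h powr \<beta>" for z
      using h unfolding ball_profile_def \<rho>_def nxz h_def by (simp_all add: diff_diff_eq)
    define F where "F = (\<lambda>z. signed_pow (ball_profile r \<beta> x - ball_profile r \<beta> (x + z)) n * trunc_kernel a \<delta> z)"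
    have Fm [measurable]: "F \<in> borel_measurable borel" unfolding F_def by measurable
    have Fint: "integrable lborel F"
      unfolding F_def
    proof (rule integrable_bounded_times_kernel[OF _ _ a \<delta>])
      show "\<bar>signed_pow (ball_profile r \<beta> x - ball_profile r \<beta> (x + z)) n\<bar> \<le> ((r\<^sup>2) powr \<beta>) powr n" for z
        unfolding abs_signed_pow using ball_profile_le[of \<beta> r x] ball_profile_le[of \<beta> r "x + z"]
          ball_profile_nonneg[of r \<beta> x] ball_profile_nonneg[of r \<beta> "x + z"] s r n
        by (intro powr_mono2) auto
    qed measurable
    \<comment> \<open>On the ray through \<open>\<omega>\<close> the truncated kernel in dimension \<open>N\<close> becomes the one-dimensional one.\<close>
    have ray: "\<bar>l\<bar> powr (?N - 1) * F (l *\<^sub>R \<omega>) =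
        norm \<omega> powr (- (?N + a)) * chord_integrand s \<beta> n h (- 2 * (x \<bullet> \<omega>)) ((norm \<omega>)\<^sup>2) (\<delta> / norm \<omega>) l"
      if \<omega>: "1 \<le> norm \<omega>" and "l \<noteq> 0" for \<omega> l
    proof -
      have w0: "0 < norm \<omega>" using \<omega> by linarith
      have f1: "\<rho> (l *\<^sub>R \<omega>) = h + - 2 * (x \<bullet> \<omega>) * l - (norm \<omega>)\<^sup>2 * l\<^sup>2" by (simp add: \<rho>_def power_mult_distrib)
      have f2: "(indicator {\<delta><..} (norm (l *\<^sub>R \<omega>)) :: real) = indicator {\<delta> / norm \<omega><..} \<bar>l\<bar>"
        using w0 by (auto simp: indicator_def field_simps)
      have f3: "\<bar>l\<bar> powr (?N - 1) / norm (l *\<^sub>R \<omega>) powr (?N + a) = norm \<omega> powr (- (?N + a)) * \<bar>l\<bar> powr (- 1 - a)"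
      proof -
        have "\<bar>l\<bar> powr (?N - 1) / norm (l *\<^sub>R \<omega>) powr (?N + a) = (\<bar>l\<bar> powr (?N - 1) / \<bar>l\<bar> powr (?N + a)) * (1 / norm \<omega> powr (?N + a))"
          by (simp add: powr_mult)
        also have "\<bar>l\<bar> powr (?N - 1) / \<bar>l\<bar> powr (?N + a) = \<bar>l\<bar> powr (- 1 - a)" by (simp flip: powr_diff)
        finally show ?thesis unfolding powr_minus_divide[of "norm \<omega>"] by (simp only: mult.commute)
      qed
      have "\<bar>l\<bar> powr (?N - 1) * F (l *\<^sub>R \<omega>) = (\<bar>l\<bar> powr (?N - 1) / norm (l *\<^sub>R \<omega>) powr (?N + a)) *
        (signed_pow (h powr \<beta> - max 0 (\<rho> (l *\<^sub>R \<omega>)) powr \<beta>) n * indicator {\<delta><..} (norm (l *\<^sub>R \<omega>)))"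
        unfolding F_def rho trunc_kernel_def by simp
      then show ?thesis unfolding f1 f2 f3 chord_integrand_def a_def[symmetric] by (simp only: mult_ac)
    qed
    define w where "w = (\<lambda>\<omega>::'a. norm \<omega> powr (- (?N + a)))"
    have w: "0 \<le> w \<omega>" "1 \<le> norm \<omega> \<Longrightarrow> w \<omega> \<le> 1" for \<omega>
      using powr_mono2'[of "- (?N + a)" 1 "norm \<omega>"] a by (simp_all add: w_def)
    have wm [measurable]: "w \<in> borel_measurable borel" unfolding w_def by measurable
    define ch where "ch = (\<lambda>\<omega>::'a. chord_integrand s \<beta> n h (- 2 * (x \<bullet> \<omega>)) ((norm \<omega>)\<^sup>2) (\<delta> / norm \<omega>))"
    have polar: "ennreal (2 * ln 2) * (\<integral>\<^sup>+z. ennreal (c * F z) \<partial>lborel) =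
      (\<integral>\<^sup>+\<omega>. indicator {1..2} (norm \<omega>) * (ennreal (w \<omega>) * (\<integral>\<^sup>+l. ennreal (c * ch \<omega> l) \<partial>lborel)) \<partial>lborel)" for c :: real
    proof -
      have "ennreal (2 * ln 2) * (\<integral>\<^sup>+z. ennreal (c * F z) \<partial>lborel) =
        (\<integral>\<^sup>+\<omega>. indicator {1..2} (norm \<omega>) * (\<integral>\<^sup>+l. ennreal (\<bar>l\<bar> powr (?N - 1)) * ennreal (c * F (l *\<^sub>R \<omega>)) \<partial>lborel) \<partial>lborel)"
        by (rule nn_integral_polar) simp
      also have "\<dots> = (\<integral>\<^sup>+\<omega>. indicator {1..2} (norm \<omega>) * (ennreal (w \<omega>) * (\<integral>\<^sup>+l. ennreal (c * ch \<omega> l) \<partial>lborel)) \<partial>lborel)"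
      proof (rule nn_integral_cong)
        fix \<omega> :: 'a
        show "indicator {1..2} (norm \<omega>) * (\<integral>\<^sup>+l. ennreal (\<bar>l\<bar> powr (?N - 1)) * ennreal (c * F (l *\<^sub>R \<omega>)) \<partial>lborel)
          = indicator {1..2} (norm \<omega>) * (ennreal (w \<omega>) * (\<integral>\<^sup>+l. ennreal (c * ch \<omega> l) \<partial>lborel))"
        proof (cases "norm \<omega> \<in> {1..2}")
          case True
          have "(\<integral>\<^sup>+l. ennreal (\<bar>l\<bar> powr (?N - 1)) * ennreal (c * F (l *\<^sub>R \<omega>)) \<partial>lborel) = (\<integral>\<^sup>+l. ennreal (w \<omega>) * ennreal (c * ch \<omega> l) \<partial>lborel)"
          proof (rule nn_integral_cong_AE)
            have "AE l in lborel. l \<noteq> (0::real)" by (rule AE_lborel_singleton)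
            then show "AE l in lborel. ennreal (\<bar>l\<bar> powr (?N - 1)) * ennreal (c * F (l *\<^sub>R \<omega>)) = ennreal (w \<omega>) * ennreal (c * ch \<omega> l)"
            proof eventually_elim
              case (elim l)
              have "\<bar>l\<bar> powr (?N - 1) * (c * F (l *\<^sub>R \<omega>)) = w \<omega> * (c * ch \<omega> l)"
                using ray[of \<omega> l] True elim by (simp add: w_def ch_def mult.left_commute)
              then show ?case using w(1)[of \<omega>] by (metis ennreal_mult' powr_ge_zero)
            qed
          qed
          also have "\<dots> = ennreal (w \<omega>) * (\<integral>\<^sup>+l. ennreal (c * ch \<omega> l) \<partial>lborel)"
            by (intro nn_integral_cmult) (simp add: ch_def)
          finally show ?thesis by simp
        qed simp
      qed
      finally show ?thesis .
    qed
    have ch_eq: "ch \<omega> l = (signed_pow (h powr \<beta> - max 0 (h + - 2 * (x \<bullet> \<omega>) * l - (norm \<omega>)\<^sup>2 * l\<^sup>2) powr \<beta>) n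
        * \<bar>l\<bar> powr (- 1 - a)) * (if \<delta> / norm \<omega> < \<bar>l\<bar> then 1 else 0)" for \<omega> l
      unfolding ch_def chord_integrand_def a_def by (simp add: indicator_def)
    have chm: "(\<lambda>z. ch (fst z) (snd z)) \<in> borel_measurable (borel \<Otimes>\<^sub>M borel)"
      unfolding ch_eq by measurable
    have chm2 [measurable]: "(\<lambda>\<omega>. \<integral>\<^sup>+l. ennreal (c * ch \<omega> l) \<partial>lborel) \<in> borel_measurable borel" for c :: real
    proof -
      have "(\<lambda>z. ennreal (c * ch (fst z) (snd z))) \<in> borel_measurable (borel \<Otimes>\<^sub>M borel)"
        using chm by measurable
      then have "(\<lambda>(\<omega>, l). ennreal (c * ch \<omega> l)) \<in> borel_measurable (borel \<Otimes>\<^sub>M lborel)"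
        by (simp add: split_beta' cong: measurable_cong_sets sets_pair_measure_cong)
      from lborel.borel_measurable_nn_integral[OF this] show ?thesis by simp
    qed
    have chm3 [measurable]: "(\<lambda>\<omega>. \<integral>\<^sup>+l. ennreal (- ch \<omega> l) \<partial>lborel) \<in> borel_measurable borel"
      using chm2[of "- 1"] by simp
    define e where "e = x /\<^sub>R norm x"
    have x0: "norm x \<noteq> 0" using x r by linarith
    have e: "norm e = 1" using x0 by (simp add: e_def)
    have key: "AE \<omega> in lborel. indicator {1..2} (norm \<omega>) * (ennreal (w \<omega>) * (\<integral>\<^sup>+l. ennreal (1 * ch \<omega> l) \<partial>lborel)) \<le>
      indicator {1..2} (norm \<omega>) * (ennreal (w \<omega>) * (\<integral>\<^sup>+l. ennreal (- 1 * ch \<omega> l) \<partial>lborel))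
       + ennreal C1 * (ennreal (r powr (- \<mu>)) * (ennreal (\<bar>\<omega> \<bullet> e\<bar> powr (- \<mu>)) * indicator {..2} (norm \<omega>)) + ennreal E * indicator {1..2} (norm \<omega>))"
    proof -
      have "AE \<omega> in lborel. x \<bullet> \<omega> \<noteq> 0"
      proof -
        have "negligible {\<omega>. x \<bullet> \<omega> = 0}" using negligible_hyperplane[of x 0] x0 by auto
        then have "{\<omega>. x \<bullet> \<omega> = 0} \<in> null_sets lebesgue" by (simp add: negligible_iff_null_sets)
        from AE_not_in[OF this] have "AE \<omega> in lebesgue. x \<bullet> \<omega> \<noteq> 0" by simp
        then show ?thesis by (simp add: AE_completion_iff)
      qed
      then show ?thesis
      proof eventually_elim
        case (elim \<omega>)
        show ?case
        proof (cases "norm \<omega> \<in> {1..2}")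
          case True
          have xw: "\<bar>x \<bullet> \<omega>\<bar> = norm x * \<bar>\<omega> \<bullet> e\<bar>" using x0 by (simp add: e_def abs_mult inner_commute[of \<omega> x])
          have k1: "\<bar>- 2 * (x \<bullet> \<omega>)\<bar> \<le> 4 * r"
          proof -
            have "\<bar>x \<bullet> \<omega>\<bar> \<le> norm x * norm \<omega>" by (rule Cauchy_Schwarz_ineq2)
            also have "\<dots> \<le> r * 2" using x True by (intro mult_mono) auto
            finally show ?thesis by simp
          qed
          have q: "1 \<le> (norm \<omega>)\<^sup>2" "(norm \<omega>)\<^sup>2 \<le> 4" using True power_mono[of "norm \<omega>" 2 2] by auto
          have w1: "1 \<le> norm \<omega>" using True by simp
          then have "0 < norm \<omega>" by linarith
          then have d: "0 < \<delta> / norm \<omega>" "\<delta> / norm \<omega> \<le> \<delta>"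
            using \<delta> w1 divide_left_mono[of 1 "norm \<omega>" \<delta>] by simp_all
          \<comment> \<open>\<open>J\<close> is the difference of the two integrands of the \<open>p\<close>-forms; the inner ball \<open>B'\<close> makes it strictly negative.\<close>
    define J where "J = C1 * (\<bar>- 2 * (x \<bullet> \<omega>)\<bar> powr (- \<mu>) + h powr (\<beta> * n - (n + 1)) * (\<delta> / norm \<omega>) powr \<alpha>)"
          have J0: "0 \<le> J" using C1 by (simp add: J_def)
          have "(LINT t|lborel. ch \<omega> t) \<le> J"
            unfolding ch_def J_def using C1(2)[OF h _ k1 q d(1)] elim by simp
          moreover have "integrable lborel (ch \<omega>)"
            unfolding ch_def using s n q d h by (intro integrable_chord_integrand) auto
          ultimately have 1: "(\<integral>\<^sup>+l. ennreal (ch \<omega> l) \<partial>lborel) \<le> (\<integral>\<^sup>+l. ennreal (- ch \<omega> l) \<partial>lborel) + ennreal J"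
            using J0 by (intro nn_integral_pos_le_neg)
          have "J \<le> C1 * (r powr (- \<mu>) * \<bar>\<omega> \<bullet> e\<bar> powr (- \<mu>) + E)"
          proof -
            have "\<bar>- 2 * (x \<bullet> \<omega>)\<bar> \<ge> r * \<bar>\<omega> \<bullet> e\<bar>" using xw x mult_right_mono[of r "2 * norm x" "\<bar>\<omega> \<bullet> e\<bar>"] by (simp add: abs_mult)
            moreover have "\<omega> \<bullet> e \<noteq> 0" using elim xw by force
            then have "0 < r * \<bar>\<omega> \<bullet> e\<bar>" using r by simp
            ultimately have "\<bar>- 2 * (x \<bullet> \<omega>)\<bar> powr (- \<mu>) \<le> (r * \<bar>\<omega> \<bullet> e\<bar>) powr (- \<mu>)" using \<mu> by (intro powr_mono2') auto
            also have "\<dots> = r powr (- \<mu>) * \<bar>\<omega> \<bullet> e\<bar> powr (- \<mu>)" using r by (simp add: powr_mult)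
            finally have "\<bar>- 2 * (x \<bullet> \<omega>)\<bar> powr (- \<mu>) \<le> r powr (- \<mu>) * \<bar>\<omega> \<bullet> e\<bar> powr (- \<mu>)" .
            moreover have "h powr (\<beta> * n - (n + 1)) * (\<delta> / norm \<omega>) powr \<alpha> \<le> E"
              unfolding E_def using d \<alpha> by (intro mult_left_mono powr_mono2) auto
            ultimately show ?thesis unfolding J_def using C1 by (intro mult_left_mono add_mono) auto
          qed
          then have 2: "ennreal J \<le> ennreal C1 * (ennreal (r powr (- \<mu>)) * ennreal (\<bar>\<omega> \<bullet> e\<bar> powr (- \<mu>)) + ennreal E)"
            using C1 E by (simp flip: ennreal_mult ennreal_plus add: ennreal_leI)
          have "ennreal (w \<omega>) * (\<integral>\<^sup>+l. ennreal (ch \<omega> l) \<partial>lborel) \<le> ennreal (w \<omega>) * ((\<integral>\<^sup>+l. ennreal (- ch \<omega> l) \<partial>lborel) + ennreal J)"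
            using 1 by (intro mult_left_mono) auto
          also have "\<dots> = ennreal (w \<omega>) * (\<integral>\<^sup>+l. ennreal (- ch \<omega> l) \<partial>lborel) + ennreal (w \<omega>) * ennreal J" by (rule distrib_left)
          also have "\<dots> \<le> ennreal (w \<omega>) * (\<integral>\<^sup>+l. ennreal (- ch \<omega> l) \<partial>lborel) + 1 * ennreal J"
            using w(2)[of \<omega>] True by (intro add_left_mono mult_right_mono) auto
          also have "\<dots> \<le> ennreal (w \<omega>) * (\<integral>\<^sup>+l. ennreal (- ch \<omega> l) \<partial>lborel) + ennreal C1 * (ennreal (r powr (- \<mu>)) * ennreal (\<bar>\<omega> \<bullet> e\<bar> powr (- \<mu>)) + ennreal E)"
            using 2 by (intro add_left_mono) simp
          finally show ?thesis using True by simp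
        qed simp
      qed
    qed
    have "ennreal (2 * ln 2) * (\<integral>\<^sup>+z. ennreal (1 * F z) \<partial>lborel) \<le>
      (\<integral>\<^sup>+\<omega>. (indicator {1..2} (norm \<omega>) * (ennreal (w \<omega>) * (\<integral>\<^sup>+l. ennreal (- 1 * ch \<omega> l) \<partial>lborel)))
       + ennreal C1 * (ennreal (r powr (- \<mu>)) * (ennreal (\<bar>\<omega> \<bullet> e\<bar> powr (- \<mu>)) * indicator {..2} (norm \<omega>)) + ennreal E * indicator {1..2} (norm \<omega>)) \<partial>lborel)"
      unfolding polar by (rule nn_integral_mono_AE[OF key])
    also have "\<dots> = ennreal (2 * ln 2) * (\<integral>\<^sup>+z. ennreal (- 1 * F z) \<partial>lborel) +
       ennreal C1 * (ennreal (r powr (- \<mu>)) * (\<integral>\<^sup>+\<omega>. ennreal (\<bar>\<omega> \<bullet> e\<bar> powr (- \<mu>)) * indicator {..2} (norm \<omega>) \<partial>lborel) + ennreal E * (\<integral>\<^sup>+(\<omega>::'a). indicator {1..2} (norm \<omega>) \<partial>lborel))"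
      unfolding polar by (simp add: nn_integral_add nn_integral_cmult)
    also have "\<dots> \<le> ennreal (2 * ln 2) * (\<integral>\<^sup>+z. ennreal (- 1 * F z) \<partial>lborel) +
       ennreal C1 * (ennreal (r powr (- \<mu>)) * ennreal B + ennreal E * ennreal V)"
      unfolding V(1) using B(2)[OF e] by (intro add_left_mono mult_left_mono add_right_mono) auto
    also have "\<dots> \<le> ennreal (2 * ln 2) * (\<integral>\<^sup>+z. ennreal (- 1 * F z) \<partial>lborel) + ennreal ((2 * ln 2) * (C * (1 + E)))"
    proof (rule add_left_mono)
      have "ennreal C1 * (ennreal (r powr (- \<mu>)) * ennreal B + ennreal E * ennreal V) = ennreal (C1 * (r powr (- \<mu>) * B + E * V))"
        using C1 B E V by (simp flip: ennreal_mult ennreal_plus)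
      also have "\<dots> \<le> ennreal ((2 * ln 2) * (C * (1 + E)))"
      proof (rule ennreal_leI)
      have "r powr (- \<mu>) * B + E * V \<le> (r powr (- \<mu>) * B + V + 1) * (1 + E)"
      proof -
        have "0 \<le> r powr (- \<mu>) * B * E" using B E by simp
        then show ?thesis using V E by (simp add: algebra_simps)
      qed
      then have "C1 * (r powr (- \<mu>) * B + E * V) \<le> C1 * ((r powr (- \<mu>) * B + V + 1) * (1 + E))" using C1 by (intro mult_left_mono) auto
      also have "\<dots> = (2 * ln 2) * (C * (1 + E))" by (simp add: C_def)
      finally show "C1 * (r powr (- \<mu>) * B + E * V) \<le> (2 * ln 2) * (C * (1 + E))" .
    qed
      finally show "ennreal C1 * (ennreal (r powr (- \<mu>)) * ennreal B + ennreal E * ennreal V) \<le> ennreal ((2 * ln 2) * (C * (1 + E)))" .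
    qed
    also have "ennreal (2 * ln 2) * (\<integral>\<^sup>+z. ennreal (- 1 * F z) \<partial>lborel) + ennreal ((2 * ln 2) * (C * (1 + E)))
      = ennreal (2 * ln 2) * ((\<integral>\<^sup>+z. ennreal (- F z) \<partial>lborel) + ennreal (C * (1 + E)))"
      using E \<open>0 < C\<close> by (simp add: ennreal_mult distrib_left)
    finally have "(\<integral>\<^sup>+z. ennreal (F z) \<partial>lborel) \<le> (\<integral>\<^sup>+z. ennreal (- F z) \<partial>lborel) + ennreal (C * (1 + E))"
      by (subst (asm) ennreal_mult_le_mult_iff) auto
    then have "(LINT z|lborel. F z) \<le> C * (1 + E)"
      using Fint E \<open>0 < C\<close> by (intro integral_le_of_nn_integral) auto
    then show ?thesis unfolding F_def E_def h_def .
  qed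
  ultimately show ?thesis using that unfolding a_def \<alpha>_def by blast
qed


section \<open>Nonlocal forms on the product space\<close>

abbreviation leb2 :: "('a::euclidean_space \<times> 'a) measure" where
  "leb2 \<equiv> lebesgue \<Otimes>\<^sub>M lebesgue"

lemma sigma_finite_lebesgue: "sigma_finite_measure (lebesgue :: 'a::euclidean_space measure)"
proof
  obtain A :: "'a set set" where A: "countable A" "A \<subseteq> sets lborel" "\<Union>A = space lborel" "\<forall>a\<in>A. emeasure lborel a \<noteq> \<infinity>"
    using lborel.sigma_finite_countable by blast
  then show "\<exists>A::'a set set. countable A \<and> A \<subseteq> sets lebesgue \<and> \<Union>A = space lebesgue \<and> (\<forall>a\<in>A. emeasure lebesgue a \<noteq> \<infinity>)"
    by (intro exI[of _ A]) (auto simp: emeasure_completion main_part_sets)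
qed

interpretation lebesgue_sf: sigma_finite_measure "lebesgue :: 'a::euclidean_space measure"
  by (rule sigma_finite_lebesgue)

interpretation lebesgue_pair: pair_sigma_finite "lebesgue :: 'a::euclidean_space measure" "lebesgue :: 'b::euclidean_space measure" ..

lemma borel_measurable_lebesgue_of_borel: "f \<in> borel_measurable borel \<Longrightarrow> f \<in> borel_measurable lebesgue"
  by (simp add: measurable_completion)

lemma measurable_leb2_fst: "f \<in> borel_measurable lebesgue \<Longrightarrow> (\<lambda>z. f (fst z)) \<in> borel_measurable leb2"
  by (rule measurable_compose[OF measurable_fst])

lemma measurable_leb2_snd: "f \<in> borel_measurable lebesgue \<Longrightarrow> (\<lambda>z. f (snd z)) \<in> borel_measurable leb2"
  by (rule measurable_compose[OF measurable_snd])

lemma measurable_leb2_diff: "(\<lambda>z::'a::euclidean_space \<times> 'a. fst z - snd z) \<in> borel_measurable leb2"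
proof -
  have id: "(\<lambda>x::'a. x) \<in> borel_measurable lebesgue" by (rule borel_measurable_lebesgue_of_borel) simp
  show ?thesis by (rule borel_measurable_diff[OF measurable_leb2_fst[OF id] measurable_leb2_snd[OF id]])
qed

lemma measurable_leb2_kernel:
  fixes k :: "'a::euclidean_space \<Rightarrow> real"
  assumes "k \<in> borel_measurable borel"
  shows "(\<lambda>z. k (fst z - snd z)) \<in> borel_measurable leb2"
  by (rule measurable_compose[OF measurable_leb2_diff assms])

lemma nn_integral_lebesgue_reflect:
  fixes k :: "'a::euclidean_space \<Rightarrow> ennreal"
  assumes "k \<in> borel_measurable borel"
  shows "(\<integral>\<^sup>+y. k (x - y) \<partial>lebesgue) = (\<integral>\<^sup>+z. k z \<partial>lborel)"
  unfolding nn_integral_completion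
  using nn_integral_euclidean_affine[OF assms, of "- 1" x] by simp

lemma nn_integral_lebesgue_translate:
  fixes k :: "'a::euclidean_space \<Rightarrow> ennreal"
  assumes "k \<in> borel_measurable borel"
  shows "(\<integral>\<^sup>+y. k (y - x) \<partial>lebesgue) = (\<integral>\<^sup>+z. k z \<partial>lborel)"
  unfolding nn_integral_completion
  using nn_integral_euclidean_affine[OF assms, of 1 "- x"] by simp

lemma nn_integral_fst_kernel:
  fixes f :: "'a::euclidean_space \<Rightarrow> ennreal" and k :: "'a \<Rightarrow> ennreal"
  assumes f: "f \<in> borel_measurable lebesgue" and k: "k \<in> borel_measurable borel"
  shows "(\<integral>\<^sup>+z. f (fst z) * k (fst z - snd z) \<partial>leb2) = (\<integral>\<^sup>+x. f x \<partial>lebesgue) * (\<integral>\<^sup>+z. k z \<partial>lborel)"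
proof -
  have m: "(\<lambda>z. f (fst z) * k (fst z - snd z)) \<in> borel_measurable leb2"
    using measurable_leb2_fst[OF f] measurable_compose[OF measurable_leb2_diff k] by measurable
  have "(\<integral>\<^sup>+z. f (fst z) * k (fst z - snd z) \<partial>leb2) = (\<integral>\<^sup>+x. \<integral>\<^sup>+y. f x * k (x - y) \<partial>lebesgue \<partial>lebesgue)"
    using lebesgue_sf.nn_integral_fst[OF m] by simp
  also have "\<dots> = (\<integral>\<^sup>+x. f x * (\<integral>\<^sup>+z. k z \<partial>lborel) \<partial>lebesgue)"
  proof (rule nn_integral_cong)
    fix x
    have "(\<lambda>y. k (x - y)) \<in> borel_measurable lebesgue"
      by (intro borel_measurable_lebesgue_of_borel measurable_compose[OF _ k]) simp
    then show "(\<integral>\<^sup>+y. f x * k (x - y) \<partial>lebesgue) = f x * (\<integral>\<^sup>+z. k z \<partial>lborel)"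
      using nn_integral_lebesgue_reflect[OF k, of x] by (simp add: nn_integral_cmult)
  qed
  also have "\<dots> = (\<integral>\<^sup>+x. f x \<partial>lebesgue) * (\<integral>\<^sup>+z. k z \<partial>lborel)"
    using f by (intro nn_integral_multc)
  finally show ?thesis .
qed

lemma nn_integral_snd_kernel:
  fixes f :: "'a::euclidean_space \<Rightarrow> ennreal" and k :: "'a \<Rightarrow> ennreal"
  assumes f: "f \<in> borel_measurable lebesgue" and k: "k \<in> borel_measurable borel"
  shows "(\<integral>\<^sup>+z. f (snd z) * k (fst z - snd z) \<partial>leb2) = (\<integral>\<^sup>+x. f x \<partial>lebesgue) * (\<integral>\<^sup>+z. k z \<partial>lborel)"
proof -
  have m: "(\<lambda>z. f (snd z) * k (fst z - snd z)) \<in> borel_measurable leb2"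
    using measurable_leb2_snd[OF f] measurable_compose[OF measurable_leb2_diff k] by measurable
  have "(\<integral>\<^sup>+z. f (snd z) * k (fst z - snd z) \<partial>leb2) = (\<integral>\<^sup>+y. \<integral>\<^sup>+x. f y * k (x - y) \<partial>lebesgue \<partial>lebesgue)"
    using lebesgue_pair.nn_integral_snd[OF m] by simp
  also have "\<dots> = (\<integral>\<^sup>+y. f y * (\<integral>\<^sup>+z. k z \<partial>lborel) \<partial>lebesgue)"
  proof (rule nn_integral_cong)
    fix y
    have "(\<lambda>x. k (x - y)) \<in> borel_measurable lebesgue"
      by (intro borel_measurable_lebesgue_of_borel measurable_compose[OF _ k]) simp
    then show "(\<integral>\<^sup>+x. f y * k (x - y) \<partial>lebesgue) = f y * (\<integral>\<^sup>+z. k z \<partial>lborel)"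
      using nn_integral_lebesgue_translate[OF k, of y] by (simp add: nn_integral_cmult)
  qed
  also have "\<dots> = (\<integral>\<^sup>+x. f x \<partial>lebesgue) * (\<integral>\<^sup>+z. k z \<partial>lborel)"
    using f by (intro nn_integral_multc)
  finally show ?thesis .
qed

lemma integrable_fst_trunc_kernel:
  fixes f :: "'a::euclidean_space \<Rightarrow> real"
  assumes f: "integrable lebesgue f" and a: "0 < a" "0 < \<delta>"
  shows "integrable leb2 (\<lambda>z. f (fst z) * trunc_kernel a \<delta> (fst z - snd z))"
proof (rule integrableI_bounded)
  have fm: "f \<in> borel_measurable lebesgue" using f by (rule borel_measurable_integrable)
  show "(\<lambda>z. f (fst z) * trunc_kernel a \<delta> (fst z - snd z)) \<in> borel_measurable leb2"
    using measurable_leb2_fst[OF fm] measurable_leb2_kernel[OF trunc_kernel_measurable] by (rule borel_measurable_times)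
  have "(\<integral>\<^sup>+z. ennreal (norm (f (fst z) * trunc_kernel a \<delta> (fst z - snd z))) \<partial>leb2)
    = (\<integral>\<^sup>+z. ennreal \<bar>f (fst z)\<bar> * ennreal (trunc_kernel a \<delta> (fst z - snd z)) \<partial>leb2)"
    by (simp add: abs_mult trunc_kernel_nonneg ennreal_mult)
  also have "\<dots> = (\<integral>\<^sup>+x. ennreal \<bar>f x\<bar> \<partial>lebesgue) * (\<integral>\<^sup>+(z::'a). ennreal (trunc_kernel a \<delta> z) \<partial>lborel)"
    using fm by (intro nn_integral_fst_kernel) auto
  also have "\<dots> < \<infinity>"
    using f integrable_trunc_kernel[OF a, where 'a='a]
    by (simp add: integrable_iff_bounded ennreal_mult_less_top trunc_kernel_nonneg)
  finally show "(\<integral>\<^sup>+z. ennreal (norm (f (fst z) * trunc_kernel a \<delta> (fst z - snd z))) \<partial>leb2) < \<infinity>" .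
qed

lemma integrable_snd_trunc_kernel:
  fixes f :: "'a::euclidean_space \<Rightarrow> real"
  assumes f: "integrable lebesgue f" and a: "0 < a" "0 < \<delta>"
  shows "integrable leb2 (\<lambda>z. f (snd z) * trunc_kernel a \<delta> (fst z - snd z))"
proof (rule integrableI_bounded)
  have fm: "f \<in> borel_measurable lebesgue" using f by (rule borel_measurable_integrable)
  show "(\<lambda>z. f (snd z) * trunc_kernel a \<delta> (fst z - snd z)) \<in> borel_measurable leb2"
    using measurable_leb2_snd[OF fm] measurable_leb2_kernel[OF trunc_kernel_measurable] by (rule borel_measurable_times)
  have "(\<integral>\<^sup>+z. ennreal (norm (f (snd z) * trunc_kernel a \<delta> (fst z - snd z))) \<partial>leb2)
    = (\<integral>\<^sup>+z. ennreal \<bar>f (snd z)\<bar> * ennreal (trunc_kernel a \<delta> (fst z - snd z)) \<partial>leb2)"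
    by (simp add: abs_mult trunc_kernel_nonneg ennreal_mult)
  also have "\<dots> = (\<integral>\<^sup>+x. ennreal \<bar>f x\<bar> \<partial>lebesgue) * (\<integral>\<^sup>+(z::'a). ennreal (trunc_kernel a \<delta> z) \<partial>lborel)"
    using fm by (intro nn_integral_snd_kernel) auto
  also have "\<dots> < \<infinity>"
    using f integrable_trunc_kernel[OF a, where 'a='a]
    by (simp add: integrable_iff_bounded ennreal_mult_less_top trunc_kernel_nonneg)
  finally show "(\<integral>\<^sup>+z. ennreal (norm (f (snd z) * trunc_kernel a \<delta> (fst z - snd z))) \<partial>leb2) < \<infinity>" .
qed

definition energy_density :: "real \<Rightarrow> real \<Rightarrow> ('a::euclidean_space \<Rightarrow> real) \<Rightarrow> 'a \<times> 'a \<Rightarrow> real" where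
  "energy_density s m u z = \<bar>u (fst z) - u (snd z)\<bar> powr m / norm (fst z - snd z) powr (real DIM('a) + s * m)"

lemma energy_density_nonneg: "0 \<le> energy_density s m u z" by (simp add: energy_density_def)

lemma energy_density_measurable:
  fixes u :: "'a::euclidean_space \<Rightarrow> real"
  assumes "u \<in> borel_measurable lebesgue"
  shows "energy_density s m u \<in> borel_measurable leb2"
proof -
  have "(\<lambda>z::'a \<times> 'a. norm (fst z - snd z)) \<in> borel_measurable leb2" by (intro measurable_leb2_kernel) simp
  then show ?thesis
    unfolding energy_density_def[abs_def] using measurable_leb2_fst[OF assms] measurable_leb2_snd[OF assms] by measurable
qed

lemma gagliardo_energy_eq:
  fixes u v :: "'a::euclidean_space \<Rightarrow> real"
  assumes E: "E \<in> sets lebesgue" and v: "v \<in> borel_measurable lebesgue" and uv: "\<And>x. x \<in> E \<Longrightarrow> u x = v x"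
  shows "gagliardo_energy E s m u = (\<integral>\<^sup>+z. ennreal (energy_density s m v z * indicator (E \<times> E) z) \<partial>leb2)"
proof -
  have m: "(\<lambda>z. ennreal (energy_density s m v z * indicator (E \<times> E) z)) \<in> borel_measurable leb2"
    using energy_density_measurable[OF v] E by measurable
  have "gagliardo_energy E s m u = (\<integral>\<^sup>+x. (\<integral>\<^sup>+y. ennreal (\<bar>u x - u y\<bar> powr m / norm (x - y) powr (real DIM('a) + s * m)) * indicator E y
        \<partial>lebesgue) * indicator E x \<partial>lebesgue)"
    unfolding gagliardo_energy_def using E by (simp add: nn_integral_restrict_space)
  also have "\<dots> = (\<integral>\<^sup>+x. \<integral>\<^sup>+y. ennreal (energy_density s m v (x, y) * indicator (E \<times> E) (x, y)) \<partial>lebesgue \<partial>lebesgue)"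
  proof (rule nn_integral_cong)
    fix x
    show "(\<integral>\<^sup>+y. ennreal (\<bar>u x - u y\<bar> powr m / norm (x - y) powr (real DIM('a) + s * m)) * indicator E y \<partial>lebesgue) * indicator E x
      = (\<integral>\<^sup>+y. ennreal (energy_density s m v (x, y) * indicator (E \<times> E) (x, y)) \<partial>lebesgue)"
    proof (cases "x \<in> E")
      case True
      then show ?thesis using uv by (auto simp: energy_density_def indicator_def intro!: nn_integral_cong)
    qed simp
  qed
  also have "\<dots> = (\<integral>\<^sup>+z. ennreal (energy_density s m v z * indicator (E \<times> E) z) \<partial>leb2)"
    using lebesgue_sf.nn_integral_fst[OF m] by simp
  finally show ?thesis .
qed

lemma lipschitz_energy_finite:
  fixes W :: "'a::euclidean_space \<Rightarrow> real"
  assumes L: "\<And>x y. \<bar>W x - W y\<bar> \<le> L * norm (x - y)" and E: "E \<in> sets lebesgue" "bounded E" and s: "0 < s" "s < 1" "1 < m"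
  shows "(\<integral>\<^sup>+z. ennreal (energy_density s m W z * indicator (E \<times> E) z) \<partial>leb2) < \<infinity>"
proof -
  obtain R where R: "0 < R" "\<And>x. x \<in> E \<Longrightarrow> norm x \<le> R" using E(2) by (auto simp: bounded_pos)
  define a where "a = m * (1 - s)"
  have a: "0 < a" using s by (simp add: a_def)
  have L0: "0 \<le> L"
  proof -
    obtain b :: 'a where "b \<in> Basis" using SOME_Basis by blast
    then show ?thesis using L[of b 0] by simp
  qed
  define k :: "'a \<Rightarrow> real" where "k = (\<lambda>x. indicator {..2 * R} (norm x) * norm x powr (a - real DIM('a)))"
  have km: "k \<in> borel_measurable borel" unfolding k_def by measurable
  have "(\<integral>\<^sup>+z. ennreal (energy_density s m W z * indicator (E \<times> E) z) \<partial>leb2)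
    \<le> (\<integral>\<^sup>+z. (ennreal (L powr m) * indicator E (fst z)) * ennreal (k (fst z - snd z)) \<partial>leb2)"
  proof (rule nn_integral_mono)
    fix z :: "'a \<times> 'a"
    show "ennreal (energy_density s m W z * indicator (E \<times> E) z) \<le> (ennreal (L powr m) * indicator E (fst z)) * ennreal (k (fst z - snd z))"
    proof (cases "z \<in> E \<times> E \<and> fst z \<noteq> snd z")
      case True
      define t where "t = norm (fst z - snd z)"
      have t: "0 < t" using True by (simp add: t_def)
      have "t \<le> norm (fst z) + norm (snd z)" unfolding t_def by (rule norm_triangle_ineq4)
      also have "\<dots> \<le> 2 * R" using R(2)[of "fst z"] R(2)[of "snd z"] True by auto
      finally have t2: "t \<le> 2 * R" .
      have "\<bar>W (fst z) - W (snd z)\<bar> powr m \<le> (L * t) powr m" using L s by (intro powr_mono2) (auto simp: t_def)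
      also have "\<dots> = L powr m * t powr m" using L0 t by (simp add: powr_mult)
      finally have "energy_density s m W z \<le> L powr m * t powr m / t powr (real DIM('a) + s * m)"
        unfolding energy_density_def t_def[symmetric] by (intro divide_right_mono) auto
      also have "\<dots> = L powr m * (t powr m / t powr (real DIM('a) + s * m))" by simp
      also have "t powr m / t powr (real DIM('a) + s * m) = t powr (a - real DIM('a))"
        unfolding powr_diff[symmetric] by (simp add: a_def algebra_simps)
      also have "\<dots> = k (fst z - snd z)" using t2 by (simp add: k_def t_def)
      finally have "ennreal (energy_density s m W z) \<le> ennreal (L powr m * k (fst z - snd z))" by (rule ennreal_leI)
      then show ?thesis using True by (auto simp: ennreal_mult' mem_Times_iff)
    next
      case False
      then show ?thesis using s by (auto simp: energy_density_def indicator_def)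
    qed
  qed
  also have "\<dots> = (\<integral>\<^sup>+x. ennreal (L powr m) * indicator E x \<partial>lebesgue) * (\<integral>\<^sup>+z. ennreal (k z) \<partial>lborel)"
    using E km by (intro nn_integral_fst_kernel) auto
  also have "\<dots> < \<infinity>"
  proof -
    have "emeasure lebesgue E < \<infinity>" using bounded_set_imp_lmeasurable[OF E(2,1)] by (auto simp: fmeasurable_def)
    then show ?thesis
      using nn_integral_kernel_near_finite[OF a, of "2 * R", where 'a='a] R(1) E(1)
      unfolding k_def by (subst nn_integral_cmult_indicator) (auto simp: ennreal_mult_less_top)
  qed
  finally show ?thesis .
qed

lemma measurable_frac_integrand:
  fixes f \<phi> :: "'a::euclidean_space \<Rightarrow> real"
  assumes "f \<in> borel_measurable lebesgue" "\<phi> \<in> borel_measurable lebesgue"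
  shows "(\<lambda>z. signed_pow (f (fst z) - f (snd z)) n * (\<phi> (fst z) - \<phi> (snd z)) / norm (fst z - snd z) powr c) \<in> borel_measurable leb2"
proof -
  have "(\<lambda>z::'a \<times> 'a. norm (fst z - snd z)) \<in> borel_measurable leb2" by (intro measurable_leb2_kernel) simp
  then show ?thesis
    using measurable_leb2_fst[OF assms(1)] measurable_leb2_snd[OF assms(1)] measurable_leb2_fst[OF assms(2)] measurable_leb2_snd[OF assms(2)]
    by measurable
qed

lemma powr_add_le:
  fixes a b m :: real
  assumes "0 \<le> a" "0 \<le> b" "0 < m"
  shows "(a + b) powr m \<le> 2 powr m * (a powr m + b powr m)"
proof -
  have "(a + b) powr m \<le> (2 * max a b) powr m" using assms by (intro powr_mono2) auto
  also have "\<dots> = 2 powr m * max a b powr m" using assms by (simp add: powr_mult)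
  also have "\<dots> \<le> 2 powr m * (a powr m + b powr m)" by (intro mult_left_mono) (auto simp: max_def)
  finally show ?thesis .
qed

lemma powr_mult_le_add:
  fixes a b m :: real
  assumes "0 \<le> a" "0 \<le> b" "1 < m"
  shows "a powr (m - 1) * b \<le> a powr m + b powr m"
proof -
  define M where "M = max a b"
  have "a powr (m - 1) * b \<le> M powr (m - 1) * M" using assms by (intro mult_mono powr_mono2) (auto simp: M_def)
  also have "\<dots> = M powr m" using assms powr_mult_base[of M "m - 1"] by (simp add: M_def mult.commute)
  also have "\<dots> \<le> a powr m + b powr m" by (auto simp: M_def max_def)
  finally show ?thesis .
qed

text \<open>The pattern by which all forms converge: near the diagonal a local energy dominates, and away from it the
kernel is integrable while one of the points stays in the bounded set \<open>K\<close>.\<close>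

lemma near_far_integrable:
  fixes G G1 :: "'a::euclidean_space \<times> 'a \<Rightarrow> real"
  assumes Gm: "G \<in> borel_measurable leb2" and G1m: "G1 \<in> borel_measurable leb2" and G1: "\<And>z. 0 \<le> G1 z"
    and G1f: "(\<integral>\<^sup>+z. ennreal (G1 z * indicator (E \<times> E) z) \<partial>leb2) < \<infinity>"
    and E: "E \<in> sets lebesgue" and K: "K \<in> sets lebesgue" "bounded K" and a: "0 < a" "0 < d" and B: "0 \<le> B"
    and bound: "\<And>z. \<bar>G z\<bar> \<le> G1 z * indicator (E \<times> E) z +
       B * (indicator K (fst z) * trunc_kernel a d (fst z - snd z) + indicator K (snd z) * trunc_kernel a d (fst z - snd z))"
  shows "integrable leb2 G"
proof (rule Bochner_Integration.integrable_bound)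
  have Ki: "integrable lebesgue (indicator K :: 'a \<Rightarrow> real)"
    using bounded_set_imp_lmeasurable[OF K(2,1)] by (intro integrable_real_indicator) (auto simp: fmeasurable_def)
  have "integrable leb2 (\<lambda>z. G1 z * indicator (E \<times> E) z)"
    using G1f G1m G1 E by (intro integrableI_bounded) (auto simp: abs_mult)
  then show "integrable leb2 (\<lambda>z. G1 z * indicator (E \<times> E) z +
       B * (indicator K (fst z) * trunc_kernel a d (fst z - snd z) + indicator K (snd z) * trunc_kernel a d (fst z - snd z)))"
    using integrable_fst_trunc_kernel[OF Ki a] integrable_snd_trunc_kernel[OF Ki a]
    by (intro Bochner_Integration.integrable_add integrable_mult_right)
  have "norm (G z) \<le> norm (G1 z * indicator (E \<times> E) z +
       B * (indicator K (fst z) * trunc_kernel a d (fst z - snd z) + indicator K (snd z) * trunc_kernel a d (fst z - snd z)))" for z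
    using bound[of z] unfolding real_norm_def by linarith
  then show "AE z in leb2. norm (G z) \<le> norm (G1 z * indicator (E \<times> E) z +
       B * (indicator K (fst z) * trunc_kernel a d (fst z - snd z) + indicator K (snd z) * trunc_kernel a d (fst z - snd z)))"
    by simp
qed (rule Gm)

lemma trunc_kernel_eq: "d < norm z \<Longrightarrow> trunc_kernel a d z = 1 / norm z powr (real DIM('a) + a)" for z :: "'a::euclidean_space"
  by (simp add: trunc_kernel_def)

text \<open>Only the energies of \<open>u\<close> and \<open>W\<close> over \<open>E\<close> are assumed finite. A pair contributes only if one of its points is in
\<open>K\<close>. If the points are within \<open>d\<close> of each other, both are in \<open>E\<close> and Young's inequality bounds the integrand
by the energy densities; otherwise all functions are bounded by \<open>B\<close>.\<close>

lemma comparison_integrands: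
  fixes u W \<phi> :: "'a::euclidean_space \<Rightarrow> real"
  assumes um: "u \<in> borel_measurable lebesgue" and Wm: "W \<in> borel_measurable lebesgue"
    and uB: "\<And>x. 0 \<le> u x" "\<And>x. u x \<le> B" and WB: "\<And>x. 0 \<le> W x" "\<And>x. W x \<le> B"
    and \<phi>: "\<phi> = (\<lambda>x. max 0 (W x - u x))" and \<phi>K': "\<forall>x. x \<notin> K \<longrightarrow> \<phi> x = 0"
    and K: "K \<in> sets lebesgue" "bounded K" and E: "E \<in> sets lebesgue" and d': "0 < d" "\<forall>x y. x \<in> K \<longrightarrow> norm (x - y) \<le> d \<longrightarrow> y \<in> E"
    and eu: "(\<integral>\<^sup>+z. ennreal (energy_density s m u z * indicator (E \<times> E) z) \<partial>leb2) < \<infinity>"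
    and eW: "(\<integral>\<^sup>+z. ennreal (energy_density s m W z * indicator (E \<times> E) z) \<partial>leb2) < \<infinity>"
    and s: "0 < s" "1 < m"
  shows "integrable leb2 (energy_density s m \<phi>)"
    and "integrable leb2 (\<lambda>z. signed_pow (u (fst z) - u (snd z)) (m - 1) * (\<phi> (fst z) - \<phi> (snd z)) / norm (fst z - snd z) powr (real DIM('a) + m * s))" (is "integrable _ (?I u)")
    and "integrable leb2 (\<lambda>z. signed_pow (W (fst z) - W (snd z)) (m - 1) * (\<phi> (fst z) - \<phi> (snd z)) / norm (fst z - snd z) powr (real DIM('a) + m * s))"
proof -
  note \<phi>K = \<phi>K'[rule_format] and d = d'[rule_format]
  \<comment> \<open>\<open>2 powr m\<close> from the energy of \<open>\<phi>\<close> in terms of those of \<open>u\<close> and \<open>W\<close>, and \<open>1\<close> from Young's inequality.\<close>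
  define C where "C = 2 powr m + 1"
  define G1 where "G1 = (\<lambda>z. C * (energy_density s m u z + energy_density s m W z))"
  have a: "0 < s * m" using s by simp
  have B: "0 \<le> B" using uB[of 0] by linarith
  have \<phi>m: "\<phi> \<in> borel_measurable lebesgue" unfolding \<phi> using um Wm by measurable
  have \<phi>B: "0 \<le> \<phi> x" "\<phi> x \<le> B" for x using uB[of x] WB[of x] B by (auto simp: \<phi>)
  have C: "0 \<le> C" "1 \<le> C" by (simp_all add: C_def add_nonneg_nonneg)
  have eum: "energy_density s m u \<in> borel_measurable leb2" "energy_density s m W \<in> borel_measurable leb2"
    using um Wm by (auto intro: energy_density_measurable)
  have G1m: "G1 \<in> borel_measurable leb2" unfolding G1_def using eum by measurable
  have G1: "0 \<le> G1 z" for z using energy_density_nonneg[of s m u z] energy_density_nonneg[of s m W z] C by (simp add: G1_def)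
  have EE: "E \<times> E \<in> sets leb2" using E by simp
  have G1f: "(\<integral>\<^sup>+z. ennreal (G1 z * indicator (E \<times> E) z) \<partial>leb2) < \<infinity>"
  proof -
    have "(\<integral>\<^sup>+z. ennreal (G1 z * indicator (E \<times> E) z) \<partial>leb2) =
      (\<integral>\<^sup>+z. ennreal C * (ennreal (energy_density s m u z * indicator (E \<times> E) z) + ennreal (energy_density s m W z * indicator (E \<times> E) z)) \<partial>leb2)"
      using C energy_density_nonneg[of s m u] energy_density_nonneg[of s m W]
      by (intro nn_integral_cong) (auto simp: G1_def indicator_def simp flip: ennreal_mult ennreal_plus)
    also have "\<dots> = ennreal C * ((\<integral>\<^sup>+z. ennreal (energy_density s m u z * indicator (E \<times> E) z) \<partial>leb2) + (\<integral>\<^sup>+z. ennreal (energy_density s m W z * indicator (E \<times> E) z) \<partial>leb2))"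
      using eum EE by (subst nn_integral_cmult, measurable, subst nn_integral_add, measurable)
    also have "\<dots> < \<infinity>" using eu eW by (simp add: ennreal_mult_less_top)
    finally show ?thesis .
  qed
  define k where "k = (\<lambda>z::'a \<times> 'a. 1 / norm (fst z - snd z) powr (real DIM('a) + s * m))"
  have k0: "0 \<le> k z" for z by (simp add: k_def)
  have pt: "H z * k z \<le> G1 z * indicator (E \<times> E) z +
      Q * (indicator K (fst z) * trunc_kernel (s * m) d (fst z - snd z) + indicator K (snd z) * trunc_kernel (s * m) d (fst z - snd z))"
    if h0: "\<phi> (fst z) = \<phi> (snd z) \<Longrightarrow> H z \<le> 0"
    and h1: "H z \<le> C * (\<bar>u (fst z) - u (snd z)\<bar> powr m + \<bar>W (fst z) - W (snd z)\<bar> powr m)" and h2: "H z \<le> Q" "0 \<le> Q" for H Q z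
  proof (cases "fst z \<in> K \<or> snd z \<in> K")
    case False
    then have "\<phi> (fst z) = \<phi> (snd z)" using \<phi>K by simp
    then have "H z * k z \<le> 0" using h0 k0[of z] by (simp add: mult_nonpos_nonneg)
    also have "0 \<le> G1 z * indicator (E \<times> E) z +
      Q * (indicator K (fst z) * trunc_kernel (s * m) d (fst z - snd z) + indicator K (snd z) * trunc_kernel (s * m) d (fst z - snd z))"
      using G1[of z] h2(2) trunc_kernel_nonneg[of "s * m" d "fst z - snd z"] by (intro add_nonneg_nonneg mult_nonneg_nonneg) auto
    finally show ?thesis .
  next
    case True
    show ?thesis
    proof (cases "norm (fst z - snd z) \<le> d")
      case near: True
      have z0: "norm (fst z - fst z) \<le> d" "norm (snd z - snd z) \<le> d" using d by simp_all
      have "fst z \<in> E" "snd z \<in> E"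
        using True near d(2)[of "fst z" "snd z"] d(2)[of "snd z" "fst z"] d(2)[OF _ z0(1)] d(2)[OF _ z0(2)] by (auto simp: norm_minus_commute)
      then have "z \<in> E \<times> E" by (simp add: mem_Times_iff)
      moreover have "H z * k z \<le> G1 z"
        using mult_right_mono[OF h1 k0[of z]] by (simp add: G1_def energy_density_def k_def algebra_simps add_divide_distrib)
      moreover have "0 \<le> Q * (indicator K (fst z) * trunc_kernel (s * m) d (fst z - snd z) + indicator K (snd z) * trunc_kernel (s * m) d (fst z - snd z))"
        using h2(2) trunc_kernel_nonneg[of "s * m" d "fst z - snd z"] by (intro add_nonneg_nonneg mult_nonneg_nonneg) auto
      ultimately show ?thesis by simp
    next
      case far: False
      then have t: "trunc_kernel (s * m) d (fst z - snd z) = k z" unfolding k_def by (intro trunc_kernel_eq) simp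
      have "H z * k z \<le> Q * k z" using h2 k0[of z] by (intro mult_right_mono) auto
      also have "\<dots> \<le> Q * (indicator K (fst z) * k z + indicator K (snd z) * k z)"
        using True h2(2) k0[of z] by (intro mult_left_mono) (auto simp: indicator_def)
      also have "\<dots> \<le> G1 z * indicator (E \<times> E) z + Q * (indicator K (fst z) * k z + indicator K (snd z) * k z)"
        using G1[of z] by simp
      finally show ?thesis unfolding t .
    qed
  qed
  have dphi: "\<bar>\<phi> x - \<phi> y\<bar> \<le> \<bar>u x - u y\<bar> + \<bar>W x - W y\<bar>" for x y by (auto simp: \<phi> max_def)
  have dphim: "\<bar>\<phi> x - \<phi> y\<bar> powr m \<le> 2 powr m * (\<bar>u x - u y\<bar> powr m + \<bar>W x - W y\<bar> powr m)" for x y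
  proof -
    have "\<bar>\<phi> x - \<phi> y\<bar> powr m \<le> (\<bar>u x - u y\<bar> + \<bar>W x - W y\<bar>) powr m" using dphi s by (intro powr_mono2) auto
    also have "\<dots> \<le> 2 powr m * (\<bar>u x - u y\<bar> powr m + \<bar>W x - W y\<bar> powr m)" using s by (intro powr_add_le) auto
    finally show ?thesis .
  qed
  have small: "\<bar>f x - f y\<bar> \<le> B" if "\<And>x. 0 \<le> f x" "\<And>x. f x \<le> B" for f :: "'a \<Rightarrow> real" and x y
    using that(1)[of x] that(1)[of y] that(2)[of x] that(2)[of y] by linarith
  show "integrable leb2 (energy_density s m \<phi>)"
  proof (rule near_far_integrable[OF energy_density_measurable[OF \<phi>m] G1m G1 G1f E K a d(1), of "B powr m"])
    fix z :: "'a \<times> 'a"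
    have "\<bar>energy_density s m \<phi> z\<bar> = \<bar>\<phi> (fst z) - \<phi> (snd z)\<bar> powr m * k z"
      by (simp add: energy_density_def k_def)
    also have "\<dots> \<le> G1 z * indicator (E \<times> E) z +
      B powr m * (indicator K (fst z) * trunc_kernel (s * m) d (fst z - snd z) + indicator K (snd z) * trunc_kernel (s * m) d (fst z - snd z))"
    proof (rule pt)
      show "\<bar>\<phi> (fst z) - \<phi> (snd z)\<bar> powr m \<le> C * (\<bar>u (fst z) - u (snd z)\<bar> powr m + \<bar>W (fst z) - W (snd z)\<bar> powr m)"
        using order_trans[OF dphim mult_right_mono[of "2 powr m" C]] by (simp add: C_def)
      show "\<bar>\<phi> (fst z) - \<phi> (snd z)\<bar> powr m \<le> B powr m" using small[OF \<phi>B] s by (intro powr_mono2) auto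
    qed (use s in auto)
    finally show "\<bar>energy_density s m \<phi> z\<bar> \<le> G1 z * indicator (E \<times> E) z +
      B powr m * (indicator K (fst z) * trunc_kernel (s * m) d (fst z - snd z) + indicator K (snd z) * trunc_kernel (s * m) d (fst z - snd z))" .
  qed simp
  have gen: "integrable leb2 (\<lambda>z. signed_pow (f (fst z) - f (snd z)) (m - 1) * (\<phi> (fst z) - \<phi> (snd z)) / norm (fst z - snd z) powr (real DIM('a) + m * s))"
    if fm: "f \<in> borel_measurable lebesgue" and fB: "\<And>x. 0 \<le> f x" "\<And>x. f x \<le> B"
      and f: "\<And>x y. \<bar>f x - f y\<bar> powr m \<le> \<bar>u x - u y\<bar> powr m + \<bar>W x - W y\<bar> powr m" for f
  proof (rule near_far_integrable[OF measurable_frac_integrand[OF fm \<phi>m] G1m G1 G1f E K a d(1), of "B powr (m - 1) * B"])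
    fix z :: "'a \<times> 'a"
    let ?H = "\<lambda>z. \<bar>f (fst z) - f (snd z)\<bar> powr (m - 1) * \<bar>\<phi> (fst z) - \<phi> (snd z)\<bar>"
    have "\<bar>signed_pow (f (fst z) - f (snd z)) (m - 1) * (\<phi> (fst z) - \<phi> (snd z)) / norm (fst z - snd z) powr (real DIM('a) + m * s)\<bar> = ?H z * k z"
      by (simp add: k_def abs_mult abs_signed_pow mult.commute[of m s])
    also have "\<dots> \<le> G1 z * indicator (E \<times> E) z +
      B powr (m - 1) * B * (indicator K (fst z) * trunc_kernel (s * m) d (fst z - snd z) + indicator K (snd z) * trunc_kernel (s * m) d (fst z - snd z))"
    proof (rule pt)
      have "?H z \<le> \<bar>f (fst z) - f (snd z)\<bar> powr m + \<bar>\<phi> (fst z) - \<phi> (snd z)\<bar> powr m" using s by (intro powr_mult_le_add) auto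
      also have "\<dots> \<le> C * (\<bar>u (fst z) - u (snd z)\<bar> powr m + \<bar>W (fst z) - W (snd z)\<bar> powr m)"
        using f[of "fst z" "snd z"] dphim[of "fst z" "snd z"] by (simp add: C_def algebra_simps)
      finally show "?H z \<le> C * (\<bar>u (fst z) - u (snd z)\<bar> powr m + \<bar>W (fst z) - W (snd z)\<bar> powr m)" .
      show "?H z \<le> B powr (m - 1) * B" using small[OF \<phi>B] small[OF fB] s by (intro mult_mono powr_mono2) auto
    qed (use B in auto)
    finally show "\<bar>signed_pow (f (fst z) - f (snd z)) (m - 1) * (\<phi> (fst z) - \<phi> (snd z)) / norm (fst z - snd z) powr (real DIM('a) + m * s)\<bar> \<le> G1 z * indicator (E \<times> E) z +
      B powr (m - 1) * B * (indicator K (fst z) * trunc_kernel (s * m) d (fst z - snd z) + indicator K (snd z) * trunc_kernel (s * m) d (fst z - snd z))" .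
  qed (use B in simp)
  show "integrable leb2 (?I u)" using um uB by (rule gen) auto
  show "integrable leb2 (?I W)" using Wm WB by (rule gen) auto
qed


section \<open>The form of the barrier\<close>

lemma integral_lebesgue_translate:
  fixes g :: "'a::euclidean_space \<Rightarrow> real"
  assumes "g \<in> borel_measurable borel"
  shows "(LINT y|lebesgue. g y) = (LINT z|lborel. g (x + z))"
proof -
  have "(LINT y|lebesgue. g y) = (LINT y|lborel. g y)" using assms by (intro integral_completion) simp
  also have "\<dots> = (LINT y|distr lborel borel ((+) x). g y)" by (simp add: lborel_distr_plus)
  also have "\<dots> = (LINT z|lborel. g (x + z))" using assms by (intro integral_distr) auto
  finally show ?thesis .
qed

text \<open>Away from the diagonal the integrals converge absolutely, and antisymmetry in the two points turns the form
into \<open>2 * \<integral>\<phi> T\<close>, where \<open>T\<close> is the truncated operator of the barrier. Cutting the barrier at the level \<open>\<epsilon>\<close>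
only lowers the operator at points above that level: there \<open>W x\<close> is \<open>c\<close> times (profile minus \<open>\<epsilon>\<close>), while
elsewhere \<open>W\<close> is at least this. The level also bounds \<open>r\<^sup>2 - |x - z0|\<^sup>2\<close> from below, by \<open>\<epsilon> powr (1 / \<beta>)\<close>.\<close>

lemma barrier_truncated_form_bound:
  fixes s \<beta> m r :: real
  assumes s: "0 < s" "s \<le> \<beta>" "\<beta> < 1" and m: "1 < m" and r: "0 < r"
  obtains C where "0 < C"
    "\<And>(z0::'a::euclidean_space) c \<epsilon> \<phi> \<delta>. 0 < c \<Longrightarrow> 0 < \<epsilon> \<Longrightarrow> 0 < \<delta> \<Longrightarrow> integrable lebesgue \<phi> \<Longrightarrow> (\<And>x. 0 \<le> \<phi> x) \<Longrightarrow>
      (\<And>x. 0 < \<phi> x \<Longrightarrow> \<epsilon> \<le> ball_profile r \<beta> (x - z0) \<and> r / 2 \<le> norm (x - z0)) \<Longrightarrow>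
      (LINT z|leb2. signed_pow (c * max 0 (ball_profile r \<beta> (fst z - z0) - \<epsilon>) - c * max 0 (ball_profile r \<beta> (snd z - z0) - \<epsilon>)) (m - 1)
         * (\<phi> (fst z) - \<phi> (snd z)) * trunc_kernel (s * m) \<delta> (fst z - snd z))
      \<le> C * c powr (m - 1) * (1 + (\<epsilon> powr (1 / \<beta>)) powr (\<beta> * (m - 1) - m) * \<delta> powr (m * (1 - s))) * (LINT x|lebesgue. \<phi> x)"
proof -
  define n where "n = m - 1"
  have n: "0 < n" "n + 1 = m" using m by (simp_all add: n_def)
  have \<beta>: "0 < \<beta>" using s by linarith
  have a: "0 < s * m" using s m by simp
  obtain C where C: "0 < C" "\<And>(x::'a::euclidean_space) \<delta>. r / 2 \<le> norm x \<Longrightarrow> norm x < r \<Longrightarrow> 0 < \<delta> \<Longrightarrow>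
    (LINT z|lborel. signed_pow (ball_profile r \<beta> x - ball_profile r \<beta> (x + z)) n * trunc_kernel (s * m) \<delta> z)
    \<le> C * (1 + (r\<^sup>2 - (norm x)\<^sup>2) powr (\<beta> * n - m) * \<delta> powr (m * (1 - s)))"
    using ball_profile_operator_bound[OF s n(1) r, where 'a='a] unfolding n(2) by blast
  have "(LINT z|leb2. signed_pow (c * max 0 (ball_profile r \<beta> (fst z - z0) - \<epsilon>) - c * max 0 (ball_profile r \<beta> (snd z - z0) - \<epsilon>)) n
         * (\<phi> (fst z) - \<phi> (snd z)) * trunc_kernel (s * m) \<delta> (fst z - snd z))
      \<le> 2 * C * c powr n * (1 + (\<epsilon> powr (1 / \<beta>)) powr (\<beta> * n - m) * \<delta> powr (m * (1 - s))) * (LINT x|lebesgue. \<phi> x)"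
    if c: "0 < c" and \<epsilon>: "0 < \<epsilon>" and \<delta>: "0 < \<delta>" and \<phi>: "integrable lebesgue \<phi>" "\<And>x. 0 \<le> \<phi> x"
      and supp: "\<And>x. 0 < \<phi> x \<Longrightarrow> \<epsilon> \<le> ball_profile r \<beta> (x - z0) \<and> r / 2 \<le> norm (x - z0)"
    for z0 :: 'a and c \<epsilon> \<phi> \<delta>
  proof -
    let ?k = "trunc_kernel (s * m) \<delta> :: 'a \<Rightarrow> real"
    define W where "W = (\<lambda>x::'a. c * max 0 (ball_profile r \<beta> (x - z0) - \<epsilon>))"
    have Wm [measurable]: "W \<in> borel_measurable borel" unfolding W_def by measurable
    note WL = borel_measurable_lebesgue_of_borel[OF Wm]
    define M where "M = c * (r\<^sup>2) powr \<beta>"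
    have WB: "0 \<le> W x" "W x \<le> M" for x
      using c ball_profile_le[OF \<beta>, of r "x - z0"] r \<epsilon> by (auto simp: W_def M_def intro!: mult_left_mono)
    have Wd: "\<bar>W x - W y\<bar> \<le> M" for x y using WB[of x] WB[of y] by linarith
    have \<phi>m: "\<phi> \<in> borel_measurable lebesgue" using \<phi>(1) by (rule borel_measurable_integrable)
    define P where "P = (\<lambda>z. signed_pow (W (fst z) - W (snd z)) n * ?k (fst z - snd z))"
    have Pm: "P \<in> borel_measurable leb2"
      unfolding P_def using measurable_leb2_fst[OF WL] measurable_leb2_snd[OF WL] measurable_leb2_kernel[OF trunc_kernel_measurable, of "s * m" \<delta>]
      by measurable
    have Pb: "\<bar>P z\<bar> \<le> M powr n * ?k (fst z - snd z)" for z
      unfolding P_def abs_mult abs_signed_pow using Wd n trunc_kernel_nonneg by (intro mult_mono powr_mono2) (auto simp: trunc_kernel_nonneg)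
    have Panti: "P (y, x) = - P (x, y)" for x y
      unfolding P_def using signed_pow_minus[of "W x - W y" n] trunc_kernel_minus[of "s * m" \<delta> "x - y"] by simp
    have I1: "integrable leb2 (\<lambda>z. \<phi> (fst z) * P z)"
    proof (rule Bochner_Integration.integrable_bound[OF integrable_mult_right[OF integrable_fst_trunc_kernel[OF \<phi>(1) a \<delta>], of "M powr n"]])
      show "(\<lambda>z. \<phi> (fst z) * P z) \<in> borel_measurable leb2" using measurable_leb2_fst[OF \<phi>m] Pm by measurable
      have "norm (\<phi> (fst z) * P z) \<le> norm (M powr n * (\<phi> (fst z) * ?k (fst z - snd z)))" for z
        using mult_left_mono[OF Pb \<phi>(2)[of "fst z"], of z] \<phi>(2)[of "fst z"] trunc_kernel_nonneg[of "s * m" \<delta> "fst z - snd z"]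
        by (simp add: abs_mult mult_ac)
      then show "AE z in leb2. norm (\<phi> (fst z) * P z) \<le> norm (M powr n * (\<phi> (fst z) * ?k (fst z - snd z)))" by simp
    qed
    have swap: "(\<lambda>(x, y). \<phi> (fst (y, x)) * P (y, x)) = (\<lambda>z. - (\<phi> (snd z) * P z))"
    proof (rule ext)
      fix z :: "'a \<times> 'a"
      obtain x y where "z = (x, y)" by (cases z)
      then show "(case z of (x, y) \<Rightarrow> \<phi> (fst (y, x)) * P (y, x)) = - (\<phi> (snd z) * P z)"
        using Panti[of x y] by simp
    qed
    have I2: "integrable leb2 (\<lambda>z. \<phi> (snd z) * P z)"
      using lebesgue_pair.integrable_product_swap[OF I1] unfolding swap by simp
    have L2: "(LINT z|leb2. \<phi> (snd z) * P z) = - (LINT z|leb2. \<phi> (fst z) * P z)"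
      using lebesgue_pair.integral_product_swap[OF borel_measurable_integrable[OF I1]] unfolding swap by simp
    have "(LINT z|leb2. signed_pow (W (fst z) - W (snd z)) n * (\<phi> (fst z) - \<phi> (snd z)) * ?k (fst z - snd z))
      = (LINT z|leb2. \<phi> (fst z) * P z - \<phi> (snd z) * P z)"
      by (intro Bochner_Integration.integral_cong) (auto simp: P_def algebra_simps)
    also have "\<dots> = 2 * (LINT z|leb2. \<phi> (fst z) * P z)"
      using I1 I2 by (simp add: L2)
    also have "(LINT z|leb2. \<phi> (fst z) * P z) = (LINT x|lebesgue. LINT y|lebesgue. \<phi> x * P (x, y))"
      using lebesgue_pair.integral_fst'[OF I1] by simp
    also have "\<dots> \<le> (LINT x|lebesgue. \<phi> x * (c powr n * (C * (1 + (\<epsilon> powr (1 / \<beta>)) powr (\<beta> * n - m) * \<delta> powr (m * (1 - s))))))"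
    proof (rule integral_mono)
      show "integrable lebesgue (\<lambda>x. LINT y|lebesgue. \<phi> x * P (x, y))"
        using lebesgue_pair.integrable_fst'[OF I1] by simp
      show "integrable lebesgue (\<lambda>x. \<phi> x * (c powr n * (C * (1 + (\<epsilon> powr (1 / \<beta>)) powr (\<beta> * n - m) * \<delta> powr (m * (1 - s))))))"
        using \<phi>(1) by (rule integrable_mult_left)
      fix x :: 'a
      show "(LINT y|lebesgue. \<phi> x * P (x, y)) \<le> \<phi> x * (c powr n * (C * (1 + (\<epsilon> powr (1 / \<beta>)) powr (\<beta> * n - m) * \<delta> powr (m * (1 - s)))))"
      proof (cases "0 < \<phi> x")
        case False
        then have "\<phi> x = 0" using \<phi>(2)[of x] by linarith
        then show ?thesis by simp
      next
        case True
        note sx = supp[OF True]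
        let ?x = "x - z0"
        have "0 < max 0 (r\<^sup>2 - (norm ?x)\<^sup>2)"
        proof (rule ccontr)
          assume "\<not> 0 < max 0 (r\<^sup>2 - (norm ?x)\<^sup>2)"
          then have "max 0 (r\<^sup>2 - (norm ?x)\<^sup>2) = 0" by simp
          then have "ball_profile r \<beta> ?x = 0" using \<beta> unfolding ball_profile_def by simp
          then show False using sx \<epsilon> by simp
        qed
        then have h: "0 < r\<^sup>2 - (norm ?x)\<^sup>2" by simp
        have xr: "norm ?x < r" using h r by (simp add: power_less_imp_less_base)
        have "\<epsilon> powr (1 / \<beta>) \<le> ball_profile r \<beta> ?x powr (1 / \<beta>)" using sx \<epsilon> \<beta> by (intro powr_mono2) auto
        also have "\<dots> = r\<^sup>2 - (norm ?x)\<^sup>2" using h \<beta> by (simp add: ball_profile_def powr_powr)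
        finally have h0: "\<epsilon> powr (1 / \<beta>) \<le> r\<^sup>2 - (norm ?x)\<^sup>2" .
        have em: "\<beta> * n - m \<le> 0"
        proof -
          have "\<beta> * n \<le> 1 * n" using s n by (intro mult_right_mono) auto
          then show ?thesis using n by linarith
        qed
        define f where "f = (\<lambda>z. signed_pow (W x - W (x + z)) n * ?k z)"
        define f2 where "f2 = (\<lambda>z. signed_pow (ball_profile r \<beta> ?x - ball_profile r \<beta> (?x + z)) n * ?k z)"
        have fi: "integrable lborel f" unfolding f_def
        proof (rule integrable_bounded_times_kernel[OF _ _ a \<delta>])
          show "\<bar>signed_pow (W x - W (x + z)) n\<bar> \<le> M powr n" for z
            unfolding abs_signed_pow using Wd[of x "x + z"] n by (intro powr_mono2) simp_all
        qed measurable
        have f2i: "integrable lborel f2" unfolding f2_def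
        proof (rule integrable_bounded_times_kernel[OF _ _ a \<delta>])
          show "\<bar>signed_pow (ball_profile r \<beta> ?x - ball_profile r \<beta> (?x + z)) n\<bar> \<le> ((r\<^sup>2) powr \<beta>) powr n" for z
            unfolding abs_signed_pow using ball_profile_le[OF \<beta>, of r ?x] ball_profile_le[OF \<beta>, of r "?x + z"]
              ball_profile_nonneg[of r \<beta> ?x] ball_profile_nonneg[of r \<beta> "?x + z"] r n
            by (intro powr_mono2) auto
        qed measurable
        have "(LINT y|lebesgue. P (x, y)) = (LINT z|lborel. P (x, x + z))"
          unfolding P_def by (rule integral_lebesgue_translate) (simp, measurable)
        also have "\<dots> = (LINT z|lborel. f z)" by (simp add: P_def f_def trunc_kernel_minus)
        also have "\<dots> \<le> (LINT z|lborel. c powr n * f2 z)"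
        proof (rule integral_mono[OF fi integrable_mult_right[OF f2i]])
          fix z
          have "W x - W (x + z) \<le> c * (ball_profile r \<beta> ?x - ball_profile r \<beta> (?x + z))"
          proof -
            have "max 0 (ball_profile r \<beta> ?x - \<epsilon>) = ball_profile r \<beta> ?x - \<epsilon>" using sx by linarith
            then have "W x = c * (ball_profile r \<beta> ?x - \<epsilon>)" unfolding W_def by (simp only:)
            moreover have "c * (ball_profile r \<beta> (?x + z) - \<epsilon>) \<le> W (x + z)"
              unfolding W_def diff_add_eq[symmetric] using c by (intro mult_left_mono) auto
            ultimately show ?thesis by (simp add: right_diff_distrib)
          qed
          then have "signed_pow (W x - W (x + z)) n \<le> signed_pow (c * (ball_profile r \<beta> ?x - ball_profile r \<beta> (?x + z))) n"
            using n by (intro signed_pow_mono)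
          also have "\<dots> = c powr n * signed_pow (ball_profile r \<beta> ?x - ball_profile r \<beta> (?x + z)) n"
            using c by (intro signed_pow_mult) simp
          finally show "f z \<le> c powr n * f2 z"
            unfolding f_def f2_def mult.assoc[symmetric] by (intro mult_right_mono trunc_kernel_nonneg)
        qed
        also have "\<dots> = c powr n * (LINT z|lborel. f2 z)" by simp
        also have "\<dots> \<le> c powr n * (C * (1 + (r\<^sup>2 - (norm ?x)\<^sup>2) powr (\<beta> * n - m) * \<delta> powr (m * (1 - s))))"
          using C(2)[of ?x \<delta>] sx xr \<delta> unfolding f2_def by (intro mult_left_mono) auto
        also have "\<dots> \<le> c powr n * (C * (1 + (\<epsilon> powr (1 / \<beta>)) powr (\<beta> * n - m) * \<delta> powr (m * (1 - s))))"
          using C(1) h0 em \<epsilon> by (intro mult_left_mono add_left_mono mult_right_mono powr_mono2') auto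
        finally show ?thesis using \<phi>(2)[of x] by (simp add: mult_left_mono)
      qed
    qed
    also have "2 * (LINT x|lebesgue. \<phi> x * (c powr n * (C * (1 + (\<epsilon> powr (1 / \<beta>)) powr (\<beta> * n - m) * \<delta> powr (m * (1 - s))))))
      = 2 * C * c powr n * (1 + (\<epsilon> powr (1 / \<beta>)) powr (\<beta> * n - m) * \<delta> powr (m * (1 - s))) * (LINT x|lebesgue. \<phi> x)"
      by simp
    finally show ?thesis unfolding W_def by simp
  qed
  then show ?thesis using that[of "2 * C"] C(1) unfolding n_def by simp
qed

text \<open>The truncation error tends to \<open>0\<close> with \<open>\<delta>\<close> for fixed \<open>\<epsilon>\<close>, so the resulting constant depends neither on the
level \<open>\<epsilon>\<close> nor on \<open>\<phi>\<close>.\<close>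

lemma barrier_form_bound:
  fixes s \<beta> m r :: real
  assumes s: "0 < s" "s \<le> \<beta>" "\<beta> < 1" and m: "1 < m" and r: "0 < r"
  obtains C where "0 < C"
    "\<And>(z0::'a::euclidean_space) c \<epsilon> \<phi> W. 0 < c \<Longrightarrow> 0 < \<epsilon> \<Longrightarrow> integrable lebesgue \<phi> \<Longrightarrow> (\<And>x. 0 \<le> \<phi> x) \<Longrightarrow>
      (\<And>x. 0 < \<phi> x \<Longrightarrow> \<epsilon> \<le> ball_profile r \<beta> (x - z0) \<and> r / 2 \<le> norm (x - z0)) \<Longrightarrow>
      W = (\<lambda>x. c * max 0 (ball_profile r \<beta> (x - z0) - \<epsilon>)) \<Longrightarrow>
      integrable leb2 (\<lambda>z. signed_pow (W (fst z) - W (snd z)) (m - 1) * (\<phi> (fst z) - \<phi> (snd z)) / norm (fst z - snd z) powr (real DIM('a) + m * s)) \<Longrightarrow>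
      frac_form s m W \<phi> \<le> C * c powr (m - 1) * (LINT x|lebesgue. \<phi> x)"
proof -
  obtain C where C: "0 < C"
    "\<And>(z0::'a::euclidean_space) c \<epsilon> \<phi> \<delta>. 0 < c \<Longrightarrow> 0 < \<epsilon> \<Longrightarrow> 0 < \<delta> \<Longrightarrow> integrable lebesgue \<phi> \<Longrightarrow> (\<And>x. 0 \<le> \<phi> x) \<Longrightarrow>
      (\<And>x. 0 < \<phi> x \<Longrightarrow> \<epsilon> \<le> ball_profile r \<beta> (x - z0) \<and> r / 2 \<le> norm (x - z0)) \<Longrightarrow>
      (LINT z|leb2. signed_pow (c * max 0 (ball_profile r \<beta> (fst z - z0) - \<epsilon>) - c * max 0 (ball_profile r \<beta> (snd z - z0) - \<epsilon>)) (m - 1)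
         * (\<phi> (fst z) - \<phi> (snd z)) * trunc_kernel (s * m) \<delta> (fst z - snd z))
      \<le> C * c powr (m - 1) * (1 + (\<epsilon> powr (1 / \<beta>)) powr (\<beta> * (m - 1) - m) * \<delta> powr (m * (1 - s))) * (LINT x|lebesgue. \<phi> x)"
    using barrier_truncated_form_bound[OF s m r, where 'a='a] by blast
  have bound: "frac_form s m W \<phi> \<le> C * c powr (m - 1) * (LINT x|lebesgue. \<phi> x)"
    if c: "0 < c" and \<epsilon>: "0 < \<epsilon>" and \<phi>: "integrable lebesgue \<phi>" "\<And>x. 0 \<le> \<phi> x"
      and supp: "\<And>x. 0 < \<phi> x \<Longrightarrow> \<epsilon> \<le> ball_profile r \<beta> (x - z0) \<and> r / 2 \<le> norm (x - z0)"
      and W: "W = (\<lambda>x. c * max 0 (ball_profile r \<beta> (x - z0) - \<epsilon>))"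
      and int: "integrable leb2 (\<lambda>z. signed_pow (W (fst z) - W (snd z)) (m - 1) * (\<phi> (fst z) - \<phi> (snd z)) / norm (fst z - snd z) powr (real DIM('a) + m * s))"
    for z0 :: 'a and c \<epsilon> \<phi> W
  proof -
    define I where "I = (\<lambda>z. signed_pow (W (fst z) - W (snd z)) (m - 1) * (\<phi> (fst z) - \<phi> (snd z)) / norm (fst z - snd z) powr (real DIM('a) + m * s))"
    define \<delta> where "\<delta> = (\<lambda>k. 1 / real (Suc k))"
    have \<delta>: "0 < \<delta> k" for k by (simp add: \<delta>_def)
    define H where "H = (\<lambda>k z. signed_pow (W (fst z) - W (snd z)) (m - 1) * (\<phi> (fst z) - \<phi> (snd z)) * trunc_kernel (s * m) (\<delta> k) (fst z - snd z))"
    have HI: "H k z = I z * indicator {\<delta> k<..} (norm (fst z - snd z))" for k z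
      by (simp add: H_def I_def trunc_kernel_def mult.commute[of m s])
    have nm: "(\<lambda>z::'a \<times> 'a. norm (fst z - snd z)) \<in> borel_measurable leb2" by (intro measurable_leb2_kernel) simp
    have Im: "I \<in> borel_measurable leb2" using borel_measurable_integrable[OF int] unfolding I_def .
    have Hm: "H k \<in> borel_measurable leb2" for k
    proof -
      have "(\<lambda>z. I z * (if \<delta> k < norm (fst z - snd z) then 1 else 0)) \<in> borel_measurable leb2"
        using nm Im by measurable
      then show ?thesis unfolding HI[abs_def] by (simp add: indicator_def of_bool_def)
    qed
    have "(\<lambda>k. LINT z|leb2. H k z) \<longlonglongrightarrow> (LINT z|leb2. I z)"
    proof (rule integral_dominated_convergence[where w = "\<lambda>z. \<bar>I z\<bar>"])
      show "integrable leb2 (\<lambda>z. \<bar>I z\<bar>)" using int unfolding I_def by (rule integrable_abs)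
      show "AE z in leb2. norm (H k z) \<le> \<bar>I z\<bar>" for k by (auto simp: HI abs_mult indicator_def)
      have "(\<lambda>k. H k z) \<longlonglongrightarrow> I z" for z
      proof (cases "fst z = snd z")
        case True
        then show ?thesis by (simp add: HI I_def)
      next
        case False
        then have "0 < norm (fst z - snd z)" by simp
        moreover have "\<delta> \<longlonglongrightarrow> 0" unfolding \<delta>_def by (rule LIMSEQ_inverse_real_of_nat[unfolded inverse_eq_divide])
        ultimately have "eventually (\<lambda>k. \<delta> k < norm (fst z - snd z)) sequentially" by (intro order_tendstoD)
        then have "eventually (\<lambda>k. H k z = I z) sequentially" by eventually_elim (simp add: HI)
        then show ?thesis by (rule tendsto_eventually)
      qed
      then show "AE z in leb2. (\<lambda>k. H k z) \<longlonglongrightarrow> I z" by simp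
    qed (use Im Hm in auto)
    moreover have "(\<lambda>k. C * c powr (m - 1) * (1 + (\<epsilon> powr (1 / \<beta>)) powr (\<beta> * (m - 1) - m) * \<delta> k powr (m * (1 - s))) * (LINT x|lebesgue. \<phi> x))
       \<longlonglongrightarrow> C * c powr (m - 1) * (1 + (\<epsilon> powr (1 / \<beta>)) powr (\<beta> * (m - 1) - m) * 0) * (LINT x|lebesgue. \<phi> x)"
    proof -
      have "\<delta> \<longlonglongrightarrow> 0" unfolding \<delta>_def by (rule LIMSEQ_inverse_real_of_nat[unfolded inverse_eq_divide])
      then have "(\<lambda>k. \<delta> k powr (m * (1 - s))) \<longlonglongrightarrow> 0 powr (m * (1 - s))"
        using s m \<delta> by (intro tendsto_powr2 tendsto_const) (auto intro!: always_eventually less_imp_le)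
      then have "(\<lambda>k. \<delta> k powr (m * (1 - s))) \<longlonglongrightarrow> 0" by simp
      then show ?thesis by (intro tendsto_intros)
    qed
    moreover have "(LINT z|leb2. H k z) \<le> C * c powr (m - 1) * (1 + (\<epsilon> powr (1 / \<beta>)) powr (\<beta> * (m - 1) - m) * \<delta> k powr (m * (1 - s))) * (LINT x|lebesgue. \<phi> x)" for k
      unfolding H_def W using C(2)[OF c \<epsilon> \<delta> \<phi> supp] by simp
    ultimately have "(LINT z|leb2. I z) \<le> C * c powr (m - 1) * (1 + (\<epsilon> powr (1 / \<beta>)) powr (\<beta> * (m - 1) - m) * 0) * (LINT x|lebesgue. \<phi> x)"
      by (intro LIMSEQ_le) auto
    then show ?thesis unfolding frac_form_def I_def by simp
  qed
  show ?thesis by (rule that[OF C(1) bound])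
qed

text \<open>Cutting at a positive level avoids the singularity of \<open>t powr \<beta>\<close> at \<open>0\<close>. This gives the barrier finite energy
over bounded sets and puts its support inside the open ball.\<close>

lemma profile_lipschitz:
  fixes c \<epsilon> r \<beta> :: real and z0 :: "'a::euclidean_space"
  assumes "0 < c" "0 < \<epsilon>" "0 < r" "0 < \<beta>" "\<beta> \<le> 1"
  obtains L where "\<And>x y. \<bar>c * max 0 (ball_profile r \<beta> (x - z0) - \<epsilon>) - c * max 0 (ball_profile r \<beta> (y - z0) - \<epsilon>)\<bar> \<le> L * norm (x - y)"
proof
  define t0 where "t0 = \<epsilon> powr (1 / \<beta>)"
  have t0: "0 < t0" "t0 powr \<beta> = \<epsilon>" using assms by (simp_all add: t0_def powr_powr)
  have cut: "max 0 (t powr \<beta> - \<epsilon>) = max t t0 powr \<beta> - \<epsilon>" if "0 \<le> t" for t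
  proof (cases "t \<le> t0")
    case True
    then have "t powr \<beta> \<le> \<epsilon>" using that t0 assms powr_mono2[of \<beta> t t0] by simp
    then show ?thesis using True t0 by (simp add: max_def)
  next
    case False
    then have "\<epsilon> \<le> t powr \<beta>" using that t0 assms powr_mono2[of \<beta> t0 t] by simp
    then show ?thesis using False by (simp add: max_def)
  qed
  have inc: "b powr \<beta> - a powr \<beta> \<le> t0 powr (\<beta> - 1) * (b - a)" if "t0 \<le> a" "a \<le> b" for a b
  proof -
    have "b powr \<beta> - a powr \<beta> \<le> a powr (\<beta> - 1) * (b - a)"
    proof -
      have a0: "0 < a" using that t0 by linarith
      have "(b / a) powr \<beta> \<le> 1 + \<beta> * (b / a - 1)" using a0 that assms by (intro powr_le_affine) auto
      also have "\<dots> \<le> 1 + 1 * (b / a - 1)" using a0 that assms by (intro add_left_mono mult_right_mono) auto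
      finally have "a powr \<beta> * (b / a) powr \<beta> \<le> a powr \<beta> * (b / a)" by (intro mult_left_mono) auto
      moreover have "a powr \<beta> * (b / a) powr \<beta> = b powr \<beta>" using a0 that by (simp add: powr_divide)
      moreover have "a powr \<beta> * (b / a) = a powr (\<beta> - 1) * b" using a0 by (simp add: powr_diff)
      moreover have "a powr \<beta> = a powr (\<beta> - 1) * a" using a0 by (simp add: powr_diff)
      ultimately show ?thesis by (simp add: right_diff_distrib)
    qed
    also have "\<dots> \<le> t0 powr (\<beta> - 1) * (b - a)"
      using that t0 assms by (intro mult_right_mono powr_mono2') auto
    finally show ?thesis .
  qed
  have incabs: "\<bar>b powr \<beta> - a powr \<beta>\<bar> \<le> t0 powr (\<beta> - 1) * \<bar>b - a\<bar>" if "t0 \<le> a" "t0 \<le> b" for a b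
    using inc[of a b] inc[of b a] that assms powr_mono2[of \<beta> a b] powr_mono2[of \<beta> b a] t0 by (cases "a \<le> b") auto
  fix x y :: 'a
  define X where "X = max 0 (r\<^sup>2 - (norm (x - z0))\<^sup>2)"
  define Y where "Y = max 0 (r\<^sup>2 - (norm (y - z0))\<^sup>2)"
  have XY: "\<bar>X - Y\<bar> \<le> 2 * r * norm (x - y)"
  proof -
    define a b where "a = min r (norm (x - z0))" and "b = min r (norm (y - z0))"
    have mm: "max 0 (r\<^sup>2 - t\<^sup>2) = r\<^sup>2 - (min r t)\<^sup>2" if "0 \<le> t" for t
      using that assms power_mono[of r t 2] power_mono[of t r 2] by (auto simp: min_def max_def)
    have "\<bar>X - Y\<bar> = \<bar>a\<^sup>2 - b\<^sup>2\<bar>" by (simp add: X_def Y_def mm a_def b_def abs_minus_commute)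
    also have "\<dots> = \<bar>a + b\<bar> * \<bar>a - b\<bar>" by (simp add: power2_eq_square abs_mult[symmetric] algebra_simps)
    also have "\<dots> \<le> (2 * r) * norm (x - y)"
    proof (rule mult_mono)
      show "\<bar>a + b\<bar> \<le> 2 * r" using assms by (auto simp: a_def b_def min_def)
      have "\<bar>norm (x - z0) - norm (y - z0)\<bar> \<le> norm (x - y)" using norm_triangle_ineq3[of "x - z0" "y - z0"] by simp
      then show "\<bar>a - b\<bar> \<le> norm (x - y)" by (auto simp: a_def b_def min_def)
    qed (use assms in auto)
    finally show ?thesis .
  qed
  have "\<bar>c * max 0 (ball_profile r \<beta> (x - z0) - \<epsilon>) - c * max 0 (ball_profile r \<beta> (y - z0) - \<epsilon>)\<bar>
     = c * \<bar>max X t0 powr \<beta> - max Y t0 powr \<beta>\<bar>"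
    using assms unfolding ball_profile_def X_def[symmetric] Y_def[symmetric]
    by (subst cut, simp add: X_def, subst cut, simp add: Y_def, simp add: right_diff_distrib[symmetric] abs_mult)
  also have "\<dots> \<le> c * (t0 powr (\<beta> - 1) * \<bar>max X t0 - max Y t0\<bar>)" using assms by (intro mult_left_mono incabs) auto
  also have "\<dots> \<le> c * (t0 powr (\<beta> - 1) * (2 * r * norm (x - y)))"
  proof -
    have "\<bar>max X t0 - max Y t0\<bar> \<le> \<bar>X - Y\<bar>" by (auto simp: max_def)
    then show ?thesis using XY assms by (intro mult_left_mono) auto
  qed
  finally show "\<bar>c * max 0 (ball_profile r \<beta> (x - z0) - \<epsilon>) - c * max 0 (ball_profile r \<beta> (y - z0) - \<epsilon>)\<bar> \<le> (c * t0 powr (\<beta> - 1) * 2 * r) * norm (x - y)"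
    by (simp add: mult_ac)
qed


section \<open>Comparison with the barrier in an interior ball\<close>

lemma frac_form_cong_AE:
  fixes u v \<phi> :: "'a::euclidean_space \<Rightarrow> real"
  assumes m: "u \<in> borel_measurable lebesgue" "v \<in> borel_measurable lebesgue" "\<phi> \<in> borel_measurable lebesgue"
    and ae: "AE x in lebesgue. u x = v x"
  shows "frac_form s l u \<phi> = frac_form s l v \<phi>"
proof -
  have 1: "AE z in leb2. u (fst z) = v (fst z)"
  proof (rule lebesgue_pair.AE_pair_measure)
    show "{z \<in> space leb2. u (fst z) = v (fst z)} \<in> sets leb2"
      using measurable_leb2_fst[OF m(1)] measurable_leb2_fst[OF m(2)] by measurable
    show "AE x in lebesgue. AE y in lebesgue. u (fst (x, y)) = v (fst (x, y))" using ae by eventually_elim simp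
  qed
  have 2: "AE z in leb2. u (snd z) = v (snd z)"
  proof (rule lebesgue_pair.AE_pair_measure)
    show "{z \<in> space leb2. u (snd z) = v (snd z)} \<in> sets leb2"
      using measurable_leb2_snd[OF m(1)] measurable_leb2_snd[OF m(2)] by measurable
    show "AE x in lebesgue. AE y in lebesgue. u (snd (x, y)) = v (snd (x, y))" using ae by simp
  qed
  show ?thesis unfolding frac_form_def
  proof (rule integral_cong_AE)
    show "AE z in leb2. signed_pow (u (fst z) - u (snd z)) (l - 1) * (\<phi> (fst z) - \<phi> (snd z)) / norm (fst z - snd z) powr (real DIM('a) + l * s) =
      signed_pow (v (fst z) - v (snd z)) (l - 1) * (\<phi> (fst z) - \<phi> (snd z)) / norm (fst z - snd z) powr (real DIM('a) + l * s)"
      using 1 2 by eventually_elim simp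
  qed (use m in \<open>auto intro!: measurable_frac_integrand\<close>)
qed

lemma integral_product:
  fixes f h :: "'a::euclidean_space \<Rightarrow> real"
  assumes f: "integrable lebesgue f" and h: "integrable lebesgue h"
  shows "integrable leb2 (\<lambda>z. f (fst z) * h (snd z))"
    and "(LINT z|leb2. f (fst z) * h (snd z)) = (LINT x|lebesgue. f x) * (LINT x|lebesgue. h x)"
proof -
  show int: "integrable leb2 (\<lambda>z. f (fst z) * h (snd z))"
  proof (rule lebesgue_pair.Fubini_integrable)
    show "(\<lambda>z. f (fst z) * h (snd z)) \<in> borel_measurable leb2"
      using measurable_leb2_fst[OF borel_measurable_integrable[OF f]] measurable_leb2_snd[OF borel_measurable_integrable[OF h]]
      by measurable
    have "integrable lebesgue (\<lambda>x. \<bar>f x\<bar> * (LINT y|lebesgue. \<bar>h y\<bar>))" using f by (intro integrable_mult_left integrable_abs)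
    then show "integrable lebesgue (\<lambda>x. LINT y|lebesgue. norm (f (fst (x, y)) * h (snd (x, y))))"
      by (simp add: abs_mult)
    show "AE x in lebesgue. integrable lebesgue (\<lambda>y. f (fst (x, y)) * h (snd (x, y)))" using h by simp
  qed
  show "(LINT z|leb2. f (fst z) * h (snd z)) = (LINT x|lebesgue. f x) * (LINT x|lebesgue. h x)"
    using lebesgue_pair.integral_fst'[OF int] by simp
qed

text \<open>The monotonicity of the operators: if the positive part of \<open>c - a\<close> exceeds that of \<open>d - b\<close>, then
\<open>c - a > d - b\<close>, so \<open>c - d > a - b\<close>.\<close>

lemma truncation_monotone:
  fixes a b c d n :: real
  assumes "0 < n"
  shows "(signed_pow (a - b) n - signed_pow (c - d) n) * (max 0 (c - a) - max 0 (d - b)) \<le> 0"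
proof (cases "max 0 (c - a) \<ge> max 0 (d - b)")
  case True
  show ?thesis
  proof (cases "max 0 (c - a) = max 0 (d - b)")
    case False
    then have "a - b \<le> c - d" using True by (auto simp: max_def split: if_splits)
    from signed_pow_mono[OF assms this] show ?thesis using True by (intro mult_nonpos_nonneg) linarith+
  qed simp
next
  case False
  then have "c - d \<le> a - b" by (auto simp: max_def split: if_splits)
  from signed_pow_mono[OF assms this] show ?thesis using False by (intro mult_nonneg_nonpos) linarith+
qed

lemma exists_small_coefficient:
  fixes A M Cp Cq p q \<kappa> \<delta> \<eta> \<eta>' :: real
  assumes "0 < M" "1 < p" "1 < q" "0 < \<kappa>" "0 < \<delta>" "0 < \<eta>" "0 < \<eta>'"
  obtains c where "0 < c" "c * M \<le> \<eta>" "c * M < \<delta>" "(c * M) powr (p - 1) \<le> \<eta>'" "Cp * c powr (p - 1) \<le> \<kappa>" "Cq * c powr (q - 1) \<le> \<kappa>"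
proof -
  have pw: "((\<lambda>c::real. c powr e) \<longlongrightarrow> 0) (at_right 0)" if "0 < e" for e :: real
  proof -
    have "((\<lambda>c::real. c powr e) \<longlongrightarrow> 0 powr e) (at_right 0)"
      using that by (intro tendsto_powr2 tendsto_const tendsto_ident_at) (auto simp: eventually_at_filter)
    then show ?thesis by simp
  qed
  have lin: "((\<lambda>c::real. c * M) \<longlongrightarrow> 0) (at_right 0)"
  proof -
    have "((\<lambda>c::real. c * M) \<longlongrightarrow> 0 * M) (at_right 0)" by (intro tendsto_intros)
    then show ?thesis by simp
  qed
  have e1: "\<forall>\<^sub>F c in at_right 0. c * M < \<eta>" by (rule order_tendstoD(2)[OF lin assms(6)])
  have e2: "\<forall>\<^sub>F c in at_right 0. c * M < \<delta>" by (rule order_tendstoD(2)[OF lin assms(5)])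
  have e3: "\<forall>\<^sub>F c in at_right 0. M powr (p - 1) * c powr (p - 1) < \<eta>'"
    using assms by (intro order_tendstoD(2)[OF tendsto_mult_right_zero[OF pw]]) auto
  have e4: "\<forall>\<^sub>F c in at_right 0. Cp * c powr (p - 1) < \<kappa>"
    using assms by (intro order_tendstoD(2)[OF tendsto_mult_right_zero[OF pw]]) auto
  have e5: "\<forall>\<^sub>F c in at_right 0. Cq * c powr (q - 1) < \<kappa>"
    using assms by (intro order_tendstoD(2)[OF tendsto_mult_right_zero[OF pw]]) auto
  have e6: "\<forall>\<^sub>F c in at_right 0. (0::real) < c" by (simp add: eventually_at_filter)
  have "\<forall>\<^sub>F c in at_right 0. 0 < c \<and> c * M \<le> \<eta> \<and> c * M < \<delta> \<and> (c * M) powr (p - 1) \<le> \<eta>' \<and> Cp * c powr (p - 1) \<le> \<kappa> \<and> Cq * c powr (q - 1) \<le> \<kappa>"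
    using e1 e2 e3 e4 e5 e6 by eventually_elim (use assms in \<open>auto simp: powr_mult mult.commute\<close>)
  then obtain c where "0 < c \<and> c * M \<le> \<eta> \<and> c * M < \<delta> \<and> (c * M) powr (p - 1) \<le> \<eta>' \<and> Cp * c powr (p - 1) \<le> \<kappa> \<and> Cq * c powr (q - 1) \<le> \<kappa>"
    using eventually_happens'[OF trivial_limit_at_right_real] by blast
  then show ?thesis using that by blast
qed

text \<open>The comparison argument described at the top. The constant \<open>c\<close> depends on \<open>r\<close> and \<open>\<eta>\<close> but not on the centre,
which is essential near the boundary. The argument is run with the barrier cut at a level \<open>\<epsilon> > 0\<close>, so that
\<open>\<phi>\<close> is an admissible test function, and \<open>\<epsilon>\<close> tends to \<open>0\<close> at the end.\<close>

lemma interior_ball_lower_bound: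
  fixes \<Omega> :: "'a::euclidean_space set" and p q s1 s2 r \<eta> :: real and g :: "real \<Rightarrow> real" and u :: "'a \<Rightarrow> real"
  assumes \<Omega>: "open \<Omega>" "bounded \<Omega>" and e: "1 < q" "q \<le> p" "0 < s2" "s2 \<le> s1" "s1 < 1"
    and g: "continuous_on UNIV g" and u: "u \<in> frac_Sobolev_0 \<Omega> s1 p" "continuous_on (closure \<Omega>) u"
    and weak: "weak_supersolution s1 p s2 q g \<Omega> u" and u0: "\<And>x. x \<in> \<Omega> \<Longrightarrow> 0 \<le> u x"
    and r: "0 < r" and \<eta>: "0 < \<eta>"
  obtains c where "0 < c" "\<And>z0 x. ball z0 r \<subseteq> \<Omega> \<Longrightarrow> (\<And>y. y \<in> cball z0 (r / 2) \<Longrightarrow> 2 * \<eta> \<le> u y) \<Longrightarrow>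
     x \<in> ball z0 r \<Longrightarrow> c * ball_profile r s1 (x - z0) \<le> u x"
proof -
  let ?N = "real DIM('a)"
  have p: "1 < p" and s1: "0 < s1" using e by auto
  obtain Cp where Cp: "0 < Cp"
    "\<And>(z0::'a) c \<epsilon> \<phi> W. 0 < c \<Longrightarrow> 0 < \<epsilon> \<Longrightarrow> integrable lebesgue \<phi> \<Longrightarrow> (\<And>x. 0 \<le> \<phi> x) \<Longrightarrow>
      (\<And>x. 0 < \<phi> x \<Longrightarrow> \<epsilon> \<le> ball_profile r s1 (x - z0) \<and> r / 2 \<le> norm (x - z0)) \<Longrightarrow>
      W = (\<lambda>x. c * max 0 (ball_profile r s1 (x - z0) - \<epsilon>)) \<Longrightarrow>
      integrable leb2 (\<lambda>z. signed_pow (W (fst z) - W (snd z)) (p - 1) * (\<phi> (fst z) - \<phi> (snd z)) / norm (fst z - snd z) powr (?N + p * s1)) \<Longrightarrow>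
      frac_form s1 p W \<phi> \<le> Cp * c powr (p - 1) * (LINT x|lebesgue. \<phi> x)"
  proof (rule barrier_form_bound[OF s1 order_refl e(5) p r, where 'a='a], goal_cases)
    case (1 C)
    show ?case by (rule 1(1)[OF 1(2,3)])
  qed
  obtain Cq where Cq: "0 < Cq"
    "\<And>(z0::'a) c \<epsilon> \<phi> W. 0 < c \<Longrightarrow> 0 < \<epsilon> \<Longrightarrow> integrable lebesgue \<phi> \<Longrightarrow> (\<And>x. 0 \<le> \<phi> x) \<Longrightarrow>
      (\<And>x. 0 < \<phi> x \<Longrightarrow> \<epsilon> \<le> ball_profile r s1 (x - z0) \<and> r / 2 \<le> norm (x - z0)) \<Longrightarrow>
      W = (\<lambda>x. c * max 0 (ball_profile r s1 (x - z0) - \<epsilon>)) \<Longrightarrow>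
      integrable leb2 (\<lambda>z. signed_pow (W (fst z) - W (snd z)) (q - 1) * (\<phi> (fst z) - \<phi> (snd z)) / norm (fst z - snd z) powr (?N + q * s2)) \<Longrightarrow>
      frac_form s2 q W \<phi> \<le> Cq * c powr (q - 1) * (LINT x|lebesgue. \<phi> x)"
  proof (rule barrier_form_bound[OF e(3,4,5,1) r, where 'a='a], goal_cases)
    case (1 C)
    show ?case by (rule 1(1)[OF 1(2,3)])
  qed
  define M where "M = (r\<^sup>2) powr s1"
  have M: "0 < M" using r by (simp add: M_def)
  define V where "V = unit_ball_vol ?N * (r / 2) ^ DIM('a)"
  have V: "0 < V" using r by (simp add: V_def)
  have VB: "measure lebesgue (cball z0 (r / 2)) = V" for z0 :: 'a
    using content_cball[of "r / 2" z0] r by (simp add: V_def)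
  define \<kappa>0 where "\<kappa>0 = \<eta> powr (p - 1) / 2 / (2 * r) powr (?N + p * s1)"
  have \<kappa>0: "0 < \<kappa>0" using \<eta> r by (simp add: \<kappa>0_def)
  define \<kappa> where "\<kappa> = 2 * \<kappa>0 * V"
  have \<kappa>: "0 < \<kappa>" using \<kappa>0 V by (simp add: \<kappa>_def)
  obtain \<delta>g where \<delta>g: "0 < \<delta>g" "\<And>t. \<bar>t\<bar> < \<delta>g \<Longrightarrow> \<bar>g t - g 0\<bar> < \<kappa> / 4"
  proof -
    have "isCont g 0" using g by (simp add: continuous_on_eq_continuous_at)
    then obtain d where "0 < d" "\<And>t. dist t 0 < d \<Longrightarrow> dist (g t) (g 0) < \<kappa> / 4"
      using \<kappa> unfolding continuous_at_eps_delta by (metis divide_pos_pos zero_less_numeral)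
    then show ?thesis using that by (simp add: dist_real_def)
  qed
  \<comment> \<open>\<open>M\<close> is the maximum of the profile. Each of the three error terms is given a quarter of \<open>\<kappa>\<close>.\<close>
  obtain c where c: "0 < c" "c * M \<le> \<eta>" "c * M < \<delta>g" "(c * M) powr (p - 1) \<le> \<eta> powr (p - 1) / 2"
    "Cp * c powr (p - 1) \<le> \<kappa> / 4" "Cq * c powr (q - 1) \<le> \<kappa> / 4"
    using exists_small_coefficient[OF M p e(1), of "\<kappa> / 4" \<delta>g \<eta> "\<eta> powr (p - 1) / 2" Cp Cq] \<kappa> \<delta>g \<eta> by auto
  have um: "u \<in> borel_measurable lebesgue" and uae: "AE x in lebesgue. x \<notin> \<Omega> \<longrightarrow> u x = 0"
    using u(1) by (auto simp: frac_Sobolev_0_def frac_Sobolev_def L_space_def)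
  have \<Omega>L: "\<Omega> \<in> sets lebesgue" using \<Omega>(1) by simp
  obtain B0 where B0: "\<And>x. x \<in> \<Omega> \<Longrightarrow> u x \<le> B0"
  proof -
    have "compact (closure \<Omega>)" using \<Omega>(2) by (simp add: compact_closure)
    then have "bounded (u ` closure \<Omega>)" using u(2) by (intro compact_imp_bounded compact_continuous_image)
    then obtain b where "\<forall>x\<in>closure \<Omega>. norm (u x) \<le> b" by (auto simp: bounded_iff)
    then show ?thesis using that[of b] closure_subset[of \<Omega>] by fastforce
  qed
  \<comment> \<open>\<open>u\<close> vanishes outside \<open>\<Omega>\<close> only almost everywhere; \<open>v\<close> is the representative that vanishes everywhere there.\<close>
  define v where "v = (\<lambda>x. if x \<in> \<Omega> then u x else 0)"
  have vm: "v \<in> borel_measurable lebesgue" unfolding v_def using um \<Omega>L by measurable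
  have vae: "AE x in lebesgue. u x = v x" using uae by eventually_elim (auto simp: v_def)
  have v0: "0 \<le> v x" for x using u0 by (simp add: v_def)
  have key: "c * max 0 (ball_profile r s1 (x1 - z0) - \<epsilon>) \<le> u x1"
    if ball: "ball z0 r \<subseteq> \<Omega>" and big: "\<And>y. y \<in> cball z0 (r / 2) \<Longrightarrow> 2 * \<eta> \<le> u y" and x1: "x1 \<in> ball z0 r" and \<epsilon>: "0 < \<epsilon>"
    for z0 x1 \<epsilon>
  proof -
    define W where "W = (\<lambda>x. c * max 0 (ball_profile r s1 (x - z0) - \<epsilon>))"
    define \<phi> where "\<phi> = (\<lambda>x. max 0 (W x - v x))"
    define K where "K = {x. \<epsilon> \<le> ball_profile r s1 (x - z0)}"
    define B' where "B' = cball z0 (r / 2)"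
    have cprof: "continuous_on UNIV (\<lambda>x. ball_profile r s1 (x - z0))"
      using continuous_ball_profile[OF s1, of r] by (rule continuous_on_compose2) (auto intro!: continuous_intros)
    have Wcont: "continuous_on UNIV W" unfolding W_def using cprof by (intro continuous_intros)
    have Wb: "W \<in> borel_measurable borel" using Wcont by (rule borel_measurable_continuous_onI)
    note Wm = borel_measurable_lebesgue_of_borel[OF Wb]
    have W0: "0 \<le> W x" "W x \<le> c * M" for x
      using c(1) ball_profile_le[OF s1, of r "x - z0"] r \<epsilon> by (auto simp: W_def M_def intro!: mult_left_mono)
    have \<phi>m: "\<phi> \<in> borel_measurable lebesgue" unfolding \<phi>_def using Wm vm by measurable
    have \<phi>0: "0 \<le> \<phi> x" "\<phi> x \<le> c * M" for x using W0[of x] v0[of x] c M by (auto simp: \<phi>_def)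
    have Kball: "K \<subseteq> ball z0 r"
    proof
      fix x assume "x \<in> K"
      then have "ball_profile r s1 (x - z0) \<noteq> 0" using \<epsilon> by (auto simp: K_def)
      then have "max 0 (r\<^sup>2 - (norm (x - z0))\<^sup>2) \<noteq> 0" unfolding ball_profile_def by auto
      then have "(norm (x - z0))\<^sup>2 < r\<^sup>2" by (auto simp: max_def split: if_splits)
      then have "norm (x - z0) < r" using r by (simp add: power_less_imp_less_base)
      then show "x \<in> ball z0 r" by (simp add: dist_norm norm_minus_commute)
    qed
    have Kclosed: "closed K"
      unfolding K_def using cprof by (intro closed_Collect_le continuous_intros) 
    have Kcomp: "compact K" using Kclosed Kball bounded_ball bounded_subset compact_eq_bounded_closed by blast
    have K\<Omega>: "K \<subseteq> \<Omega>" using Kball ball by blast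
    have \<phi>pos: "x \<in> K \<and> v x < W x" if "0 < \<phi> x" for x
    proof -
      have "v x < W x" using that by (simp add: \<phi>_def max_def split: if_splits)
      moreover have "0 < max 0 (ball_profile r s1 (x - z0) - \<epsilon>)"
      proof (rule ccontr)
        assume "\<not> ?thesis"
        then have "W x = 0" by (simp add: W_def)
        then show False using \<open>v x < W x\<close> v0[of x] by simp
      qed
      ultimately show ?thesis by (auto simp: K_def)
    qed
    have \<phi>K: "\<phi> x = 0" if "x \<notin> K" for x using \<phi>pos[of x] that \<phi>0(1)[of x] by force
    have B'\<Omega>: "B' \<subseteq> \<Omega>" using ball r by (force simp: B'_def)
    have \<phi>B: "\<phi> y = 0" "2 * \<eta> \<le> v y" if "y \<in> B'" for y
    proof -
      show "2 * \<eta> \<le> v y" using that big[of y] B'\<Omega> by (auto simp: v_def B'_def)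
      then show "\<phi> y = 0" using W0(2)[of y] c(2) \<eta> by (simp add: \<phi>_def)
    qed
    have supp: "\<epsilon> \<le> ball_profile r s1 (x - z0) \<and> r / 2 \<le> norm (x - z0)" if "0 < \<phi> x" for x
    proof -
      have "x \<notin> B'" using \<phi>B(1)[of x] that by auto
      then show ?thesis using \<phi>pos[OF that] by (auto simp: B'_def K_def dist_norm norm_minus_commute)
    qed
    obtain d where d: "0 < d" "(\<Union>x\<in>K. cball x d) \<subseteq> \<Omega>"
      using compact_subset_open_imp_cball_epsilon_subset[OF Kcomp \<Omega>(1) K\<Omega>] by blast
    define E where "E = {x + y |x y. x \<in> K \<and> y \<in> cball 0 d}"
    have Ecomp: "compact E" unfolding E_def using Kcomp by (intro compact_sums) auto
    have EL: "E \<in> sets lebesgue" using compact_imp_closed[OF Ecomp] by simp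
    have KL: "K \<in> sets lebesgue" using Kclosed by simp
    have Kbd: "bounded K" using Kcomp by (rule compact_imp_bounded)
    have nearE: "y \<in> E" if "x \<in> K" "norm (x - y) \<le> d" for x y
      unfolding E_def using that by (intro CollectI exI[of _ x] exI[of _ "y - x"]) (auto simp: dist_norm norm_minus_commute)
    have E\<Omega>: "E \<subseteq> \<Omega>"
    proof
      fix y assume "y \<in> E"
      then obtain a b where "y = a + b" "a \<in> K" "norm b \<le> d" by (auto simp: E_def)
      then have "y \<in> cball a d" by (simp add: dist_norm)
      then show "y \<in> \<Omega>" using \<open>a \<in> K\<close> d(2) by blast
    qed
    have uE: "u \<in> W_space s1 p s2 q E"
    proof -
      have "u \<in> W_loc s1 p s2 q \<Omega>" using weak by (simp only: weak_supersolution_def)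
      then have "compact (closure E) \<and> closure E \<subseteq> \<Omega> \<longrightarrow> u \<in> W_space s1 p s2 q E"
        using EL unfolding W_loc_def by blast
      then show ?thesis using Ecomp E\<Omega> compact_imp_closed[OF Ecomp] by simp
    qed
    have ev: "(\<integral>\<^sup>+z. ennreal (energy_density s1 p v z * indicator (E \<times> E) z) \<partial>leb2) < \<infinity>"
       "(\<integral>\<^sup>+z. ennreal (energy_density s2 q v z * indicator (E \<times> E) z) \<partial>leb2) < \<infinity>"
      using uE gagliardo_energy_eq[OF EL vm, of u] E\<Omega> by (auto simp: W_space_def frac_Sobolev_def v_def subset_iff)
    obtain L where L: "\<And>x y. \<bar>W x - W y\<bar> \<le> L * norm (x - y)"
      using profile_lipschitz[OF c(1) \<epsilon> r s1 less_imp_le[OF e(5)], of z0] unfolding W_def by blast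
    have eW: "(\<integral>\<^sup>+z. ennreal (energy_density s1 p W z * indicator (E \<times> E) z) \<partial>leb2) < \<infinity>"
       "(\<integral>\<^sup>+z. ennreal (energy_density s2 q W z * indicator (E \<times> E) z) \<partial>leb2) < \<infinity>"
      using lipschitz_energy_finite[OF L EL compact_imp_bounded[OF Ecomp]] e p s1 by auto
    define B where "B = max B0 (c * M)"
    have vB: "v x \<le> B" for x using B0[of x] c M by (auto simp: v_def B_def le_max_iff_disj)
    have WB: "W x \<le> B" for x using W0(2)[of x] by (simp add: B_def)
    have \<phi>K': "\<forall>x. x \<notin> K \<longrightarrow> \<phi> x = 0" and nearE': "\<forall>x y. x \<in> K \<longrightarrow> norm (x - y) \<le> d \<longrightarrow> y \<in> E"
      using \<phi>K nearE by blast+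
    note ci = comparison_integrands[OF vm Wm v0 vB W0(1) WB \<phi>_def \<phi>K' KL Kbd EL d(1) nearE']
    note cp = ci[OF ev(1) eW(1) s1 p] and cq = ci[OF ev(2) eW(2) e(3) e(1)]
    have \<phi>i: "integrable lebesgue \<phi>"
    proof (rule Bochner_Integration.integrable_bound[OF _ \<phi>m])
      show "integrable lebesgue (\<lambda>x. c * M * indicator K x :: real)"
        using bounded_set_imp_lmeasurable[OF Kbd KL] by (intro integrable_mult_right integrable_real_indicator) (auto simp: fmeasurable_def)
      have "norm (\<phi> x) \<le> norm (c * M * indicator K x :: real)" for x
        using \<phi>0[of x] \<phi>K[of x] c M by (cases "x \<in> K") auto
      then show "AE x in lebesgue. norm (\<phi> x) \<le> norm (c * M * indicator K x :: real)" by simp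
    qed
    define I where "I = (LINT x|lebesgue. \<phi> x)"
    have I0: "0 \<le> I" unfolding I_def using \<phi>0 by (intro Bochner_Integration.integral_nonneg) auto
    have test: "\<phi> \<in> test_functions s1 p s2 q \<Omega>"
    proof -
      have Lsp: "\<phi> \<in> L_space \<Omega> m" if m: "1 < m" for m
      proof -
        have "integrable lebesgue (\<lambda>x. indicator \<Omega> x *\<^sub>R \<bar>\<phi> x\<bar> powr m)"
        proof (rule Bochner_Integration.integrable_bound)
          show "integrable lebesgue (\<lambda>x. (c * M) powr m * indicator K x :: real)"
            using bounded_set_imp_lmeasurable[OF Kbd KL] by (intro integrable_mult_right integrable_real_indicator) (auto simp: fmeasurable_def)
          show "(\<lambda>x. indicator \<Omega> x *\<^sub>R \<bar>\<phi> x\<bar> powr m) \<in> borel_measurable lebesgue" using \<phi>m \<Omega>L by measurable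
          have "norm (indicator \<Omega> x *\<^sub>R \<bar>\<phi> x\<bar> powr m) \<le> norm ((c * M) powr m * indicator K x :: real)" for x
            using \<phi>0[of x] \<phi>K[of x] m powr_mono2[of m "\<phi> x" "c * M"] by (cases "x \<in> K") (auto simp: indicator_def)
          then show "AE x in lebesgue. norm (indicator \<Omega> x *\<^sub>R \<bar>\<phi> x\<bar> powr m) \<le> norm ((c * M) powr m * indicator K x :: real)" by simp
        qed
        then show ?thesis unfolding L_space_def using \<phi>m \<Omega>L by (simp add: integrable_restrict_space measurable_restrict_space1)
      qed
      have en: "gagliardo_energy \<Omega> s m \<phi> < \<infinity>" if "integrable leb2 (energy_density s m \<phi>)" for s m
      proof -
        have "gagliardo_energy \<Omega> s m \<phi> = (\<integral>\<^sup>+z. ennreal (energy_density s m \<phi> z * indicator (\<Omega> \<times> \<Omega>) z) \<partial>leb2)"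
          using \<Omega>L \<phi>m by (rule gagliardo_energy_eq) simp
        also have "\<dots> \<le> (\<integral>\<^sup>+z. ennreal (norm (energy_density s m \<phi> z)) \<partial>leb2)"
          by (intro nn_integral_mono ennreal_leI) (auto simp: indicator_def)
        also have "\<dots> < \<infinity>" using that by (simp add: integrable_iff_bounded)
        finally show ?thesis .
      qed
      have "closure {x. \<phi> x \<noteq> 0} \<subseteq> K" using \<phi>K Kclosed by (intro closure_minimal) auto
      moreover then have "compact (closure {x. \<phi> x \<noteq> 0})" using Kcomp by (metis closed_closure compact_Int_closed inf.absorb_iff2 inf.commute)
      ultimately show ?thesis
        unfolding test_functions_def W_space_def frac_Sobolev_def
        using Lsp[OF p] Lsp[OF e(1)] en[OF cp(1)] en[OF cq(1)] \<phi>0 K\<Omega> by auto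
    qed
    define Iv where "Iv = (\<lambda>z. signed_pow (v (fst z) - v (snd z)) (p - 1) * (\<phi> (fst z) - \<phi> (snd z)) / norm (fst z - snd z) powr (?N + p * s1))"
    define IW where "IW = (\<lambda>z. signed_pow (W (fst z) - W (snd z)) (p - 1) * (\<phi> (fst z) - \<phi> (snd z)) / norm (fst z - snd z) powr (?N + p * s1))"
    have B'i: "integrable lebesgue (indicator B' :: 'a \<Rightarrow> real)"
      unfolding B'_def using bounded_set_imp_lmeasurable[of "cball z0 (r / 2)"] by (intro integrable_real_indicator) (auto simp: fmeasurable_def)
    have "p - 1 > 0" using p by simp
    define J where "J = (\<lambda>x y. (signed_pow (v x - v y) (p - 1) - signed_pow (W x - W y) (p - 1)) * (\<phi> x - \<phi> y) / norm (x - y) powr (?N + p * s1))"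
    have Jsym: "J x y = J y x" for x y
    proof -
      have "signed_pow (v x - v y) (p - 1) = - signed_pow (v y - v x) (p - 1)" "signed_pow (W x - W y) (p - 1) = - signed_pow (W y - W x) (p - 1)"
        using signed_pow_minus[of "v y - v x" "p - 1"] signed_pow_minus[of "W y - W x" "p - 1"] by simp_all
      then show ?thesis unfolding J_def norm_minus_commute[of x y] by (simp add: algebra_simps)
    qed
    have Jneg: "J x y \<le> 0" for x y
      unfolding J_def \<phi>_def using truncation_monotone[OF \<open>p - 1 > 0\<close>, of "v x" "v y" "W x" "W y"] by (intro divide_nonpos_nonneg) auto
    have Jbig: "J x y \<le> - (\<kappa>0 * \<phi> x)" if x: "0 < \<phi> x" and y: "y \<in> B'" for x y
    proof -
      have xK: "x \<in> K" "v x < W x" using \<phi>pos[OF x] by auto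
      have "x \<noteq> y" using x \<phi>B(1)[OF y] by auto
      then have n0: "0 < norm (x - y)" by simp
      have "x \<in> ball z0 r" "y \<in> ball z0 r" using xK(1) Kball y r by (auto simp: B'_def)
      then have n2: "norm (x - y) \<le> 2 * r" using norm_triangle_ineq4[of "x - z0" "y - z0"]
        by (simp add: dist_norm norm_minus_commute[of z0])
      have "v x - v y \<le> - \<eta>" using xK(2) W0(2)[of x] c(2) \<phi>B(2)[OF y] by linarith
      then have "signed_pow (v x - v y) (p - 1) \<le> signed_pow (- \<eta>) (p - 1)" using p by (intro signed_pow_mono) auto
      also have "\<dots> = - (\<eta> powr (p - 1))" using \<eta> by (simp add: signed_pow_nonpos)
      finally have 1: "signed_pow (v x - v y) (p - 1) \<le> - (\<eta> powr (p - 1))" .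
      have "- (c * M) \<le> W x - W y" using W0(1)[of x] W0(2)[of y] by linarith
      then have "signed_pow (- (c * M)) (p - 1) \<le> signed_pow (W x - W y) (p - 1)" using p by (intro signed_pow_mono) auto
      moreover have "signed_pow (- (c * M)) (p - 1) = - ((c * M) powr (p - 1))" using c(1) M by (simp add: signed_pow_nonpos)
      ultimately have 2: "- (\<eta> powr (p - 1) / 2) \<le> signed_pow (W x - W y) (p - 1)" using c(4) by linarith
      have "J x y \<le> - (\<eta> powr (p - 1) / 2) * \<phi> x / norm (x - y) powr (?N + p * s1)"
      proof -
        have "signed_pow (v x - v y) (p - 1) - signed_pow (W x - W y) (p - 1) \<le> - (\<eta> powr (p - 1) / 2)" using 1 2 by linarith
        from mult_right_mono[OF this less_imp_le[OF x]] show ?thesis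
          unfolding J_def \<phi>B(1)[OF y] diff_0_right by (rule divide_right_mono) simp
      qed
      also have "\<dots> = - (\<eta> powr (p - 1) / 2 * \<phi> x / norm (x - y) powr (?N + p * s1))" by simp
      also have "\<dots> \<le> - (\<eta> powr (p - 1) / 2 * \<phi> x / (2 * r) powr (?N + p * s1))"
      proof -
        have "norm (x - y) powr (?N + p * s1) \<le> (2 * r) powr (?N + p * s1)" using n2 p s1 by (intro powr_mono2) auto
        then show ?thesis using n0 x \<eta> r by (intro le_imp_neg_le divide_left_mono) auto
      qed
      also have "\<dots> = - (\<kappa>0 * \<phi> x)" by (simp add: \<kappa>0_def)
      finally show ?thesis .
    qed
    have pt: "Iv z \<le> IW z - \<kappa>0 * (\<phi> (fst z) * indicator B' (snd z)) - \<kappa>0 * (indicator B' (fst z) * \<phi> (snd z))" for z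
    proof -
      obtain x y where z: "z = (x, y)" by (cases z)
      have "J x y \<le> - (\<kappa>0 * (\<phi> x * indicator B' y)) - \<kappa>0 * (indicator B' x * \<phi> y)"
      proof (cases "0 < \<phi> x \<and> y \<in> B'")
        case True
        then show ?thesis using Jbig[of x y] \<phi>B(1)[of y] by simp
      next
        case F1: False
        then have z1: "\<phi> x * indicator B' y = 0" using \<phi>0(1)[of x] by (auto simp: indicator_def)
        show ?thesis
        proof (cases "0 < \<phi> y \<and> x \<in> B'")
          case True
          then show ?thesis using Jbig[of y x] Jsym[of x y] \<phi>B(1)[of x] by simp
        next
          case False
          then have z2: "indicator B' x * \<phi> y = 0" using \<phi>0(1)[of y] by (auto simp: indicator_def)
          show ?thesis unfolding z1 z2 using Jneg[of x y] by simp
        qed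
      qed
      moreover have "Iv z - IW z = J x y" unfolding Iv_def IW_def J_def z
        by (simp only: fst_conv snd_conv left_diff_distrib diff_divide_distrib)
      ultimately show ?thesis by (simp add: z)
    qed
    have Ivi: "integrable leb2 Iv" and IWi: "integrable leb2 IW" unfolding Iv_def IW_def using cp by auto
    have fp: "frac_form s1 p v \<phi> \<le> frac_form s1 p W \<phi> - \<kappa> * I"
    proof -
      have p1: "integrable leb2 (\<lambda>z. \<phi> (fst z) * indicator B' (snd z))" and p2: "integrable leb2 (\<lambda>z. indicator B' (fst z) * \<phi> (snd z))"
        by (rule integral_product(1)[OF \<phi>i B'i], rule integral_product(1)[OF B'i \<phi>i])
      have "(LINT z|leb2. Iv z) \<le> (LINT z|leb2. IW z - \<kappa>0 * (\<phi> (fst z) * indicator B' (snd z)) - \<kappa>0 * (indicator B' (fst z) * \<phi> (snd z)))"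
        using pt by (intro integral_mono Bochner_Integration.integrable_diff integrable_mult_right Ivi IWi p1 p2)
      also have "\<dots> = (LINT z|leb2. IW z) - \<kappa>0 * (LINT z|leb2. \<phi> (fst z) * indicator B' (snd z)) - \<kappa>0 * (LINT z|leb2. indicator B' (fst z) * \<phi> (snd z))"
        using IWi p1 p2 by simp
      also have "\<dots> = (LINT z|leb2. IW z) - \<kappa> * I"
        unfolding integral_product(2)[OF \<phi>i B'i] integral_product(2)[OF B'i \<phi>i] I_def \<kappa>_def
        using VB[of z0] by (simp add: B'_def)
      finally show ?thesis unfolding frac_form_def Iv_def IW_def .
    qed
    have fq: "frac_form s2 q v \<phi> \<le> frac_form s2 q W \<phi>"
      unfolding frac_form_def
    proof (rule integral_mono[OF cq(2) cq(3)])
      fix z :: "'a \<times> 'a"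
      have "(signed_pow (v (fst z) - v (snd z)) (q - 1) - signed_pow (W (fst z) - W (snd z)) (q - 1)) * (\<phi> (fst z) - \<phi> (snd z)) \<le> 0"
        unfolding \<phi>_def using e by (intro truncation_monotone) simp
      then show "signed_pow (v (fst z) - v (snd z)) (q - 1) * (\<phi> (fst z) - \<phi> (snd z)) / norm (fst z - snd z) powr (?N + q * s2)
        \<le> signed_pow (W (fst z) - W (snd z)) (q - 1) * (\<phi> (fst z) - \<phi> (snd z)) / norm (fst z - snd z) powr (?N + q * s2)"
        by (intro divide_right_mono) (auto simp: left_diff_distrib)
    qed
    have bp: "frac_form s1 p W \<phi> \<le> \<kappa> / 4 * I"
    proof -
      have "frac_form s1 p W \<phi> \<le> Cp * c powr (p - 1) * I"
        unfolding I_def using Cp(2)[OF c(1) \<epsilon> \<phi>i \<phi>0(1) supp W_def cp(3)] by simp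
      also have "\<dots> \<le> \<kappa> / 4 * I" using c(5) I0 by (rule mult_right_mono)
      finally show ?thesis .
    qed
    have bq: "frac_form s2 q W \<phi> \<le> \<kappa> / 4 * I"
    proof -
      have "frac_form s2 q W \<phi> \<le> Cq * c powr (q - 1) * I"
        unfolding I_def using Cq(2)[OF c(1) \<epsilon> \<phi>i \<phi>0(1) supp W_def cq(3)] by simp
      also have "\<dots> \<le> \<kappa> / 4 * I" using c(6) I0 by (rule mult_right_mono)
      finally show ?thesis .
    qed
    have gb: "\<bar>g (v x) * \<phi> x - g 0 * \<phi> x\<bar> \<le> \<kappa> / 4 * \<phi> x" for x
    proof (cases "0 < \<phi> x")
      case True
      then have "\<bar>v x\<bar> < \<delta>g" using \<phi>pos[OF True] W0(2)[of x] c(3) v0[of x] by linarith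
      then have "\<bar>g (v x) - g 0\<bar> * \<phi> x \<le> \<kappa> / 4 * \<phi> x" using \<delta>g(2)[of "v x"] True by (intro mult_right_mono) auto
      moreover have "\<bar>g (v x) * \<phi> x - g 0 * \<phi> x\<bar> = \<bar>g (v x) - g 0\<bar> * \<phi> x" using True by (simp add: abs_mult flip: left_diff_distrib)
      ultimately show ?thesis by simp
    next
      case False
      then have "\<phi> x = 0" using \<phi>0(1)[of x] by linarith
      then show ?thesis by simp
    qed
    have gvm: "(\<lambda>x. g (v x) * \<phi> x) \<in> borel_measurable lebesgue"
      using measurable_compose[OF vm borel_measurable_continuous_onI[OF g]] \<phi>m by (rule borel_measurable_times)
    have g0i: "integrable lebesgue (\<lambda>x. g 0 * \<phi> x)" using \<phi>i by (rule integrable_mult_right)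
    have gdi: "integrable lebesgue (\<lambda>x. g (v x) * \<phi> x - g 0 * \<phi> x)"
    proof (rule Bochner_Integration.integrable_bound[OF integrable_mult_right[OF \<phi>i, of "\<kappa> / 4"]])
      show "(\<lambda>x. g (v x) * \<phi> x - g 0 * \<phi> x) \<in> borel_measurable lebesgue" using gvm \<phi>m by measurable
      show "AE x in lebesgue. norm (g (v x) * \<phi> x - g 0 * \<phi> x) \<le> norm (\<kappa> / 4 * \<phi> x)"
        using gb \<phi>0(1) \<kappa> by (auto simp: abs_mult)
    qed
    have gvi: "integrable lebesgue (\<lambda>x. g (v x) * \<phi> x)"
      using Bochner_Integration.integrable_add[OF gdi g0i] by simp
    have gint: "(LINT x|lebesgue. g (v x) * \<phi> x) - (LINT x|lebesgue. g 0 * \<phi> x) \<le> \<kappa> / 4 * I"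
    proof -
      have "(LINT x|lebesgue. g (v x) * \<phi> x) - (LINT x|lebesgue. g 0 * \<phi> x) = (LINT x|lebesgue. g (v x) * \<phi> x - g 0 * \<phi> x)"
        using gvi g0i by simp
      also have "\<dots> \<le> (LINT x|lebesgue. \<kappa> / 4 * \<phi> x)"
      proof (rule integral_mono[OF gdi integrable_mult_right[OF \<phi>i]])
        show "g (v x) * \<phi> x - g 0 * \<phi> x \<le> \<kappa> / 4 * \<phi> x" for x using gb[of x] by linarith
      qed
      finally show ?thesis by (simp add: I_def)
    qed
    have \<Omega>1: "(LINT x:\<Omega>|lebesgue. g (u x) * \<phi> x) = (LINT x|lebesgue. g (v x) * \<phi> x)"
      unfolding set_lebesgue_integral_def using \<phi>K K\<Omega> by (intro Bochner_Integration.integral_cong) (auto simp: indicator_def v_def)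
    have \<Omega>2: "(LINT x:\<Omega>|lebesgue. g 0 * \<phi> x) = (LINT x|lebesgue. g 0 * \<phi> x)"
      unfolding set_lebesgue_integral_def using \<phi>K K\<Omega> by (intro Bochner_Integration.integral_cong) (auto simp: indicator_def)
    have "frac_form s1 p u \<phi> + frac_form s2 q u \<phi> + (LINT x:\<Omega>|lebesgue. g (u x) * \<phi> x) \<ge> (LINT x:\<Omega>|lebesgue. g 0 * \<phi> x)"
      using weak test by (simp add: weak_supersolution_def)
    then have "0 \<le> frac_form s1 p v \<phi> + frac_form s2 q v \<phi> + ((LINT x|lebesgue. g (v x) * \<phi> x) - (LINT x|lebesgue. g 0 * \<phi> x))"
      unfolding \<Omega>1 \<Omega>2 frac_form_cong_AE[OF um vm \<phi>m vae] by simp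
    then have "\<kappa> * I \<le> 3 * (\<kappa> / 4 * I)" using fp fq bp bq gint by linarith
    moreover have "3 * (\<kappa> / 4 * I) = 3 / 4 * (\<kappa> * I)" by simp
    ultimately have "\<kappa> * I \<le> 0" by linarith
    then have "I = 0" using I0 \<kappa> by (simp add: mult_le_0_iff)
    then have ae0: "AE x in lebesgue. \<phi> x = 0"
      using integral_nonneg_eq_0_iff_AE[OF \<phi>i] \<phi>0 by (simp add: I_def)
    have "open {x \<in> \<Omega>. u x < W x}"
    proof -
      have "continuous_on \<Omega> (\<lambda>x. W x - u x)"
        using continuous_on_subset[OF Wcont] continuous_on_subset[OF u(2) closure_subset] by (intro continuous_intros) auto
      from continuous_on_open_vimage[OF \<Omega>(1), THEN iffD1, OF this]
      have "open ((\<lambda>x. W x - u x) -` {0<..} \<inter> \<Omega>)" by simp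
      moreover have "(\<lambda>x. W x - u x) -` {0<..} \<inter> \<Omega> = {x \<in> \<Omega>. u x < W x}" by auto
      ultimately show ?thesis by simp
    qed
    moreover have "negligible {x \<in> \<Omega>. u x < W x}"
    proof -
      have "AE x in lebesgue. x \<notin> {x \<in> \<Omega>. u x < W x}"
        using ae0 by eventually_elim (auto simp: \<phi>_def v_def)
      then have "{x \<in> \<Omega>. u x < W x} \<in> null_sets lebesgue"
        using \<open>open {x \<in> \<Omega>. u x < W x}\<close> by (subst AE_iff_null_sets) auto
      then show ?thesis by (simp add: negligible_iff_null_sets)
    qed
    ultimately have "{x \<in> \<Omega>. u x < W x} = {}" using open_not_negligible by blast
    then have "W x1 \<le> u x1" using x1 ball by force
    then show ?thesis by (simp add: W_def)
  qed
  have bound: "c * ball_profile r s1 (x - z0) \<le> u x"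
    if ball: "ball z0 r \<subseteq> \<Omega>" and big: "\<And>y. y \<in> cball z0 (r / 2) \<Longrightarrow> 2 * \<eta> \<le> u y" and x: "x \<in> ball z0 r" for z0 x
  proof (rule field_le_epsilon)
    fix t :: real assume t: "0 < t"
    have "c * (ball_profile r s1 (x - z0) - t / c) \<le> c * max 0 (ball_profile r s1 (x - z0) - t / c)"
      using c by (intro mult_left_mono) auto
    also have "\<dots> \<le> u x" using key[OF ball big x, of "t / c"] t c(1) by simp
    finally show "c * ball_profile r s1 (x - z0) \<le> u x + t" using c(1) by (simp add: right_diff_distrib)
  qed
  show ?thesis by (rule that[OF c(1) bound])
qed


section \<open>Positivity and the growth at the boundary\<close>

text \<open>By connectedness a zero \<open>x0\<close> is a limit of points of positivity. Take such a point \<open>z\<close> so close to \<open>x0\<close> that its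
nearest zero \<open>y0\<close> and a slightly larger ball stay in \<open>\<Omega>\<close>. The lower bound on that larger ball contradicts
\<open>u y0 = 0\<close>.\<close>

lemma strong_minimum_principle:
  fixes \<Omega> :: "'a::euclidean_space set" and u :: "'a \<Rightarrow> real" and s :: real
  assumes \<Omega>: "open \<Omega>" "connected \<Omega>" and u: "continuous_on \<Omega> u" "\<And>x. x \<in> \<Omega> \<Longrightarrow> 0 \<le> u x"
    and nz: "\<exists>x\<in>\<Omega>. u x \<noteq> 0"
    and ball: "\<And>r \<eta>. 0 < r \<Longrightarrow> 0 < \<eta> \<Longrightarrow> \<exists>c>0. \<forall>z0 x. ball z0 r \<subseteq> \<Omega> \<longrightarrow> (\<forall>y\<in>cball z0 (r / 2). 2 * \<eta> \<le> u y) \<longrightarrow>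
       x \<in> ball z0 r \<longrightarrow> c * ball_profile r s (x - z0) \<le> u x"
    and x: "x \<in> \<Omega>"
  shows "0 < u x"
proof (rule ccontr)
  assume "\<not> 0 < u x"
  then have ux: "u x = 0" using u(2)[OF x] by simp
  define P where "P = {x \<in> \<Omega>. 0 < u x}"
  define Z where "Z = {x \<in> \<Omega>. u x = 0}"
  have Popen: "open P"
  proof -
    from continuous_on_open_vimage[OF \<Omega>(1), THEN iffD1, OF u(1)]
    have "open (u -` {0<..} \<inter> \<Omega>)" by simp
    moreover have "u -` {0<..} \<inter> \<Omega> = P" by (auto simp: P_def)
    ultimately show ?thesis by simp
  qed
  have PZ: "P \<union> Z = \<Omega>" "P \<inter> Z = {}" using u(2) by (force simp: P_def Z_def)+
  have "P \<noteq> {}" using nz u(2) by (force simp: P_def)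
  have "Z \<noteq> {}" using ux x by (auto simp: Z_def)
  have "\<not> open Z"
    using connectedD[OF \<Omega>(2) Popen, of Z] PZ \<open>P \<noteq> {}\<close> \<open>Z \<noteq> {}\<close> by blast
  then obtain x0 where x0: "x0 \<in> Z" "\<And>e. 0 < e \<Longrightarrow> \<not> ball x0 e \<subseteq> Z" unfolding open_contains_ball by blast
  have "x0 \<in> \<Omega>" using x0(1) by (simp add: Z_def)
  then obtain R where R: "0 < R" "ball x0 R \<subseteq> \<Omega>" using \<Omega>(1) open_contains_ball by blast
  have "\<not> ball x0 (R / 4) \<subseteq> Z" using x0(2)[of "R / 4"] R by simp
  then obtain z where z: "z \<in> ball x0 (R / 4)" "z \<notin> Z" by blast
  have zx0: "dist x0 z < R / 4" using z by simp
  define Z' where "Z' = Z \<inter> cball x0 (R / 2)"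
  have cb: "cball x0 (R / 2) \<subseteq> \<Omega>" using R by force
  have Zc: "Z' = cball x0 (R / 2) \<inter> u -` {0}" using cb by (auto simp: Z'_def Z_def)
  have "closed Z'"
    unfolding Zc using continuous_on_subset[OF u(1) cb] by (intro continuous_closed_preimage) auto
  moreover have "x0 \<in> Z'" using x0 R by (simp add: Z'_def)
  ultimately obtain y0 where y0: "y0 \<in> Z'" "\<And>y. y \<in> Z' \<Longrightarrow> dist z y0 \<le> dist z y"
    using distance_attains_inf[of Z' z] by blast
  define d where "d = dist z y0"
  have "z \<noteq> y0" using y0(1) z(2) by (auto simp: Z'_def)
  then have d0: "0 < d" by (simp add: d_def)
  have d1: "d < R / 4" using y0(2)[OF \<open>x0 \<in> Z'\<close>] zx0 by (simp add: d_def dist_commute)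
  have pos: "0 < u y" if "dist z y < d" for y
  proof -
    have "dist x0 y < R / 2" using dist_triangle[of x0 y z] that d1 zx0 by linarith
    then have "y \<in> cball x0 (R / 2)" by simp
    moreover have "y \<notin> Z'" using y0(2)[of y] that by (auto simp: d_def)
    ultimately have "y \<in> \<Omega>" "y \<notin> Z" using cb by (auto simp: Z'_def)
    then show ?thesis using PZ by (auto simp: P_def)
  qed
  \<comment> \<open>Any factor between \<open>1\<close> and \<open>2\<close> works: the half ball has to avoid the zeros, the whole ball has to contain \<open>y0\<close>.\<close>
  define r where "r = 9 / 5 * d"
  have r: "0 < r" "r / 2 < d" "d < r" using d0 by (simp_all add: r_def)
  have br: "ball z r \<subseteq> \<Omega>"
  proof
    fix y assume "y \<in> ball z r"
    then have "dist x0 y < R" using dist_triangle[of x0 y z] d1 zx0 R by (simp add: r_def)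
    then show "y \<in> \<Omega>" using R by auto
  qed
  have cbr: "cball z (r / 2) \<subseteq> \<Omega>" using br r by force
  obtain y1 where y1: "y1 \<in> cball z (r / 2)" "\<And>y. y \<in> cball z (r / 2) \<Longrightarrow> u y1 \<le> u y"
    using continuous_attains_inf[of "cball z (r / 2)" u] continuous_on_subset[OF u(1) cbr] r by auto
  have "0 < u y1" using pos[of y1] y1(1) r by simp
  then obtain c where c: "0 < c" "\<forall>z0 x. ball z0 r \<subseteq> \<Omega> \<longrightarrow> (\<forall>y\<in>cball z0 (r / 2). 2 * (u y1 / 2) \<le> u y) \<longrightarrow>
       x \<in> ball z0 r \<longrightarrow> c * ball_profile r s (x - z0) \<le> u x"
    using ball[of r "u y1 / 2"] r by auto
  have "y0 \<in> ball z r" using r by (simp add: d_def)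
  then have "c * ball_profile r s (y0 - z) \<le> u y0" using c(2) br y1(2) by auto
  moreover have "u y0 = 0" using y0(1) by (simp add: Z'_def Z_def)
  moreover have "0 < ball_profile r s (y0 - z)"
  proof -
    have "(norm (y0 - z))\<^sup>2 < r\<^sup>2" using r d0 by (intro power_strict_mono) (auto simp: d_def dist_norm norm_minus_commute)
    then show ?thesis by (simp add: ball_profile_def)
  qed
  ultimately show False using c(1) by (simp add: mult_le_0_iff)
qed

lemma C11_taylor:
  fixes \<gamma> :: "'a::euclidean_space \<Rightarrow> real" and \<gamma>' :: "'a \<Rightarrow> 'a \<Rightarrow>\<^sub>L real"
  assumes d: "\<And>x. (\<gamma> has_derivative blinfun_apply (\<gamma>' x)) (at x)" and L: "L-lipschitz_on UNIV \<gamma>'"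
  shows "\<gamma> (x + w) - \<gamma> x \<le> blinfun_apply (\<gamma>' x) w + L * (norm w)\<^sup>2"
proof -
  have L0: "0 \<le> L" using L by (rule lipschitz_on_nonneg)
  have "((\<lambda>t. \<gamma> (x + t *\<^sub>R w)) has_real_derivative blinfun_apply (\<gamma>' (x + t *\<^sub>R w)) w) (at t)" for t :: real
  proof -
    have 1: "((\<lambda>t. x + t *\<^sub>R w) has_derivative (\<lambda>h. h *\<^sub>R w)) (at t)" by (auto intro!: derivative_eq_intros)
    have "((\<lambda>t. \<gamma> (x + t *\<^sub>R w)) has_derivative (\<lambda>h. blinfun_apply (\<gamma>' (x + t *\<^sub>R w)) (h *\<^sub>R w))) (at t)"
      using has_derivative_compose[OF 1 d] .
    then show ?thesis unfolding has_field_derivative_def by (simp add: blinfun.scaleR_right mult_commute_abs)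
  qed
  then obtain t where t: "0 < t" "t < 1" "\<gamma> (x + 1 *\<^sub>R w) - \<gamma> (x + 0 *\<^sub>R w) = (1 - 0) * blinfun_apply (\<gamma>' (x + t *\<^sub>R w)) w"
    using MVT2[of 0 1 "\<lambda>t. \<gamma> (x + t *\<^sub>R w)" "\<lambda>t. blinfun_apply (\<gamma>' (x + t *\<^sub>R w)) w"] by auto
  have "blinfun_apply (\<gamma>' (x + t *\<^sub>R w)) w - blinfun_apply (\<gamma>' x) w = blinfun_apply (\<gamma>' (x + t *\<^sub>R w) - \<gamma>' x) w"
    by (simp add: blinfun.diff_left)
  also have "\<dots> \<le> norm (\<gamma>' (x + t *\<^sub>R w) - \<gamma>' x) * norm w"
    using norm_blinfun[of "\<gamma>' (x + t *\<^sub>R w) - \<gamma>' x" w] by simp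
  also have "\<dots> \<le> (L * norm w) * norm w"
  proof (rule mult_right_mono)
    have "norm (\<gamma>' (x + t *\<^sub>R w) - \<gamma>' x) \<le> L * norm (t *\<^sub>R w)"
      using lipschitz_onD[OF L, of "x + t *\<^sub>R w" x] by (simp add: dist_norm)
    also have "\<dots> \<le> L * norm w" using L0 t by (intro mult_left_mono) (auto simp: mult_left_le_one_le)
    finally show "norm (\<gamma>' (x + t *\<^sub>R w) - \<gamma>' x) \<le> L * norm w" .
  qed simp
  finally show ?thesis using t(3) by (simp add: power2_eq_square mult.assoc)
qed

text \<open>The ball used for \<open>x\<close> touches the graph at the point \<open>xb\<close> below \<open>x\<close> in the vertical direction \<open>e\<close>, rather than at
the nearest boundary point. Its centre lies on the normal \<open>\<nu>\<close> to the graph at \<open>xb\<close>, and it stays in \<open>\<Omega>\<close> because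
the graph deviates from its tangent plane by at most \<open>L' |v|\<^sup>2\<close> with \<open>L' \<le> 1 / (2 r)\<close>. The angle between \<open>e\<close> and
\<open>\<nu>\<close> is bounded away from a right angle by the slope bound \<open>B\<close>, so \<open>r\<^sup>2 - |x - z|\<^sup>2\<close> is at least a multiple of
the height \<open>t\<close> of \<open>x\<close> above the graph.\<close>

lemma hopf_near_boundary_point:
  fixes \<Omega> :: "'a::euclidean_space set" and u :: "'a \<Rightarrow> real" and s :: real
  assumes \<Omega>: "open \<Omega>" "bounded \<Omega>" "C11_boundary \<Omega>" and s: "0 < s"
    and u: "continuous_on \<Omega> u" "\<And>x. x \<in> \<Omega> \<Longrightarrow> 0 < u x"
    and ball: "\<And>r \<eta>. 0 < r \<Longrightarrow> 0 < \<eta> \<Longrightarrow> \<exists>c>0. \<forall>z0 x. ball z0 r \<subseteq> \<Omega> \<longrightarrow> (\<forall>y\<in>cball z0 (r / 2). 2 * \<eta> \<le> u y) \<longrightarrow>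
       x \<in> ball z0 r \<longrightarrow> c * ball_profile r s (x - z0) \<le> u x"
    and x0: "x0 \<in> frontier \<Omega>"
  obtains \<rho> c where "0 < \<rho>" "0 < c" "\<And>x. x \<in> \<Omega> \<Longrightarrow> x \<in> ball x0 \<rho> \<Longrightarrow> c * infdist x (frontier \<Omega>) powr s \<le> u x"
proof -
  obtain r0 e \<gamma> where r0: "0 < r0" and e: "norm e = 1" and C11: "C11_function \<gamma>"
    and graph: "\<And>y. y \<in> ball x0 r0 \<Longrightarrow> y \<in> \<Omega> \<longleftrightarrow> \<gamma> (y - (y \<bullet> e) *\<^sub>R e) < y \<bullet> e"
    using \<Omega>(3) x0 unfolding C11_boundary_def by metis
  obtain \<gamma>' :: "'a \<Rightarrow> 'a \<Rightarrow>\<^sub>L real" and L where d\<gamma>: "\<And>x. (\<gamma> has_derivative blinfun_apply (\<gamma>' x)) (at x)" and L: "L-lipschitz_on UNIV \<gamma>'"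
    using C11 unfolding C11_function_def by blast
  have L0: "0 \<le> L" using L by (rule lipschitz_on_nonneg)
  have ee: "e \<bullet> e = 1" using e by (simp add: norm_eq_1)
  define \<pi> where "\<pi> = (\<lambda>y::'a. y - (y \<bullet> e) *\<^sub>R e)"
  have \<pi>add: "\<pi> (x + y) = \<pi> x + \<pi> y" and \<pi>diff: "\<pi> (x - y) = \<pi> x - \<pi> y" for x y
    by (simp_all add: \<pi>_def inner_add_left inner_diff_left algebra_simps)
  have \<pi>e: "\<pi> (t *\<^sub>R e) = 0" for t by (simp add: \<pi>_def ee)
  have \<pi>norm: "norm (\<pi> v) \<le> norm v" for v
  proof -
    have "(norm (\<pi> v))\<^sup>2 = (norm v)\<^sup>2 - (v \<bullet> e)\<^sup>2"
      unfolding \<pi>_def power2_norm_eq_inner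
      by (simp add: inner_diff_left inner_diff_right ee inner_commute[of e v] power2_eq_square)
    then have "(norm (\<pi> v))\<^sup>2 \<le> (norm v)\<^sup>2" by simp
    then show ?thesis by (rule power2_le_imp_le) simp
  qed
  define T where "T = (\<lambda>y. y \<bullet> e - \<gamma> (\<pi> y))"
  have T: "y \<in> \<Omega> \<longleftrightarrow> 0 < T y" if "y \<in> ball x0 r0" for y using graph[OF that] by (simp add: T_def \<pi>_def)
  have Tcont: "isCont T y" for y
  proof -
    have "isCont \<gamma> z" for z using has_derivative_continuous[OF d\<gamma>] .
    moreover have "isCont \<pi> y" unfolding \<pi>_def by (intro continuous_intros)
    ultimately have "isCont (\<lambda>y. \<gamma> (\<pi> y)) y" using isCont_o2[of y \<pi> \<gamma>] by blast
    then show ?thesis unfolding T_def by (intro continuous_intros)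
  qed
  have "x0 \<notin> \<Omega>" using x0 \<Omega>(1) by (simp add: frontier_def interior_open)
  then have Tx0: "T x0 \<le> 0" using T[of x0] r0 by simp
  define L' where "L' = L + 1"
  have L': "0 < L'" "L \<le> L'" using L0 by (simp_all add: L'_def)
  define r where "r = min (r0 / 8) (1 / (2 * L'))"
  have r: "0 < r" "r \<le> r0 / 8" "r \<le> 1 / (2 * L')" unfolding r_def using r0 L' by (simp, intro min.cobounded1, intro min.cobounded2)
  define B where "B = norm (\<gamma>' (\<pi> x0)) + L * r0"
  have B: "0 \<le> B" using L0 r0 by (simp add: B_def)
  define \<tau> where "\<tau> = min (r / (1 + 2 * B)) (r0 / 4)"
  have \<tau>: "0 < \<tau>" "\<tau> \<le> r / (1 + 2 * B)" "\<tau> \<le> r0 / 4" unfolding \<tau>_def using r r0 B by (simp, intro min.cobounded1, intro min.cobounded2)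
  obtain \<rho>1 where \<rho>1: "0 < \<rho>1" "\<And>x. dist x x0 < \<rho>1 \<Longrightarrow> T x < \<tau>"
  proof -
    obtain d where "0 < d" "\<And>x. dist x x0 < d \<Longrightarrow> dist (T x) (T x0) < \<tau>"
      using Tcont[of x0] \<tau>(1) unfolding continuous_at_eps_delta by metis
    then show ?thesis using that[of d] Tx0 by (force simp: dist_real_def)
  qed
  define \<rho> where "\<rho> = min \<rho>1 (r0 / 4)"
  have \<rho>: "0 < \<rho>" "\<rho> \<le> \<rho>1" "\<rho> \<le> r0 / 4" unfolding \<rho>_def using \<rho>1 r0 by (simp, intro min.cobounded1, intro min.cobounded2)
  \<comment> \<open>A compact subset of \<open>\<Omega>\<close> that contains the half balls of all balls of radius \<open>r\<close> in \<open>\<Omega>\<close>.\<close>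
  define S where "S = closure \<Omega> \<inter> (\<Inter>w\<in>- \<Omega>. {y. r / 2 \<le> dist y w})"
  have Sclosed: "closed S" unfolding S_def by (intro closed_Int closed_closure closed_INT ballI closed_Collect_le continuous_intros)
  have Scomp: "compact S"
    using Sclosed \<Omega>(2) bounded_closure[of \<Omega>] bounded_subset[of "closure \<Omega>" S] by (auto simp: S_def compact_eq_bounded_closed)
  have S\<Omega>: "S \<subseteq> \<Omega>"
  proof
    fix y assume y: "y \<in> S"
    show "y \<in> \<Omega>"
    proof (rule ccontr)
      assume "y \<notin> \<Omega>"
      moreover have "\<forall>w\<in>- \<Omega>. r / 2 \<le> dist y w" using y unfolding S_def by blast
      ultimately have "r / 2 \<le> dist y y" by blast
      then show False using r by simp
    qed
  qed
  obtain \<eta> where \<eta>: "0 < \<eta>" "\<And>y. y \<in> S \<Longrightarrow> 2 * \<eta> \<le> u y"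
  proof (cases "S = {}")
    case True
    then show ?thesis using that[of 1] by simp
  next
    case False
    then obtain y1 where "y1 \<in> S" "\<And>y. y \<in> S \<Longrightarrow> u y1 \<le> u y"
      using continuous_attains_inf[OF Scomp False continuous_on_subset[OF u(1) S\<Omega>]] by blast
    then show ?thesis using that[of "u y1 / 2"] u(2)[of y1] S\<Omega> by auto
  qed
  obtain c where c: "0 < c" "\<And>z0 x. ball z0 r \<subseteq> \<Omega> \<Longrightarrow> (\<forall>y\<in>cball z0 (r / 2). 2 * \<eta> \<le> u y) \<Longrightarrow>
       x \<in> ball z0 r \<Longrightarrow> c * ball_profile r s (x - z0) \<le> u x"
    using ball[OF r(1) \<eta>(1)] by blast
  define c' where "c' = c * (r / (1 + 2 * B)) powr s"
  have c': "0 < c'" using c(1) r(1) B by (simp add: c'_def)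
  have "c' * infdist x (frontier \<Omega>) powr s \<le> u x" if x: "x \<in> \<Omega>" "x \<in> ball x0 \<rho>" for x
  proof -
    have dx: "dist x x0 < r0 / 4" "dist x x0 < \<rho>1" using x(2) \<rho> by (simp_all add: dist_commute)
    define t where "t = T x"
    have t: "0 < t" "t < \<tau>" using T[of x] x(1) dx r0 \<rho>1(2)[OF dx(2)] by (simp_all add: t_def dist_commute)
    define xb where "xb = x - t *\<^sub>R e"
    have \<pi>xb: "\<pi> xb = \<pi> x" by (simp add: xb_def \<pi>diff \<pi>e)
    have xbe: "xb \<bullet> e = \<gamma> (\<pi> x)" by (simp add: xb_def inner_diff_left ee t_def T_def)
    have dxb: "dist xb x = t" using t e by (simp add: xb_def dist_norm)
    have xb0: "dist xb x0 < r0 / 2" using dist_triangle[of xb x0 x] dxb t \<tau> dx by linarith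
    have "T xb = 0" by (simp add: T_def \<pi>xb xbe)
    then have xb\<Omega>: "xb \<notin> \<Omega>" using T[of xb] xb0 r0 by (simp add: dist_commute)
    define A where "A = \<gamma>' (\<pi> x)"
    have AB: "norm A \<le> B"
    proof -
      have "norm (A - \<gamma>' (\<pi> x0)) \<le> L * norm (\<pi> x - \<pi> x0)"
        using lipschitz_onD[OF L, of "\<pi> x" "\<pi> x0"] by (simp add: A_def dist_norm)
      also have "\<dots> \<le> L * r0"
        using \<pi>norm[of "x - x0"] dx(1) r0 L0 by (intro mult_left_mono) (simp_all add: \<pi>diff dist_norm)
      finally have "norm (A - \<gamma>' (\<pi> x0)) \<le> L * r0" .
      moreover have "norm A \<le> norm (A - \<gamma>' (\<pi> x0)) + norm (\<gamma>' (\<pi> x0))" by (metis diff_add_cancel norm_triangle_ineq)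
      ultimately show ?thesis by (simp add: B_def)
    qed
    define lf where "lf = (\<lambda>v. v \<bullet> e - blinfun_apply A (\<pi> v))"
    have lin: "linear lf"
      unfolding lf_def \<pi>_def by (rule linearI) (simp_all add: inner_add_left blinfun.add_right blinfun.diff_right blinfun.scaleR_right algebra_simps)
    \<comment> \<open>The vector that represents the linear functional \<open>lf\<close>, whose kernel is the tangent plane at \<open>xb\<close>.\<close>
    define \<nu> where "\<nu> = adjoint lf 1"
    have \<nu>: "v \<bullet> \<nu> = lf v" for v using adjoint_works[OF lin, of v 1] by (simp add: \<nu>_def)
    have e\<nu>: "e \<bullet> \<nu> = 1" unfolding \<nu> using \<pi>e[of 1] by (simp add: lf_def ee)
    have \<nu>1: "1 \<le> norm \<nu>" using norm_cauchy_schwarz[of e \<nu>] e\<nu> e by simp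
    have \<nu>B: "norm \<nu> \<le> 1 + 2 * B"
    proof -
      have "norm \<nu> * norm \<nu> = lf \<nu>" unfolding \<nu>[symmetric] by (simp add: power2_norm_eq_inner[symmetric] power2_eq_square)
      also have "\<dots> \<le> norm \<nu> + norm A * norm \<nu>"
      proof -
        have "\<nu> \<bullet> e \<le> norm \<nu>" using norm_cauchy_schwarz[of \<nu> e] e by simp
        moreover have "- blinfun_apply A (\<pi> \<nu>) \<le> norm A * norm (\<pi> \<nu>)" using norm_blinfun[of A "\<pi> \<nu>"] by simp
        moreover have "norm A * norm (\<pi> \<nu>) \<le> norm A * norm \<nu>" using \<pi>norm by (intro mult_left_mono) auto
        ultimately show ?thesis by (simp add: lf_def)
      qed
      also have "\<dots> = (1 + norm A) * norm \<nu>" by (simp add: algebra_simps)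
      finally have "norm \<nu> \<le> 1 + norm A" using \<nu>1 by (cases "\<nu> = 0") (auto simp: mult_le_cancel_right)
      then show ?thesis using AB B by linarith
    qed
    have n0: "0 < norm \<nu>" using \<nu>1 by linarith
    define z where "z = xb + (r / norm \<nu>) *\<^sub>R \<nu>"
    have expand: "(norm (v - (r / norm \<nu>) *\<^sub>R \<nu>))\<^sup>2 = (norm v)\<^sup>2 - 2 * r / norm \<nu> * lf v + r\<^sup>2" for v
    proof -
      have "(norm (v - (r / norm \<nu>) *\<^sub>R \<nu>))\<^sup>2 = (norm v)\<^sup>2 - 2 * (r / norm \<nu>) * (v \<bullet> \<nu>) + (r / norm \<nu>)\<^sup>2 * (norm \<nu>)\<^sup>2"
      proof -
        have "(v - k *\<^sub>R \<nu>) \<bullet> (v - k *\<^sub>R \<nu>) = v \<bullet> v - 2 * k * (v \<bullet> \<nu>) + k * k * (\<nu> \<bullet> \<nu>)" for k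
          by (simp add: inner_diff_left inner_diff_right inner_commute[of \<nu> v] algebra_simps)
        then show ?thesis unfolding power2_norm_eq_inner power2_eq_square[of "r / norm \<nu>"] .
      qed
      also have "(r / norm \<nu>)\<^sup>2 * (norm \<nu>)\<^sup>2 = r\<^sup>2" using n0 by (simp add: power_divide)
      finally show ?thesis by (simp add: \<nu>)
    qed
    have zball: "ball z r \<subseteq> \<Omega>"
    proof
      fix y assume y: "y \<in> ball z r"
      define v where "v = y - xb"
      have "norm (v - (r / norm \<nu>) *\<^sub>R \<nu>) < r" using y by (simp add: v_def z_def dist_norm norm_minus_commute algebra_simps)
      then have "(norm (v - (r / norm \<nu>) *\<^sub>R \<nu>))\<^sup>2 < r\<^sup>2" by (intro power_strict_mono) auto
      then have v1: "(norm v)\<^sup>2 < 2 * r / norm \<nu> * lf v" using expand[of v] by simp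
      then have "0 < 2 * r / norm \<nu> * lf v" using zero_le_power2[of "norm v"] by linarith
      moreover have k0: "0 < 2 * r / norm \<nu>" using r n0 by simp
      ultimately have l0: "0 < lf v" by (rule zero_less_mult_pos)
      have kk: "2 * r / norm \<nu> \<le> 2 * r" using divide_left_mono[of 1 "norm \<nu>" "2 * r"] r \<nu>1 n0 by simp
      have "2 * r / norm \<nu> * lf v \<le> 2 * r * lf v" by (rule mult_right_mono[OF kk]) (use l0 in simp)
      then have v2: "(norm v)\<^sup>2 < 2 * r * lf v" using v1 by linarith
      have "norm v \<le> norm (v - (r / norm \<nu>) *\<^sub>R \<nu>) + norm ((r / norm \<nu>) *\<^sub>R \<nu>)" by (metis diff_add_cancel norm_triangle_ineq)
      also have "norm ((r / norm \<nu>) *\<^sub>R \<nu>) = r" using n0 r by simp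
      finally have "norm v < 2 * r" using \<open>norm (v - (r / norm \<nu>) *\<^sub>R \<nu>) < r\<close> by linarith
      moreover have "dist y x0 \<le> norm v + dist xb x0" using dist_triangle[of y x0 xb] by (simp add: v_def dist_norm)
      ultimately have y0: "y \<in> ball x0 r0" using xb0 r by (simp add: dist_commute)
      have "\<gamma> (\<pi> x + \<pi> v) - \<gamma> (\<pi> x) \<le> blinfun_apply A (\<pi> v) + L * (norm (\<pi> v))\<^sup>2"
        unfolding A_def by (rule C11_taylor[OF d\<gamma> L])
      moreover have "L * (norm (\<pi> v))\<^sup>2 \<le> L' * (norm v)\<^sup>2"
        using \<pi>norm[of v] L' L0 by (intro mult_mono power_mono) auto
      moreover have "\<pi> y = \<pi> x + \<pi> v" "y \<bullet> e = \<gamma> (\<pi> x) + v \<bullet> e"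
        by (simp_all add: v_def \<pi>diff \<pi>xb inner_diff_left xbe)
      ultimately have "lf v - L' * (norm v)\<^sup>2 \<le> T y" by (simp add: T_def lf_def)
      moreover have "L' * (norm v)\<^sup>2 < lf v"
      proof -
        have "L' * (norm v)\<^sup>2 < L' * (2 * r * lf v)" using v2 L' by (intro mult_strict_left_mono) auto
        also have "\<dots> \<le> L' * (2 * (1 / (2 * L')) * lf v)" using r(3) l0 L' by (intro mult_left_mono mult_right_mono) auto
        also have "\<dots> = lf v" using L' by simp
        finally show ?thesis .
      qed
      ultimately have "0 < T y" by linarith
      then show "y \<in> \<Omega>" using T[OF y0] by simp
    qed
    have zS: "\<forall>y\<in>cball z (r / 2). 2 * \<eta> \<le> u y"
    proof
      fix y assume y: "y \<in> cball z (r / 2)"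
      have "y \<in> \<Omega>" using y zball r by force
      moreover have "r / 2 \<le> dist y w" if "w \<notin> \<Omega>" for w
      proof -
        have "r \<le> dist z w" using that zball by force
        then show ?thesis using dist_triangle[of z w y] y by simp
      qed
      ultimately have "y \<in> S" using closure_subset[of \<Omega>] by (auto simp: S_def)
      then show "2 * \<eta> \<le> u y" by (rule \<eta>(2))
    qed
    have lte: "lf (t *\<^sub>R e) = t" using e\<nu> unfolding \<nu>[symmetric] by simp
    have "x - z = t *\<^sub>R e - (r / norm \<nu>) *\<^sub>R \<nu>" by (simp add: z_def xb_def)
    then have nxz: "(norm (x - z))\<^sup>2 = t\<^sup>2 - 2 * r / norm \<nu> * t + r\<^sup>2" using expand[of "t *\<^sub>R e"] lte e by simp
    have rn: "r / (1 + 2 * B) \<le> r / norm \<nu>" using \<nu>B n0 r B by (intro divide_left_mono) auto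
    have low: "r / (1 + 2 * B) * t \<le> r\<^sup>2 - (norm (x - z))\<^sup>2"
    proof -
      have "t * t \<le> r / norm \<nu> * t" using t \<tau>(2) rn by (intro mult_right_mono) auto
      moreover have "r / (1 + 2 * B) * t \<le> r / norm \<nu> * t" using rn t by (intro mult_right_mono) auto
      ultimately show ?thesis unfolding nxz by (simp add: power2_eq_square)
    qed
    have pos: "0 < r / (1 + 2 * B) * t" using r B t by simp
    then have "(norm (x - z))\<^sup>2 < r\<^sup>2" using low by linarith
    then have "norm (x - z) < r" using r by (simp add: power_less_imp_less_base)
    then have "x \<in> ball z r" by (simp add: dist_norm norm_minus_commute)
    from c(2)[OF zball zS this] have ux: "c * ball_profile r s (x - z) \<le> u x" .
    have "closed_segment x xb \<inter> frontier \<Omega> \<noteq> {}"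
      using x(1) xb\<Omega> by (intro connected_Int_frontier) auto
    then obtain w where w: "w \<in> closed_segment x xb" "w \<in> frontier \<Omega>" by blast
    have "infdist x (frontier \<Omega>) \<le> dist x w" using w(2) by (rule infdist_le)
    also have "\<dots> \<le> t" using dist_in_closed_segment(1)[OF w(1)] dxb by (simp add: dist_commute)
    finally have "infdist x (frontier \<Omega>) \<le> t" .
    then have "infdist x (frontier \<Omega>) powr s \<le> t powr s" using s infdist_nonneg by (intro powr_mono2) auto
    then have "c' * infdist x (frontier \<Omega>) powr s \<le> c' * t powr s" using c' by (intro mult_left_mono) auto
    also have "\<dots> = c * (r / (1 + 2 * B) * t) powr s"
    proof -
      have "(r / (1 + 2 * B) * t) powr s = (r / (1 + 2 * B)) powr s * t powr s"
        by (rule powr_mult)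
      then show ?thesis by (simp only: c'_def mult.assoc)
    qed
    also have "\<dots> \<le> c * ball_profile r s (x - z)"
      unfolding ball_profile_def using low pos s c(1) by (intro mult_left_mono powr_mono2) auto
    finally show ?thesis using ux by linarith
  qed
  then show ?thesis using that \<rho>(1) c' by blast
qed

theorem theorem3p4:
  fixes \<Omega> :: "'a::euclidean_space set"
    and p q s1 s2 :: real
    and g :: "real \<Rightarrow> real"
    and u :: "'a \<Rightarrow> real"
  assumes "open \<Omega>" and "connected \<Omega>" and "\<Omega> \<noteq> {}" and "bounded \<Omega>" and "C11_boundary \<Omega>"
    and "1 < q" and "q \<le> p"
    and "0 < s2" and "s2 \<le> s1" and "s1 < 1"
    and "continuous_on UNIV g" and "g \<in> BV_loc"
    and "u \<in> frac_Sobolev_0 \<Omega> s1 p" and "continuous_on (closure \<Omega>) u"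
    and "weak_supersolution s1 p s2 q g \<Omega> u"
    and "\<exists>x\<in>\<Omega>. u x \<noteq> 0"
    and "\<forall>x\<in>\<Omega>. 0 \<le> u x"
  shows "\<exists>c1>0. \<forall>x\<in>\<Omega>. u x \<ge> c1 * infdist x (frontier \<Omega>) powr s1"
proof -
  have s1: "0 < s1" using assms(8,9) by linarith
  have u\<Omega>: "continuous_on \<Omega> u" using assms(14) closure_subset by (rule continuous_on_subset)
  have nonneg: "\<And>x. x \<in> \<Omega> \<Longrightarrow> 0 \<le> u x" using assms(17) by blast
  have ball: "\<exists>c>0. \<forall>z0 x. ball z0 r \<subseteq> \<Omega> \<longrightarrow> (\<forall>y\<in>cball z0 (r / 2). 2 * \<eta> \<le> u y) \<longrightarrow>
       x \<in> ball z0 r \<longrightarrow> c * ball_profile r s1 (x - z0) \<le> u x" if r: "0 < r" and \<eta>: "0 < \<eta>" for r \<eta>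
  proof -
    obtain c where "0 < c" "\<And>z0 x. ball z0 r \<subseteq> \<Omega> \<Longrightarrow> (\<And>y. y \<in> cball z0 (r / 2) \<Longrightarrow> 2 * \<eta> \<le> u y) \<Longrightarrow>
       x \<in> ball z0 r \<Longrightarrow> c * ball_profile r s1 (x - z0) \<le> u x"
      using interior_ball_lower_bound[OF assms(1,4,6-11,13-15) nonneg r \<eta>] by blast
    then show ?thesis by blast
  qed
  have pos: "0 < u x" if "x \<in> \<Omega>" for x
    by (rule strong_minimum_principle[OF assms(1,2) u\<Omega> nonneg assms(16) ball that])
  obtain D where D: "1 \<le> D" "\<And>x. x \<in> \<Omega> \<Longrightarrow> infdist x (frontier \<Omega>) \<le> D"
  proof (cases "frontier \<Omega> = {}")
    case True
    then show ?thesis using that[of 1] by (simp add: infdist_def)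
  next
    case False
    then obtain w where w: "w \<in> frontier \<Omega>" by blast
    obtain R where "\<And>x. x \<in> \<Omega> \<Longrightarrow> dist w x \<le> R" using assms(4) unfolding bounded_any_center[of \<Omega> w] by blast
    then have "infdist x (frontier \<Omega>) \<le> max 1 R" if "x \<in> \<Omega>" for x
      using infdist_le[OF w, of x] that by (force simp: dist_commute le_max_iff_disj)
    then show ?thesis using that[of "max 1 R"] by simp
  qed
  have loc: "\<exists>\<rho> c. 0 < \<rho> \<and> 0 < c \<and> (\<forall>x\<in>\<Omega> \<inter> ball y \<rho>. c * infdist x (frontier \<Omega>) powr s1 \<le> u x)" if y: "y \<in> closure \<Omega>" for y
  proof (cases "y \<in> \<Omega>")
    case False
    then have "y \<in> frontier \<Omega>" using y assms(1) by (simp add: frontier_def interior_open)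
    from hopf_near_boundary_point[OF assms(1,4,5) s1 u\<Omega> pos ball this]
    show ?thesis by (metis IntD1 IntD2)
  next
    case True
    have "isCont u y" using u\<Omega> assms(1) True by (simp add: continuous_on_eq_continuous_at)
    then obtain d where d: "0 < d" "\<And>x. dist x y < d \<Longrightarrow> dist (u x) (u y) < u y / 2"
      using pos[OF True] unfolding continuous_at_eps_delta by (metis half_gt_zero)
    define c where "c = u y / 2 / D powr s1"
    have c: "0 < c" using pos[OF True] D by (simp add: c_def)
    have "c * infdist x (frontier \<Omega>) powr s1 \<le> u x" if x: "x \<in> \<Omega> \<inter> ball y d" for x
    proof -
      have "infdist x (frontier \<Omega>) powr s1 \<le> D powr s1" using D x s1 infdist_nonneg by (intro powr_mono2) auto
      then have "c * infdist x (frontier \<Omega>) powr s1 \<le> c * D powr s1" using c by (intro mult_left_mono) auto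
      also have "\<dots> = u y / 2" using D by (simp add: c_def)
      also have "\<dots> \<le> u x"
      proof -
        have "dist x y < d" using x by (simp add: dist_commute)
        then have "\<bar>u x - u y\<bar> < u y / 2" using d(2) unfolding dist_real_def by blast
        then show ?thesis by linarith
      qed
      finally show ?thesis .
    qed
    then show ?thesis using d(1) c by blast
  qed
  then obtain \<rho> C where \<rho>C: "\<And>y. y \<in> closure \<Omega> \<Longrightarrow> 0 < \<rho> y \<and> 0 < C y \<and> (\<forall>x\<in>\<Omega> \<inter> ball y (\<rho> y). C y * infdist x (frontier \<Omega>) powr s1 \<le> u x)"
    by metis
  have cc: "compact (closure \<Omega>)" using assms(4) by (simp add: compact_closure)
  have cov: "closure \<Omega> \<subseteq> (\<Union>y\<in>closure \<Omega>. ball y (\<rho> y))" using \<rho>C by force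
  have "\<exists>Y\<subseteq>closure \<Omega>. finite Y \<and> closure \<Omega> \<subseteq> (\<Union>y\<in>Y. ball y (\<rho> y))"
    by (rule compactE_image[OF cc _ cov], simp, blast)
  then obtain Y where Y: "Y \<subseteq> closure \<Omega>" "finite Y" "closure \<Omega> \<subseteq> (\<Union>y\<in>Y. ball y (\<rho> y))"
    by blast
  have "Y \<noteq> {}" using Y(3) assms(3) closure_subset by force
  define c1 where "c1 = Min (C ` Y)"
  have "0 < c1" unfolding c1_def using Y \<open>Y \<noteq> {}\<close> \<rho>C by (subst Min_gr_iff) auto
  moreover have "c1 * infdist x (frontier \<Omega>) powr s1 \<le> u x" if x: "x \<in> \<Omega>" for x
  proof -
    obtain y where y: "y \<in> Y" "x \<in> ball y (\<rho> y)" using Y(3) x closure_subset by blast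
    have "c1 * infdist x (frontier \<Omega>) powr s1 \<le> C y * infdist x (frontier \<Omega>) powr s1"
      unfolding c1_def using Y(2) y(1) by (intro mult_right_mono) auto
    also have "\<dots> \<le> u x" using \<rho>C[of y] y Y(1) x by blast
    finally show ?thesis .
  qed
  ultimately show ?thesis by blast
qed

end
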